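(* Let $k\ge3$, let $a\in\mathbb{C}$, and let $h$ be the birational map $$h(x_1,\dots,x_k)=\Big(x_2,\dots,x_k,\frac{a+x_2+x_3+\cdots+x_k}{x_1}\Big)$$ of complex $k$-dimensional space. If $k>3$, or if $a\ne1$, then the degree of $h^n$ grows quadratically in $n$.
   Context: The degree of a rational self-map $g$ of $\mathbb{C}^k$ is the degree of its extension to $\mathbf{P}^k$: write $g=[g_0:\cdots:g_k]$ with homogeneous polynomials $g_j$ of a common degree $d$ without common factor; then $\deg g=d$. Here $h^n$ is the $n$-th iterate as a rational map. Quadratic growth of $\deg(h^n)$ means that there are constants $0<c\le C$ with $c\,n^2\le\deg(h^n)\le C\,n^2$ for all sufficiently large $n$. *)

theory Defs
  imports Complex_Main "HOL-Library.Poly_Mapping" "HOL-Computational_Algebra.Fraction_Field"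
begin

text \<open>
  Polynomials and rational functions over the complex numbers, in variables indexed by the
  natural numbers.  A monomial is its finitely supported exponent vector.  The affine coordinates
  are the variables with index 1 to k; index 0 is kept for the homogenising variable.
\<close>

type_synonym mpoly = "(nat \<Rightarrow>\<^sub>0 nat) \<Rightarrow>\<^sub>0 complex"

type_synonym ratfun = "mpoly fract"

definition rf_const :: "complex \<Rightarrow> ratfun" where
  "rf_const c = Fract (Poly_Mapping.single 0 c) 1"

definition rf_var :: "nat \<Rightarrow> ratfun" where
  "rf_var i = Fract (Poly_Mapping.single (Poly_Mapping.single i 1) 1) 1"

definition mpoly_subst :: "mpoly \<Rightarrow> (nat \<Rightarrow> ratfun) \<Rightarrow> ratfun" where
  "mpoly_subst p y =
     (\<Sum>m\<in>Poly_Mapping.keys p. rf_const (Poly_Mapping.lookup p m) *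
        (\<Prod>i\<in>Poly_Mapping.keys m. y i ^ Poly_Mapping.lookup m i))"

text \<open>
  The value does not depend on the fraction p/q chosen, as long as its denominator stays nonzero
  under the substitution.  If there is no such fraction (which cannot happen when y is dominant),
  the result is unspecified.
\<close>

definition rf_subst :: "ratfun \<Rightarrow> (nat \<Rightarrow> ratfun) \<Rightarrow> ratfun" where
  "rf_subst r y =
     (THE z. \<exists>p q. q \<noteq> 0 \<and> r = Fract p q \<and> mpoly_subst q y \<noteq> 0 \<and>
                   z = mpoly_subst p y / mpoly_subst q y)"

text \<open>
  A rational self-map of k-dimensional affine space is given by its coordinate functions
  f 1, ..., f k, rational functions of the variables 1 to k.  Values of f outside the
  indices 1 to k carry no meaning.
\<close>

type_synonym ratmap = "nat \<Rightarrow> ratfun"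

definition ratmap_comp :: "ratmap \<Rightarrow> ratmap \<Rightarrow> ratmap" where
  "ratmap_comp f g = (\<lambda>i. rf_subst (f i) g)"

definition ratmap_iterate :: "nat \<Rightarrow> ratmap \<Rightarrow> ratmap" where
  "ratmap_iterate n f = (ratmap_comp f ^^ n) rf_var"

definition homogeneous_mpoly :: "nat \<Rightarrow> nat \<Rightarrow> mpoly \<Rightarrow> bool" where
  "homogeneous_mpoly k d p \<longleftrightarrow>
     (\<forall>m\<in>Poly_Mapping.keys p. Poly_Mapping.keys m \<subseteq> {0..k} \<and>
        (\<Sum>i\<in>Poly_Mapping.keys m. Poly_Mapping.lookup m i) = d)"

text \<open>
  The tuple g 0, ..., g k gives the extension [g 0 : ... : g k] of f to projective space:
  homogeneous of common degree d, without common factor, and equal to f in the affine chart where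
  the homogeneous coordinate of index 0 is 1.
\<close>

definition proj_extension :: "nat \<Rightarrow> ratmap \<Rightarrow> nat \<Rightarrow> (nat \<Rightarrow> mpoly) \<Rightarrow> bool" where
  "proj_extension k f d g \<longleftrightarrow>
     (\<forall>j\<in>{0..k}. homogeneous_mpoly k d (g j)) \<and>
     (\<forall>c. (\<forall>j\<in>{0..k}. c dvd g j) \<longrightarrow> c dvd 1) \<and>
     mpoly_subst (g 0) (rf_var(0 := 1)) \<noteq> 0 \<and>
     (\<forall>i\<in>{1..k}. f i = mpoly_subst (g i) (rf_var(0 := 1)) / mpoly_subst (g 0) (rf_var(0 := 1)))"

definition ratmap_degree :: "nat \<Rightarrow> ratmap \<Rightarrow> nat" where
  "ratmap_degree k f = (THE d. \<exists>g. proj_extension k f d g)"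

definition grows_quadratically :: "(nat \<Rightarrow> nat) \<Rightarrow> bool" where
  "grows_quadratically u \<longleftrightarrow>
     (\<exists>c C :: real. 0 < c \<and> c \<le> C \<and>
        (\<forall>\<^sub>F n in sequentially. c * (real n)\<^sup>2 \<le> real (u n) \<and> real (u n) \<le> C * (real n)\<^sup>2))"

definition lyness_map :: "nat \<Rightarrow> complex \<Rightarrow> ratmap" where
  "lyness_map k a = (\<lambda>i. if i < k then rf_var (i + 1)
                         else (rf_const a + (\<Sum>j = 2..k. rf_var j)) / rf_var 1)"

end

theory Submission
  imports Defs "HOL-Computational_Algebra.Factorial_Ring"
begin

text \<open>The n-th iterate has the coordinates X (n + 1), ..., X (n + k), where X i = x i for i \<le> k and
  X n X (n + k) = a + X (n + 1) + ... + X (n + k - 1). Along the divisor of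
  ell = a + x 2 + ... + x k the sequence has simple zeros at X (k + 1) and X (3 k + 2), simple poles
  at X (2 k + 1) and X (2 k + 2), and the singularity is confined. Hence
  X n = tau n tau (n - 2 k - 1) / (tau (n - k) tau (n - k - 1)), where tau n is the product of the
  X i ^ c (n - i), c having the generating function 1 / ((1 - t ^ k) (1 - t ^ (k + 1))); the tau n
  are Laurent polynomials, and the two factors of the denominator have no prime factor in common
  with tau n other than the variables.

  The weighted degrees of the X n are bounded by the tropical recurrence, which has a first
  integral and therefore bounded orbits. As the c sum to O(n ^ 2), so do the degrees of the tau n.
  For the lower bound, the tropical recurrence has solutions p and 1 - p with values 0 and 1,
  antiperiodic under a shift by k; as the coefficients of the recurrence other than a are positive,
  no leading terms cancel and the weighted degrees of tau n for p and 1 - p are exact. Their sum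
  exceeds the degree for the weight 1 by a quantity of order n ^ 2, which by coprimality survives
  in the reduced degree of the iterate.\<close>

section \<open>Polynomials and their evaluation\<close>

text \<open>The exponents c are forced by the singularity: the zeros and poles along ell have the
  generating function t^(k+1) (1 - t^k) (1 - t^(k+1)), so convolution with c leaves a single zero,
  that of tau (k + 1). Apart from the variables, one shift creates new poles along ell only. Any
  other prime can therefore be followed back one index at a time; along ell itself the sequence is
  shifted by \<open>M\<close> = 3 k + 2 indices at once, to the window of k units behind the
  singularity. For coprimality one must also know to which prime ell goes under this jump: the map
  is reversible and the pattern symmetric, which identifies it as ell with its variables reversed.
  The valuations are read off at one point of ell = 0, found near a degenerate limit d -> 0 whose
  leading term is nonzero exactly when k > 3 or a \<noteq> 1. For k = 3, a = 1 the sequence is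
  periodic. The weights p and 1 - p are used as a pair because powers of the variables in tau n may
  cancel in the iterate: their contribution is additive in the weight and drops out when the degree
  for the weight 1 is subtracted.\<close>

definition mconst :: "complex \<Rightarrow> mpoly" where
  "mconst c = Poly_Mapping.single 0 c"

definition mvar :: "nat \<Rightarrow> mpoly" where
  "mvar i = Poly_Mapping.single (Poly_Mapping.single i 1) 1"

definition mon :: "(nat \<Rightarrow> 'a::comm_ring_1) \<Rightarrow> (nat \<Rightarrow>\<^sub>0 nat) \<Rightarrow> 'a" where
  "mon y m = (\<Prod>i\<in>Poly_Mapping.keys m. y i ^ Poly_Mapping.lookup m i)"

text \<open>The coefficient map h is a parameter because three targets occur: \<open>mconst\<close>
  for polynomial substitution, \<open>rf_const\<close> for rational functions, \<open>id\<close> for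
  points of complex space.\<close>

definition peval :: "(complex \<Rightarrow> 'a::comm_ring_1) \<Rightarrow> (nat \<Rightarrow> 'a) \<Rightarrow> mpoly \<Rightarrow> 'a" where
  "peval h y p = (\<Sum>m\<in>Poly_Mapping.keys p. h (Poly_Mapping.lookup p m) * mon y m)"

definition coeff_hom :: "(complex \<Rightarrow> 'a::comm_ring_1) \<Rightarrow> bool" where
  "coeff_hom h \<longleftrightarrow> h 1 = 1 \<and> (\<forall>a b. h (a + b) = h a + h b) \<and> (\<forall>a b. h (a * b) = h a * h b)"

lemma coeff_hom_simps:
  assumes "coeff_hom h"
  shows "h 1 = 1" "h (a + b) = h a + h b" "h (a * b) = h a * h b" "h 0 = 0"
proof -
  show "h 1 = 1" "h (a + b) = h a + h b" "h (a * b) = h a * h b"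
    using assms by (auto simp: coeff_hom_def)
  have "h (0 + 0) = h 0 + h 0"
    using assms unfolding coeff_hom_def by blast
  then show "h 0 = 0" by simp
qed

lemma mon_superset:
  assumes "finite S" "Poly_Mapping.keys m \<subseteq> S"
  shows "mon y m = (\<Prod>i\<in>S. y i ^ Poly_Mapping.lookup m i)"
  unfolding mon_def
  by (rule prod.mono_neutral_left) (use assms in \<open>auto simp: in_keys_iff\<close>)

lemma mon_zero [simp]: "mon y 0 = 1"
  by (simp add: mon_def)

lemma mon_single [simp]: "mon y (Poly_Mapping.single i n) = y i ^ n"
  by (cases "n = 0") (simp_all add: mon_def)

lemma mon_add: "mon y (m + n) = mon y m * mon y n"
proof -
  let ?S = "Poly_Mapping.keys m \<union> Poly_Mapping.keys n"
  have "mon y (m + n) = (\<Prod>i\<in>?S. y i ^ Poly_Mapping.lookup (m + n) i)"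
    by (rule mon_superset) (use keys_add[of m n] in auto)
  also have "\<dots> = (\<Prod>i\<in>?S. y i ^ Poly_Mapping.lookup m i) * (\<Prod>i\<in>?S. y i ^ Poly_Mapping.lookup n i)"
    by (simp add: lookup_add power_add prod.distrib)
  also have "\<dots> = mon y m * mon y n"
    by (simp add: mon_superset[of ?S])
  finally show ?thesis .
qed

lemma peval_superset:
  assumes "coeff_hom h" "finite S" "Poly_Mapping.keys p \<subseteq> S"
  shows "peval h y p = (\<Sum>m\<in>S. h (Poly_Mapping.lookup p m) * mon y m)"
  unfolding peval_def
  by (rule sum.mono_neutral_left)
     (use assms in \<open>auto simp: in_keys_iff coeff_hom_simps\<close>)

lemma peval_add:
  assumes "coeff_hom h"
  shows "peval h y (p + q) = peval h y p + peval h y q"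
proof -
  let ?S = "Poly_Mapping.keys p \<union> Poly_Mapping.keys q"
  have "peval h y (p + q) = (\<Sum>m\<in>?S. h (Poly_Mapping.lookup (p + q) m) * mon y m)"
    by (rule peval_superset) (use assms keys_add[of p q] in auto)
  also have "\<dots> = (\<Sum>m\<in>?S. h (Poly_Mapping.lookup p m) * mon y m)
                + (\<Sum>m\<in>?S. h (Poly_Mapping.lookup q m) * mon y m)"
    by (simp add: lookup_add coeff_hom_simps[OF assms] distrib_right sum.distrib)
  also have "\<dots> = peval h y p + peval h y q"
    using assms by (simp add: peval_superset[of h ?S])
  finally show ?thesis .
qed

lemma peval_single:
  assumes "coeff_hom h"
  shows "peval h y (Poly_Mapping.single m c) = h c * mon y m"
  by (cases "c = 0") (simp_all add: peval_def coeff_hom_simps[OF assms])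

lemma mpoly_eq_sum_singles:
  "p = (\<Sum>m\<in>Poly_Mapping.keys p. Poly_Mapping.single m (Poly_Mapping.lookup p m))"
proof (rule poly_mapping_eqI)
  fix n
  have "Poly_Mapping.lookup (\<Sum>m\<in>Poly_Mapping.keys p. Poly_Mapping.single m (Poly_Mapping.lookup p m)) n
      = (\<Sum>m\<in>Poly_Mapping.keys p. Poly_Mapping.lookup p m when m = n)"
    by (simp add: lookup_sum lookup_single)
  also have "\<dots> = Poly_Mapping.lookup p n"
    by (simp add: when_def sum.delta in_keys_iff)
  finally show "Poly_Mapping.lookup p n
      = Poly_Mapping.lookup (\<Sum>m\<in>Poly_Mapping.keys p. Poly_Mapping.single m (Poly_Mapping.lookup p m)) n"
    by simp
qed

lemma mpoly_single_induct [case_names single add]: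
  fixes p :: mpoly
  assumes single: "\<And>m c. P (Poly_Mapping.single m c)"
    and add: "\<And>p q. P p \<Longrightarrow> P q \<Longrightarrow> P (p + q)"
  shows "P p"
proof -
  have zero: "P 0" using single[of 0 0] by simp
  have "P (\<Sum>m\<in>S. Poly_Mapping.single m (Poly_Mapping.lookup p m))" if "finite S" for S
    using that by (induction S) (auto intro: zero single add)
  then show ?thesis
    using mpoly_eq_sum_singles[of p] by (metis finite_keys)
qed

lemma peval_mult:
  assumes h: "coeff_hom h"
  shows "peval h y (p * q) = peval h y p * peval h y q"
proof (induction p rule: mpoly_single_induct)
  case (single m c)
  show ?case
  proof (induction q rule: mpoly_single_induct)
    case (single n d)
    show ?case
      by (simp add: mult_single peval_single[OF h] coeff_hom_simps[OF h] mon_add algebra_simps)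
  next
    case (add p q)
    then show ?case by (simp add: distrib_left peval_add[OF h])
  qed
next
  case (add p q)
  then show ?case by (simp add: distrib_right peval_add[OF h])
qed

lemma peval_const [simp]:
  assumes "coeff_hom h"
  shows "peval h y (mconst c) = h c"
  by (simp add: mconst_def peval_single[OF assms])

lemma peval_var [simp]:
  assumes "coeff_hom h"
  shows "peval h y (mvar i) = y i"
  by (simp add: mvar_def peval_single[OF assms] coeff_hom_simps[OF assms])

lemma mconst_1 [simp]: "mconst 1 = 1" and mconst_0 [simp]: "mconst 0 = 0"
  by (simp_all add: mconst_def)

lemma coeff_hom_mconst: "coeff_hom mconst"
  by (simp add: coeff_hom_def mconst_def single_add mult_single)

lemma coeff_hom_rf_const: "coeff_hom rf_const"
  by (simp add: coeff_hom_def rf_const_def single_add mult_single One_fract_def)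

lemma coeff_hom_id: "coeff_hom id"
  by (simp add: coeff_hom_def)

lemma peval_0 [simp]: "peval h y 0 = 0"
  by (simp add: peval_def)

lemma peval_1 [simp]:
  assumes "coeff_hom h" shows "peval h y 1 = 1"
  using peval_const[OF assms, of y 1] coeff_hom_simps[OF assms] by simp

lemma peval_uminus:
  assumes "coeff_hom h" shows "peval h y (- p) = - peval h y p"
  using peval_add[OF assms, of y p "- p"] by (simp add: eq_neg_iff_add_eq_0 add.commute)

lemma peval_diff:
  assumes "coeff_hom h" shows "peval h y (p - q) = peval h y p - peval h y q"
  using peval_add[OF assms, of y p "- q"] by (simp add: peval_uminus[OF assms])

lemma peval_power:
  assumes "coeff_hom h" shows "peval h y (p ^ n) = peval h y p ^ n"
  using assms by (induction n) (simp_all add: peval_mult)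

lemma peval_sum:
  assumes "coeff_hom h" shows "peval h y (sum f S) = (\<Sum>i\<in>S. peval h y (f i))"
  using assms by (induction S rule: infinite_finite_induct) (simp_all add: peval_add)

lemma peval_prod:
  assumes "coeff_hom h" shows "peval h y (prod f S) = (\<Prod>i\<in>S. peval h y (f i))"
  using assms by (induction S rule: infinite_finite_induct) (simp_all add: peval_mult)

lemma mon_mvar: "mon mvar m = Poly_Mapping.single m 1"
proof -
  have pow: "mvar i ^ n = Poly_Mapping.single (Poly_Mapping.single i n) 1" for i n
    by (induction n) (simp_all add: mvar_def mult_single single_add[symmetric])
  have "(\<Prod>i\<in>S. mvar i ^ l i) = Poly_Mapping.single (\<Sum>i\<in>S. Poly_Mapping.single i (l i)) 1"
    if "finite S" for S l
    using that by (induction S) (simp_all add: pow mult_single)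
  moreover have "(\<Sum>i\<in>Poly_Mapping.keys m. Poly_Mapping.single i (Poly_Mapping.lookup m i)) = m"
    by (rule poly_mapping_eqI) (simp add: lookup_sum lookup_single when_def sum.delta in_keys_iff)
  ultimately show ?thesis by (simp add: mon_def)
qed

lemma single_eq_const_mon: "Poly_Mapping.single m c = mconst c * mon mvar m"
  by (simp add: mon_mvar mconst_def mult_single)

lemma mpoly_induct [case_names const var add mult]:
  fixes p :: mpoly
  assumes const: "\<And>c. P (mconst c)" and var: "\<And>i. P (mvar i)"
    and add: "\<And>p q. P p \<Longrightarrow> P q \<Longrightarrow> P (p + q)"
    and mult: "\<And>p q. P p \<Longrightarrow> P q \<Longrightarrow> P (p * q)"
  shows "P p"
proof (induction p rule: mpoly_single_induct)
  case (single m c)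
  have one: "P 1" using const[of 1] by simp
  have pow: "P (mvar i ^ n)" for i n
    by (induction n) (auto intro: one var mult)
  have "P (\<Prod>i\<in>S. mvar i ^ l i)" if "finite S" for S and l :: "nat \<Rightarrow> nat"
    using that by (induction S) (auto intro: one mult pow)
  then show ?case
    by (simp add: single_eq_const_mon mon_def const mult)
qed (rule add)

lemma peval_peval:
  assumes "coeff_hom h"
  shows "peval h y (peval mconst z p) = peval h (\<lambda>i. peval h y (z i)) p"
  by (induction p rule: mpoly_induct)
     (simp_all add: peval_add[OF assms] peval_mult[OF assms] assms coeff_hom_mconst peval_add peval_mult)

lemma peval_mvar [simp]: "peval mconst mvar p = p"
  by (induction p rule: mpoly_induct) (simp_all add: coeff_hom_mconst peval_add peval_mult)

section \<open>Weighted degrees\<close>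

definition mweight :: "(nat \<Rightarrow> int) \<Rightarrow> (nat \<Rightarrow>\<^sub>0 nat) \<Rightarrow> int" where
  "mweight q m = (\<Sum>i\<in>Poly_Mapping.keys m. int (Poly_Mapping.lookup m i) * q i)"

text \<open>Weights may be negative: the constant weight - 1 gives minus the lowest total degree,
  and minus an indicator gives minus the order of vanishing along a variable. The value 0 at the
  zero polynomial is a convention, hence the side conditions on nonzero polynomials.\<close>

definition wdeg :: "(nat \<Rightarrow> int) \<Rightarrow> mpoly \<Rightarrow> int" where
  "wdeg q p = (if p = 0 then 0 else Max (mweight q ` Poly_Mapping.keys p))"

lemma mweight_superset:
  assumes "finite S" "Poly_Mapping.keys m \<subseteq> S"
  shows "mweight q m = (\<Sum>i\<in>S. int (Poly_Mapping.lookup m i) * q i)"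
  unfolding mweight_def
  by (rule sum.mono_neutral_left) (use assms in \<open>auto simp: in_keys_iff\<close>)

lemma mweight_add: "mweight q (m + n) = mweight q m + mweight q n"
proof -
  let ?S = "Poly_Mapping.keys m \<union> Poly_Mapping.keys n"
  have "mweight q (m + n) = (\<Sum>i\<in>?S. int (Poly_Mapping.lookup (m + n) i) * q i)"
    by (rule mweight_superset) (use keys_add[of m n] in auto)
  also have "\<dots> = (\<Sum>i\<in>?S. int (Poly_Mapping.lookup m i) * q i) + (\<Sum>i\<in>?S. int (Poly_Mapping.lookup n i) * q i)"
    by (simp add: lookup_add algebra_simps sum.distrib)
  also have "\<dots> = mweight q m + mweight q n"
    by (simp add: mweight_superset[of ?S])
  finally show ?thesis .
qed

lemma mweight_zero [simp]: "mweight q 0 = 0"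
  by (simp add: mweight_def)

lemma mweight_single [simp]: "mweight q (Poly_Mapping.single i n) = int n * q i"
  by (cases "n = 0") (simp_all add: mweight_def)

lemma wdeg_ge: "m \<in> Poly_Mapping.keys p \<Longrightarrow> mweight q m \<le> wdeg q p"
  by (auto simp: wdeg_def)

lemma wdeg_leI: "p \<noteq> 0 \<Longrightarrow> (\<And>m. m \<in> Poly_Mapping.keys p \<Longrightarrow> mweight q m \<le> e) \<Longrightarrow> wdeg q p \<le> e"
  by (auto simp: wdeg_def)

lemma wdeg_attained:
  assumes "p \<noteq> 0"
  obtains m where "m \<in> Poly_Mapping.keys p" "mweight q m = wdeg q p"
proof -
  have "Max (mweight q ` Poly_Mapping.keys p) \<in> mweight q ` Poly_Mapping.keys p"
    using assms by (intro Max_in) auto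
  then have "wdeg q p \<in> mweight q ` Poly_Mapping.keys p"
    using assms by (simp add: wdeg_def)
  then show ?thesis using that by (metis imageE)
qed

lemma wdeg_0 [simp]: "wdeg q 0 = 0"
  by (simp add: wdeg_def)

lemma wdeg_single: "c \<noteq> 0 \<Longrightarrow> wdeg q (Poly_Mapping.single m c) = mweight q m"
  by (auto simp: wdeg_def dest!: arg_cong[of _ 0 "\<lambda>p. Poly_Mapping.lookup p m"])

lemma wdeg_mconst [simp]: "wdeg q (mconst c) = 0"
  by (cases "c = 0") (simp_all add: mconst_def wdeg_single)

lemma wdeg_1 [simp]: "wdeg q 1 = 0"
  using wdeg_mconst[of q 1] by simp

lemma wdeg_mvar [simp]: "wdeg q (mvar i) = q i"
  by (simp add: mvar_def wdeg_single)

lemma mvar_neq_0 [simp]: "mvar i \<noteq> 0"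
  by (metis lookup_single_eq lookup_zero mvar_def zero_neq_one)

lemma wdeg_top_part:
  assumes "p \<noteq> 0"
  obtains t r where "p = t + r" "t \<noteq> 0"
    "\<And>m. m \<in> Poly_Mapping.keys t \<Longrightarrow> m \<in> Poly_Mapping.keys p \<and> mweight q m = wdeg q p"
    "\<And>m. m \<in> Poly_Mapping.keys r \<Longrightarrow> m \<in> Poly_Mapping.keys p \<and> mweight q m < wdeg q p"
proof -
  let ?K = "Poly_Mapping.keys p"
  let ?s = "\<lambda>m. Poly_Mapping.single m (Poly_Mapping.lookup p m)"
  define t where "t = (\<Sum>m\<in>{m\<in>?K. mweight q m = wdeg q p}. ?s m)"
  define r where "r = (\<Sum>m\<in>{m\<in>?K. mweight q m \<noteq> wdeg q p}. ?s m)"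
  have lt: "Poly_Mapping.lookup t n = (if n \<in> ?K \<and> mweight q n = wdeg q p then Poly_Mapping.lookup p n else 0)" for n
    by (simp add: t_def lookup_sum lookup_single when_def sum.delta)
  have lr: "Poly_Mapping.lookup r n = (if n \<in> ?K \<and> mweight q n \<noteq> wdeg q p then Poly_Mapping.lookup p n else 0)" for n
    by (simp add: r_def lookup_sum lookup_single when_def sum.delta)
  have "p = t + r"
    by (rule poly_mapping_eqI) (auto simp: lookup_add lt lr in_keys_iff)
  moreover have "t \<noteq> 0"
  proof -
    obtain m where "m \<in> ?K" "mweight q m = wdeg q p"
      using wdeg_attained[OF assms] by blast
    then have "Poly_Mapping.lookup t m \<noteq> 0" by (simp add: lt in_keys_iff)
    then show ?thesis by auto
  qed
  moreover have "m \<in> ?K \<and> mweight q m = wdeg q p" if "m \<in> Poly_Mapping.keys t" for m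
    using that by (auto simp: in_keys_iff lt split: if_splits)
  moreover have "m \<in> ?K \<and> mweight q m < wdeg q p" if "m \<in> Poly_Mapping.keys r" for m
    using that wdeg_ge[of m p q] by (fastforce simp: in_keys_iff lr split: if_splits)
  ultimately show ?thesis using that by blast
qed

text \<open>Equality holds because the top-weight parts t and u have a nonzero product in a domain,
  and the remaining terms t * s + r * g have strictly smaller weight, so they cannot cancel
  it.\<close>

lemma wdeg_mult:
  assumes f: "f \<noteq> 0" and g: "g \<noteq> 0"
  shows "wdeg q (f * g) = wdeg q f + wdeg q g"
proof (rule antisym)
  have fg: "f * g \<noteq> 0" using assms by simp
  show "wdeg q (f * g) \<le> wdeg q f + wdeg q g"
  proof (rule wdeg_leI[OF fg])
    fix m assume "m \<in> Poly_Mapping.keys (f * g)"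
    then obtain a b where "m = a + b" "a \<in> Poly_Mapping.keys f" "b \<in> Poly_Mapping.keys g"
      using keys_mult[of f g] by auto
    then show "mweight q m \<le> wdeg q f + wdeg q g"
      using wdeg_ge[of a f q] wdeg_ge[of b g q] by (simp add: mweight_add)
  qed
  obtain t r where tr: "f = t + r" "t \<noteq> 0"
    "\<And>m. m \<in> Poly_Mapping.keys t \<Longrightarrow> m \<in> Poly_Mapping.keys f \<and> mweight q m = wdeg q f"
    "\<And>m. m \<in> Poly_Mapping.keys r \<Longrightarrow> m \<in> Poly_Mapping.keys f \<and> mweight q m < wdeg q f"
    by (rule wdeg_top_part[OF f, of q]) blast
  obtain u s where us: "g = u + s" "u \<noteq> 0"
    "\<And>m. m \<in> Poly_Mapping.keys u \<Longrightarrow> m \<in> Poly_Mapping.keys g \<and> mweight q m = wdeg q g"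
    "\<And>m. m \<in> Poly_Mapping.keys s \<Longrightarrow> m \<in> Poly_Mapping.keys g \<and> mweight q m < wdeg q g"
    by (rule wdeg_top_part[OF g, of q]) blast
  have "t * u \<noteq> 0" using tr us by simp
  then obtain m where m: "m \<in> Poly_Mapping.keys (t * u)"
    by (meson keys_eq_empty equals0I)
  then obtain a b where ab: "m = a + b" "a \<in> Poly_Mapping.keys t" "b \<in> Poly_Mapping.keys u"
    using keys_mult[of t u] by auto
  then have mw: "mweight q m = wdeg q f + wdeg q g"
    using tr(3)[of a] us(3)[of b] by (simp add: mweight_add)
  have no1: "m \<notin> Poly_Mapping.keys (r * g)"
  proof
    assume "m \<in> Poly_Mapping.keys (r * g)"
    then obtain a b where "m = a + b" "a \<in> Poly_Mapping.keys r" "b \<in> Poly_Mapping.keys g"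
      using keys_mult[of r g] by auto
    then show False using mw tr(4)[of a] wdeg_ge[of b g q] by (simp add: mweight_add)
  qed
  have no2: "m \<notin> Poly_Mapping.keys (t * s)"
  proof
    assume "m \<in> Poly_Mapping.keys (t * s)"
    then obtain a b where "m = a + b" "a \<in> Poly_Mapping.keys t" "b \<in> Poly_Mapping.keys s"
      using keys_mult[of t s] by auto
    then show False using mw tr(3)[of a] us(4)[of b] by (simp add: mweight_add)
  qed
  have "f * g = t * u + (t * s + r * g)"
    using tr(1) us(1) by (simp add: algebra_simps)
  then have "Poly_Mapping.lookup (f * g) m = Poly_Mapping.lookup (t * u) m"
    using no1 no2 by (simp add: lookup_add in_keys_iff)
  then have "m \<in> Poly_Mapping.keys (f * g)"
    using m by (simp add: in_keys_iff)
  then show "wdeg q f + wdeg q g \<le> wdeg q (f * g)"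
    using wdeg_ge[of m "f * g" q] mw by simp
qed

lemma wdeg_power: "f \<noteq> 0 \<Longrightarrow> wdeg q (f ^ n) = int n * wdeg q f"
  by (induction n) (simp_all add: wdeg_mult algebra_simps)

lemma wdeg_prod:
  "(\<And>i. i \<in> S \<Longrightarrow> f i \<noteq> 0) \<Longrightarrow> wdeg q (prod f S) = (\<Sum>i\<in>S. wdeg q (f i))"
  by (induction S rule: infinite_finite_induct) (simp_all add: wdeg_mult)

lemma wdeg_add_le:
  assumes "f + g \<noteq> 0" "f \<noteq> 0 \<Longrightarrow> wdeg q f \<le> e" "g \<noteq> 0 \<Longrightarrow> wdeg q g \<le> e"
  shows "wdeg q (f + g) \<le> e"
proof (rule wdeg_leI[OF assms(1)])
  fix m assume "m \<in> Poly_Mapping.keys (f + g)"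
  then consider "m \<in> Poly_Mapping.keys f" | "m \<in> Poly_Mapping.keys g"
    using keys_add[of f g] by auto
  then show "mweight q m \<le> e"
    by cases (use wdeg_ge[of m f q] wdeg_ge[of m g q] assms in fastforce)+
qed

lemma wdeg_uminus [simp]: "wdeg q (- f) = wdeg q f"
  by (simp add: wdeg_def)

lemma wdeg_nonneg:
  assumes "\<And>i. q i \<ge> 0"
  shows "wdeg q p \<ge> 0"
proof (cases "p = 0")
  case False
  then obtain m where "m \<in> Poly_Mapping.keys p" "mweight q m = wdeg q p"
    by (rule wdeg_attained)
  moreover have "mweight q m \<ge> 0"
    unfolding mweight_def by (intro sum_nonneg) (simp add: assms)
  ultimately show ?thesis by simp
qed simp

abbreviation tdeg :: "mpoly \<Rightarrow> int" where "tdeg \<equiv> wdeg (\<lambda>_. 1)"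

lemma tdeg_nonneg: "tdeg p \<ge> 0"
  by (rule wdeg_nonneg) simp

lemma tdeg_eq_0_imp_const:
  assumes "tdeg p = 0"
  obtains c where "p = mconst c"
proof -
  have "m = 0" if "m \<in> Poly_Mapping.keys p" for m
  proof -
    have "mweight (\<lambda>_. 1) m \<le> 0" using wdeg_ge[OF that, of "\<lambda>_. 1"] assms by simp
    then have "(\<Sum>i\<in>Poly_Mapping.keys m. Poly_Mapping.lookup m i) = 0"
      by (simp add: mweight_def flip: of_nat_sum)
    then have "\<forall>i\<in>Poly_Mapping.keys m. Poly_Mapping.lookup m i = 0" by simp
    then show ?thesis by (simp add: in_keys_iff poly_mapping_eqI)
  qed
  then have "Poly_Mapping.keys p \<subseteq> {0}" by auto
  then have "p = mconst (Poly_Mapping.lookup p 0)"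
    unfolding mconst_def
    by (intro poly_mapping_eqI) (auto simp: lookup_single when_def in_keys_iff)
  then show ?thesis by (rule that)
qed

lemma mconst_mult: "mconst a * mconst b = mconst (a * b)"
  by (simp add: mconst_def mult_single)

lemma mconst_eq_0_iff [simp]: "mconst c = 0 \<longleftrightarrow> c = 0"
  by (metis lookup_single_eq lookup_zero mconst_def single_zero)

lemma mpoly_unit_iff: "(p::mpoly) dvd 1 \<longleftrightarrow> p \<noteq> 0 \<and> tdeg p = 0"
proof
  assume "p dvd 1"
  then obtain r where r: "1 = p * r" by (auto simp: dvd_def)
  then have nz: "p \<noteq> 0" "r \<noteq> 0" by auto
  have "tdeg p + tdeg r = 0"
    using wdeg_mult[OF nz, of "\<lambda>_. 1"] by (simp flip: r)
  then show "p \<noteq> 0 \<and> tdeg p = 0"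
    using nz tdeg_nonneg[of p] tdeg_nonneg[of r] by simp
next
  assume p: "p \<noteq> 0 \<and> tdeg p = 0"
  then obtain c where c: "p = mconst c" using tdeg_eq_0_imp_const[of p] by blast
  then have "p * mconst (1 / c) = 1" using p by (simp add: mconst_mult)
  then show "p dvd 1" by (metis dvdI)
qed

section \<open>Unique factorisation\<close>

definition vdeg :: "nat \<Rightarrow> mpoly \<Rightarrow> int" where
  "vdeg i = wdeg (\<lambda>j. if j = i then 1 else 0)"

lemma mweight_indicator: "mweight (\<lambda>j. if j = i then 1 else 0) m = int (Poly_Mapping.lookup m i)"
  by (simp add: mweight_def sum.delta' if_distrib[of "(*) _"] in_keys_iff cong: if_cong)

lemma vdeg_nonneg: "vdeg i p \<ge> 0"
  unfolding vdeg_def by (rule wdeg_nonneg) simp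

lemma vdeg_mult: "f \<noteq> 0 \<Longrightarrow> g \<noteq> 0 \<Longrightarrow> vdeg i (f * g) = vdeg i f + vdeg i g"
  by (simp add: vdeg_def wdeg_mult)

lemma vdeg_ge: "m \<in> Poly_Mapping.keys p \<Longrightarrow> int (Poly_Mapping.lookup m i) \<le> vdeg i p"
  using wdeg_ge[of m p "\<lambda>j. if j = i then 1 else 0"] by (simp add: vdeg_def mweight_indicator)

lemma vdeg_eq_0_iff: "vdeg i p = 0 \<longleftrightarrow> (\<forall>m\<in>Poly_Mapping.keys p. i \<notin> Poly_Mapping.keys m)"
proof (cases "p = 0")
  case False
  show ?thesis
  proof
    assume "vdeg i p = 0"
    then show "\<forall>m\<in>Poly_Mapping.keys p. i \<notin> Poly_Mapping.keys m"
      using vdeg_ge[of _ p i] by (auto simp: in_keys_iff)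
  next
    assume *: "\<forall>m\<in>Poly_Mapping.keys p. i \<notin> Poly_Mapping.keys m"
    have "vdeg i p \<le> 0"
      unfolding vdeg_def
      by (rule wdeg_leI[OF False]) (use * in \<open>auto simp: mweight_indicator in_keys_iff\<close>)
    then show "vdeg i p = 0" using vdeg_nonneg[of i p] by simp
  qed
qed (simp add: vdeg_def)

text \<open>Filtration by the number of variables, along which unique factorisation is proved by
  induction. Every polynomial lies in some member, and a factor of a nonzero element lies in the
  same member.\<close>

definition polys_below :: "nat \<Rightarrow> mpoly set" where
  "polys_below n = {f. \<forall>j\<ge>n. vdeg j f = 0}"

lemma polys_below_iff: "f \<in> polys_below n \<longleftrightarrow> (\<forall>m\<in>Poly_Mapping.keys f. Poly_Mapping.keys m \<subseteq> {..<n})"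
proof
  assume f: "f \<in> polys_below n"
  show "\<forall>m\<in>Poly_Mapping.keys f. Poly_Mapping.keys m \<subseteq> {..<n}"
  proof (intro ballI subsetI)
    fix m i assume "m \<in> Poly_Mapping.keys f" "i \<in> Poly_Mapping.keys m"
    then have "vdeg i f \<noteq> 0" by (auto simp: vdeg_eq_0_iff)
    then have "\<not> n \<le> i" using f by (auto simp: polys_below_def)
    then show "i \<in> {..<n}" by simp
  qed
next
  assume *: "\<forall>m\<in>Poly_Mapping.keys f. Poly_Mapping.keys m \<subseteq> {..<n}"
  have "vdeg j f = 0" if "n \<le> j" for j
  proof -
    have "j \<notin> Poly_Mapping.keys m" if "m \<in> Poly_Mapping.keys f" for m
      using * that \<open>n \<le> j\<close> by force
    then show ?thesis by (simp add: vdeg_eq_0_iff)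
  qed
  then show "f \<in> polys_below n" by (auto simp: polys_below_def)
qed

lemma polys_below_0 [simp]: "0 \<in> polys_below n"
  by (simp add: polys_below_iff)

lemma polys_below_add: "f \<in> polys_below n \<Longrightarrow> g \<in> polys_below n \<Longrightarrow> f + g \<in> polys_below n"
  unfolding polys_below_iff using keys_add[of f g] by blast

lemma polys_below_uminus: "f \<in> polys_below n \<Longrightarrow> - f \<in> polys_below n"
  by (simp add: polys_below_iff)

lemma polys_below_diff: "f \<in> polys_below n \<Longrightarrow> g \<in> polys_below n \<Longrightarrow> f - g \<in> polys_below n"
  using polys_below_add[of f n "- g"] polys_below_uminus[of g n] by simp

lemma polys_below_mult: "f \<in> polys_below n \<Longrightarrow> g \<in> polys_below n \<Longrightarrow> f * g \<in> polys_below n"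
  by (cases "f = 0 \<or> g = 0") (auto simp: polys_below_def vdeg_mult)

lemma polys_below_factor:
  assumes "f * g \<in> polys_below n" "f * g \<noteq> 0"
  shows "f \<in> polys_below n" "g \<in> polys_below n"
proof -
  have nz: "f \<noteq> 0" "g \<noteq> 0" using assms by auto
  have "vdeg j f = 0 \<and> vdeg j g = 0" if "j \<ge> n" for j
    using assms that vdeg_mult[OF nz, of j] vdeg_nonneg[of j f] vdeg_nonneg[of j g]
    by (auto simp: polys_below_def)
  then show "f \<in> polys_below n" "g \<in> polys_below n" by (auto simp: polys_below_def)
qed

lemma polys_below_mono: "f \<in> polys_below n \<Longrightarrow> n \<le> N \<Longrightarrow> f \<in> polys_below N"
  by (auto simp: polys_below_def)

lemma polys_below_const: "mconst c \<in> polys_below n"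
  by (simp add: polys_below_def vdeg_def)

lemma polys_below_var: "i < n \<Longrightarrow> mvar i \<in> polys_below n"
  by (auto simp: polys_below_def vdeg_def)

lemma polys_below_power: "f \<in> polys_below n \<Longrightarrow> f ^ e \<in> polys_below n"
  using polys_below_const[of 1 n] by (induction e) (auto intro: polys_below_mult)

lemma polys_below_exhaust: "\<exists>n. f \<in> polys_below n"
proof (induction f rule: mpoly_induct)
  case (const c) then show ?case by (blast intro: polys_below_const)
next
  case (var i) then show ?case by (blast intro: polys_below_var)
next
  case (add p q)
  then obtain a b where "p \<in> polys_below a" "q \<in> polys_below b" by blast
  then have "p + q \<in> polys_below (max a b)"
    by (intro polys_below_add) (auto intro: polys_below_mono)
  then show ?case ..
next
  case (mult p q)
  then obtain a b where "p \<in> polys_below a" "q \<in> polys_below b" by blast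
  then have "p * q \<in> polys_below (max a b)"
    by (intro polys_below_mult) (auto intro: polys_below_mono)
  then show ?case ..
qed

lemma polys_below_zero_const:
  assumes "f \<in> polys_below 0"
  obtains c where "f = mconst c"
proof -
  have "Poly_Mapping.keys m = {}" if "m \<in> Poly_Mapping.keys f" for m
    using assms that unfolding polys_below_iff by auto
  then have "mweight (\<lambda>_. 1) m = 0" if "m \<in> Poly_Mapping.keys f" for m
    using that by (simp only: mweight_def sum.empty)
  then have "tdeg f \<le> 0"
    by (cases "f = 0") (auto intro: wdeg_leI)
  then show ?thesis using that tdeg_eq_0_imp_const[of f] tdeg_nonneg[of f] by force
qed

text \<open>View of f as a polynomial in the variable n over \<open>polys_below n\<close>, with
  leading coefficient c. The degree claim is conditional because \<open>vdeg n 0 = 0\<close> would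
  violate it for f of degree 0.\<close>

lemma lead_decomp:
  assumes f: "f \<in> polys_below (Suc n)" and nz: "f \<noteq> 0"
  obtains c g where "c \<in> polys_below n" "c \<noteq> 0" "g \<in> polys_below (Suc n)"
    "f = c * mvar n ^ nat (vdeg n f) + g" "g \<noteq> 0 \<Longrightarrow> vdeg n g < vdeg n f"
proof -
  let ?d = "nat (vdeg n f)"
  let ?q = "\<lambda>j. if j = n then 1 else (0::int)"
  obtain t r where tr: "f = t + r" "t \<noteq> 0"
    "\<And>m. m \<in> Poly_Mapping.keys t \<Longrightarrow> m \<in> Poly_Mapping.keys f \<and> mweight ?q m = wdeg ?q f"
    "\<And>m. m \<in> Poly_Mapping.keys r \<Longrightarrow> m \<in> Poly_Mapping.keys f \<and> mweight ?q m < wdeg ?q f"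
    by (rule wdeg_top_part[OF nz, of ?q]) blast
  have exp: "Poly_Mapping.lookup m n = ?d" if "m \<in> Poly_Mapping.keys t" for m
    using tr(3)[OF that] unfolding mweight_indicator vdeg_def by linarith
  define c where "c = (\<Sum>m\<in>Poly_Mapping.keys t. Poly_Mapping.single (m - Poly_Mapping.single n ?d) (Poly_Mapping.lookup t m))"
  have split: "m - Poly_Mapping.single n ?d + Poly_Mapping.single n ?d = m" if "m \<in> Poly_Mapping.keys t" for m
    by (rule poly_mapping_eqI) (use exp[OF that] in \<open>auto simp: lookup_add lookup_minus lookup_single when_def\<close>)
  have pow: "mvar n ^ e = Poly_Mapping.single (Poly_Mapping.single n e) 1" for e
    using mon_mvar[of "Poly_Mapping.single n e"] by simp
  have "c * mvar n ^ ?d = (\<Sum>m\<in>Poly_Mapping.keys t. Poly_Mapping.single m (Poly_Mapping.lookup t m))"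
    unfolding c_def pow sum_distrib_right by (intro sum.cong refl) (simp add: mult_single split)
  then have ct: "c * mvar n ^ ?d = t" using mpoly_eq_sum_singles[of t] by simp
  then have cnz: "c \<noteq> 0" using tr(2) by auto
  have "c \<in> polys_below n"
  proof -
    have "m' \<in> (\<lambda>m. m - Poly_Mapping.single n ?d) ` Poly_Mapping.keys t" if "m' \<in> Poly_Mapping.keys c" for m'
    proof -
      have "Poly_Mapping.keys c \<subseteq> (\<Union>m\<in>Poly_Mapping.keys t. Poly_Mapping.keys (Poly_Mapping.single (m - Poly_Mapping.single n ?d) (Poly_Mapping.lookup t m)))"
        unfolding c_def by (rule keys_sum)
      then show ?thesis using that by (auto split: if_splits)
    qed
    moreover have "Poly_Mapping.keys (m - Poly_Mapping.single n ?d) \<subseteq> {..<n}" if "m \<in> Poly_Mapping.keys t" for m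
    proof
      fix i assume i: "i \<in> Poly_Mapping.keys (m - Poly_Mapping.single n ?d)"
      then have ne: "i \<noteq> n" using exp[OF that] by (auto simp: in_keys_iff lookup_minus)
      have "i \<in> Poly_Mapping.keys m" using i by (auto simp: in_keys_iff lookup_minus)
      then have "i < Suc n" using f tr(3)[OF that] unfolding polys_below_iff by blast
      then show "i \<in> {..<n}" using ne by simp
    qed
    ultimately show ?thesis unfolding polys_below_iff by blast
  qed
  moreover have "r \<in> polys_below (Suc n)"
    using tr(4) f unfolding polys_below_iff by blast
  moreover have "vdeg n r < vdeg n f" if rnz: "r \<noteq> 0"
  proof -
    obtain m where "m \<in> Poly_Mapping.keys r" "mweight ?q m = wdeg ?q r"
      using wdeg_attained[OF rnz, of ?q] by blast
    then show ?thesis using tr(4)[of m] by (simp add: vdeg_def)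
  qed
  moreover have "f = c * mvar n ^ ?d + r" using ct tr(1) by simp
  ultimately show ?thesis using that cnz by blast
qed

lemma vdeg_below: "c \<in> polys_below n \<Longrightarrow> vdeg n c = 0"
  by (simp add: polys_below_def)

lemma vdeg_mvar_power [simp]: "vdeg n (mvar n ^ e) = int e"
  by (simp add: vdeg_def wdeg_power)

lemma vdeg_add_less:
  assumes "f + g \<noteq> 0" "f \<noteq> 0 \<Longrightarrow> vdeg n f < e" "g \<noteq> 0 \<Longrightarrow> vdeg n g < e"
  shows "vdeg n (f + g) < e"
  using wdeg_add_le[of f g "\<lambda>j. if j = n then 1 else 0" "e - 1"] assms by (simp add: vdeg_def)

lemma vdeg_diff_less:
  assumes "f - g \<noteq> 0" "f \<noteq> 0 \<Longrightarrow> vdeg n f < e" "g \<noteq> 0 \<Longrightarrow> vdeg n g < e"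
  shows "vdeg n (f - g) < e"
  using vdeg_add_less[of f "- g" n e] assms by (simp add: vdeg_def)

lemma lead_coeff_unique:
  assumes "c \<in> polys_below n" "c' \<in> polys_below n"
    and "g \<noteq> 0 \<Longrightarrow> vdeg n g < int d" "g' \<noteq> 0 \<Longrightarrow> vdeg n g' < int d"
    and "c * mvar n ^ d + g = c' * mvar n ^ d + g'"
  shows "c = c'"
proof (rule ccontr)
  assume "c \<noteq> c'"
  then have nz: "c - c' \<noteq> 0" by simp
  have eq: "(c - c') * mvar n ^ d = g' - g" using assms(5) by (simp add: algebra_simps)
  then have "g' - g \<noteq> 0" using nz by (metis mult_eq_0_iff mvar_neq_0 power_not_zero)
  then have "vdeg n (g' - g) < int d" using assms(3,4) by (intro vdeg_diff_less)
  moreover have "vdeg n ((c - c') * mvar n ^ d) = int d"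
    using vdeg_mult[OF nz, of "mvar n ^ d" n] vdeg_below[OF polys_below_diff[OF assms(1,2)]] by simp
  ultimately show False using eq by simp
qed

text \<open>Only the tested factors are restricted to S; divisibility is that of the whole ring. For
  S = \<open>polys_below n\<close> this agrees with divisibility inside S, as cofactors of nonzero
  elements stay in S.\<close>

definition prime_on :: "mpoly set \<Rightarrow> mpoly \<Rightarrow> bool" where
  "prime_on S p \<longleftrightarrow> (\<forall>f\<in>S. \<forall>g\<in>S. p dvd f * g \<longrightarrow> p dvd f \<or> p dvd g)"

text \<open>Gauss's lemma: a prime of R stays prime in R[x]. If p divides the leading coefficient of
  f or g, that leading term is dropped; otherwise the leading coefficient of f * g would be
  divisible by p although neither of its factors is.\<close>

lemma prime_on_Suc:
  assumes p: "p \<in> polys_below n" "p \<noteq> 0" and pr: "prime_on (polys_below n) p"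
  shows "prime_on (polys_below (Suc n)) p"
proof -
  have "p dvd f \<or> p dvd g"
    if "f \<in> polys_below (Suc n)" "g \<in> polys_below (Suc n)" "p dvd f * g" for f g
    using that
  \<comment> \<open>The indicator terms make the measure drop also when a polynomial of degree 0 in
    the variable n is reduced to 0.\<close>
  proof (induction "nat (vdeg n f) + nat (vdeg n g) + (if f = 0 then 0 else 1) + (if g = 0 then 0 else 1)"
      arbitrary: f g rule: less_induct)
    case less
    show ?case
    proof (cases "f = 0 \<or> g = 0")
      case False
      obtain c f' where c: "c \<in> polys_below n" "c \<noteq> 0" "f' \<in> polys_below (Suc n)"
        "f = c * mvar n ^ nat (vdeg n f) + f'" "f' \<noteq> 0 \<Longrightarrow> vdeg n f' < vdeg n f"
        using lead_decomp[OF less.prems(1)] False by metis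
      obtain e g' where e: "e \<in> polys_below n" "e \<noteq> 0" "g' \<in> polys_below (Suc n)"
        "g = e * mvar n ^ nat (vdeg n g) + g'" "g' \<noteq> 0 \<Longrightarrow> vdeg n g' < vdeg n g"
        using lead_decomp[OF less.prems(2)] False by metis
      consider (A) "p dvd c" | (B) "p dvd e" | (C) "\<not> p dvd c" "\<not> p dvd e" by blast
      then show ?thesis
      proof cases
        case A
        have "f * g = c * mvar n ^ nat (vdeg n f) * g + f' * g"
          using c(4) by (simp add: distrib_right[symmetric])
        then have "p dvd f' * g"
          using less.prems(3) A by (simp add: dvd_add_right_iff)
        then have "p dvd f' \<or> p dvd g"
        proof (rule less.hyps[rotated 3])
          show "nat (vdeg n f') + nat (vdeg n g) + (if f' = 0 then 0 else 1) + (if g = 0 then 0 else 1)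
              < nat (vdeg n f) + nat (vdeg n g) + (if f = 0 then 0 else 1) + (if g = 0 then 0 else 1)"
            using c(5) False vdeg_nonneg[of n f] vdeg_nonneg[of n f'] by (auto simp: vdeg_def)
        qed (use c(3) less.prems in auto)
        moreover have "p dvd f" if "p dvd f'"
          by (subst c(4)) (use that A in simp)
        ultimately show ?thesis by blast
      next
        case B
        have "f * g = e * mvar n ^ nat (vdeg n g) * f + f * g'"
          by (subst e(4)) (simp add: algebra_simps)
        then have "p dvd f * g'"
          using less.prems(3) B by (simp add: dvd_add_right_iff)
        then have "p dvd f \<or> p dvd g'"
        proof (rule less.hyps[rotated 3])
          show "nat (vdeg n f) + nat (vdeg n g') + (if f = 0 then 0 else 1) + (if g' = 0 then 0 else 1)
              < nat (vdeg n f) + nat (vdeg n g) + (if f = 0 then 0 else 1) + (if g = 0 then 0 else 1)"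
            using e(5) False vdeg_nonneg[of n g] vdeg_nonneg[of n g'] by (auto simp: vdeg_def)
        qed (use e(3) less.prems in auto)
        moreover have "p dvd g" if "p dvd g'"
          by (subst e(4)) (use that B in simp)
        ultimately show ?thesis by blast
      next
        case C
        obtain u where u: "f * g = p * u" using less.prems(3) by (auto simp: dvd_def)
        have fg: "f * g \<noteq> 0" using False by simp
        then have unz: "u \<noteq> 0" using u by auto
        have "u \<in> polys_below (Suc n)"
          using polys_below_factor[of p u "Suc n"] u fg polys_below_mult[OF less.prems(1,2)] by simp
        then obtain s v where s: "s \<in> polys_below n" "s \<noteq> 0" "v \<in> polys_below (Suc n)"
          "u = s * mvar n ^ nat (vdeg n u) + v" "v \<noteq> 0 \<Longrightarrow> vdeg n v < vdeg n u"
          using lead_decomp[of u n] unz by metis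
        let ?F = "nat (vdeg n f)" and ?G = "nat (vdeg n g)"
        have du: "vdeg n u = vdeg n f + vdeg n g"
          using vdeg_mult[of f g n] vdeg_mult[of p u n] u False unz p(2) vdeg_below[OF p(1)] by simp
        then have du': "nat (vdeg n u) = ?F + ?G"
          using vdeg_nonneg[of n f] vdeg_nonneg[of n g] by simp
        have l: "(c * e) * mvar n ^ (?F + ?G) + (c * mvar n ^ ?F * g' + f' * g) = (p * s) * mvar n ^ (?F + ?G) + p * v"
        proof -
          have "f * g = c * mvar n ^ ?F * g + f' * g"
            using c(4) by (simp add: distrib_right[symmetric])
          also have "c * mvar n ^ ?F * g = c * mvar n ^ ?F * (e * mvar n ^ ?G + g')"
            using e(4) by simp
          finally have "f * g = (c * e) * mvar n ^ (?F + ?G) + (c * mvar n ^ ?F * g' + f' * g)"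
            by (simp add: algebra_simps power_add)
          moreover have "p * u = (p * s) * mvar n ^ (?F + ?G) + p * v"
            using s(4) du' by (metis distrib_left mult.assoc)
          ultimately show ?thesis using u by simp
        qed
        have "c * e = p * s"
        proof (rule lead_coeff_unique[OF _ _ _ _ l])
          show "c * e \<in> polys_below n" "p * s \<in> polys_below n"
            using c e p s by (auto intro: polys_below_mult)
          show "vdeg n (p * v) < int (?F + ?G)" if "p * v \<noteq> 0"
            using that s(5) du' du vdeg_mult[of p v n] vdeg_below[OF p(1)] vdeg_nonneg[of n u] by auto
          show "vdeg n (c * mvar n ^ ?F * g' + f' * g) < int (?F + ?G)"
            if "c * mvar n ^ ?F * g' + f' * g \<noteq> 0"
          proof (rule vdeg_add_less[OF that])
            assume nz: "c * mvar n ^ ?F * g' \<noteq> 0"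
            then have "vdeg n (c * mvar n ^ ?F * g') = int ?F + vdeg n g'"
              using vdeg_mult[of c "mvar n ^ ?F" n] vdeg_mult[of "c * mvar n ^ ?F" g' n] vdeg_below[OF c(1)] by simp
            then show "vdeg n (c * mvar n ^ ?F * g') < int (?F + ?G)"
              using nz e(5) vdeg_nonneg[of n g] by auto
          next
            assume nz: "f' * g \<noteq> 0"
            then show "vdeg n (f' * g) < int (?F + ?G)"
              using vdeg_mult[of f' g n] c(5) vdeg_nonneg[of n f] vdeg_nonneg[of n g] by auto
          qed
        qed
        then have "p dvd c * e" by simp
        then show ?thesis using pr c(1) e(1) C unfolding prime_on_def by blast
      qed
    qed auto
  qed
  then show ?thesis unfolding prime_on_def by blast
qed

text \<open>Each step multiplies f by the leading coefficient e of h and cancels the top term; c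
  collects these factors e and hence does not involve the variable n.\<close>

lemma pseudo_division:
  assumes h: "h \<in> polys_below (Suc n)" "h \<noteq> 0" and f: "f \<in> polys_below (Suc n)"
  shows "\<exists>c q r. c \<in> polys_below n \<and> c \<noteq> 0 \<and> q \<in> polys_below (Suc n) \<and> r \<in> polys_below (Suc n) \<and>
           c * f = q * h + r \<and> (r \<noteq> 0 \<longrightarrow> vdeg n r < vdeg n h)"
  using f
proof (induction "nat (vdeg n f) + (if f = 0 then 0 else 1)" arbitrary: f rule: less_induct)
  case less
  have triv: ?case if "f \<noteq> 0 \<longrightarrow> vdeg n f < vdeg n h"
    using that less.prems polys_below_const[of 1 n]
    by (intro exI[of _ 1] exI[of _ 0] exI[of _ f]) auto
  show ?case
  proof (cases "f = 0 \<or> vdeg n f < vdeg n h")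
    case False
    obtain c f' where c: "c \<in> polys_below n" "c \<noteq> 0" "f' \<in> polys_below (Suc n)"
      "f = c * mvar n ^ nat (vdeg n f) + f'" "f' \<noteq> 0 \<Longrightarrow> vdeg n f' < vdeg n f"
      using lead_decomp[OF less.prems] False by metis
    obtain e h' where e: "e \<in> polys_below n" "e \<noteq> 0" "h' \<in> polys_below (Suc n)"
      "h = e * mvar n ^ nat (vdeg n h) + h'" "h' \<noteq> 0 \<Longrightarrow> vdeg n h' < vdeg n h"
      using lead_decomp[OF h] by metis
    let ?k = "nat (vdeg n f) - nat (vdeg n h)"
    define f2 where "f2 = e * f' - c * mvar n ^ ?k * h'"
    have k: "nat (vdeg n f) = ?k + nat (vdeg n h)"
      using False vdeg_nonneg[of n h] by auto
    have up: "c \<in> polys_below (Suc n)" "e \<in> polys_below (Suc n)" "mvar n ^ ?k \<in> polys_below (Suc n)"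
      using c(1) e(1) by (auto intro: polys_below_mono polys_below_power polys_below_var)
    have f2: "e * f = c * mvar n ^ ?k * h + f2"
    proof -
      have "e * f = e * (c * (mvar n ^ ?k * mvar n ^ nat (vdeg n h)) + f')"
        using c(4) k by (metis power_add)
      also have "\<dots> = c * mvar n ^ ?k * (e * mvar n ^ nat (vdeg n h) + h') + f2"
        by (simp add: f2_def algebra_simps)
      finally show ?thesis using e(4) by simp
    qed
    have f2b: "f2 \<in> polys_below (Suc n)"
      unfolding f2_def using up c(3) e(3) by (intro polys_below_diff polys_below_mult) auto
    have lt: "vdeg n f2 < vdeg n f" if "f2 \<noteq> 0"
    proof -
      have "f2 \<noteq> 0" by fact
      then show ?thesis
        unfolding f2_def
      proof (rule vdeg_diff_less)
        assume "e * f' \<noteq> 0"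
        then show "vdeg n (e * f') < vdeg n f"
          using vdeg_mult[of e f' n] vdeg_below[OF e(1)] c(5) by auto
      next
        assume nz: "c * mvar n ^ ?k * h' \<noteq> 0"
        then have "vdeg n (c * mvar n ^ ?k * h') = int ?k + vdeg n h'"
          using vdeg_mult[of c "mvar n ^ ?k" n] vdeg_mult[of "c * mvar n ^ ?k" h' n] vdeg_below[OF c(1)] by simp
        then show "vdeg n (c * mvar n ^ ?k * h') < vdeg n f"
          using nz e(5) k vdeg_nonneg[of n f] vdeg_nonneg[of n h] by auto
      qed
    qed
    have "\<exists>c q r. c \<in> polys_below n \<and> c \<noteq> 0 \<and> q \<in> polys_below (Suc n) \<and> r \<in> polys_below (Suc n) \<and>
           c * f2 = q * h + r \<and> (r \<noteq> 0 \<longrightarrow> vdeg n r < vdeg n h)"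
      by (rule less.hyps[OF _ f2b])
         (use lt False vdeg_nonneg[of n f] vdeg_nonneg[of n f2] in \<open>auto simp: vdeg_def\<close>)
    then obtain b q r where b: "b \<in> polys_below n" "b \<noteq> 0" "q \<in> polys_below (Suc n)" "r \<in> polys_below (Suc n)"
      "b * f2 = q * h + r" "r \<noteq> 0 \<longrightarrow> vdeg n r < vdeg n h" by blast
    have "(b * e) * f = b * (e * f)" by (simp add: mult.assoc)
    also have "\<dots> = (b * c * mvar n ^ ?k + q) * h + r"
      unfolding f2 distrib_left b(5) by (simp add: algebra_simps)
    finally have "(b * e) * f = (b * c * mvar n ^ ?k + q) * h + r" .
    moreover have "b * c * mvar n ^ ?k + q \<in> polys_below (Suc n)"
      using b up by (intro polys_below_add polys_below_mult) (auto intro: polys_below_mono)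
    moreover have "b * e \<in> polys_below n" "b * e \<noteq> 0"
      using b e by (auto intro: polys_below_mult)
    ultimately show ?thesis using b(4,6) by blast
  qed (use triv in blast)
qed

lemma irreducible_factor:
  fixes f :: mpoly
  assumes "f \<noteq> 0" "\<not> f dvd 1"
  obtains p where "irreducible p" "p dvd f"
  using assms
proof (induction "nat (tdeg f)" arbitrary: f thesis rule: less_induct)
  case less
  show ?case
  proof (cases "irreducible f")
    case False
    then obtain a b where ab: "f = a * b" "\<not> a dvd 1" "\<not> b dvd 1"
      using less.prems by (auto simp: irreducible_def)
    then have nz: "a \<noteq> 0" "b \<noteq> 0" using less.prems(2) by auto
    have "tdeg b > 0" using ab nz tdeg_nonneg[of b] mpoly_unit_iff[of b] by auto
    then have "nat (tdeg a) < nat (tdeg f)"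
      using ab wdeg_mult[OF nz, of "\<lambda>_. 1"] tdeg_nonneg[of a] by simp
    then obtain p where "irreducible p" "p dvd a"
      using less.hyps[of a] nz ab by metis
    then show ?thesis using less.prems(1) ab by auto
  qed (use less.prems(1) in auto)
qed

text \<open>The irreducible factors r of c are cancelled one at a time. Each is prime on T and
  cannot divide p, since p would then be r times a unit and hence in S; so it divides u.\<close>

lemma cancel_coprime:
  assumes primes: "\<And>p. p \<in> S \<Longrightarrow> irreducible p \<Longrightarrow> prime_on T p"
    and closed: "\<And>a b. a * b \<in> S \<Longrightarrow> a * b \<noteq> 0 \<Longrightarrow> a \<in> S \<and> b \<in> S"
    and closedT: "\<And>a b. a * b \<in> T \<Longrightarrow> a * b \<noteq> 0 \<Longrightarrow> a \<in> T \<and> b \<in> T"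
    and p: "irreducible p" "p \<in> T" "p \<notin> S" and unitS: "\<And>a. a dvd 1 \<Longrightarrow> a \<in> S"
    and mulS: "\<And>a b. a \<in> S \<Longrightarrow> b \<in> S \<Longrightarrow> a * b \<in> S"
  shows "c \<in> S \<Longrightarrow> c \<noteq> 0 \<Longrightarrow> f \<in> T \<Longrightarrow> u \<in> T \<Longrightarrow> c * f = p * u \<Longrightarrow> p dvd f"
proof (induction "nat (tdeg c)" arbitrary: c u rule: less_induct)
  case less
  show ?case
  proof (cases "c dvd 1")
    case True
    then obtain d where "1 = c * d" by (auto simp: dvd_def)
    then have "f = p * (u * d)"
      using less.prems(5) by (metis mult.assoc mult.commute mult.left_neutral)
    then show ?thesis by simp
  next
    case False
    obtain r where r: "irreducible r" "r dvd c"
      using irreducible_factor[OF less.prems(2) False] by blast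
    then obtain c' where c': "c = r * c'" by (auto simp: dvd_def)
    have rS: "r \<in> S" "c' \<in> S" using closed[of r c'] c' less.prems(1,2) by auto
    have nz: "r \<noteq> 0" "c' \<noteq> 0" using c' less.prems(2) by auto
    have "r dvd p * u" using less.prems(5) c' by (metis dvd_triv_left mult.assoc)
    then have "r dvd p \<or> r dvd u"
      using primes[OF rS(1) r(1)] p(2) less.prems(4) unfolding prime_on_def by blast
    moreover have "\<not> r dvd p"
    proof
      assume "r dvd p"
      then obtain s where s: "p = r * s" by (auto simp: dvd_def)
      then have "s dvd 1" using p(1) r(1) by (auto simp: irreducible_def)
      then show False using s rS(1) unitS mulS p(3) by blast
    qed
    ultimately obtain u' where u': "u = r * u'" by (auto simp: dvd_def)
    have "r * (c' * f) = r * (p * u')"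
      using less.prems(5) c' u' by (simp add: ac_simps)
    then have eq: "c' * f = p * u'" using nz(1) by simp
    show ?thesis
    proof (cases "u = 0")
      case True
      then have "f = 0" using less.prems(2,5) by simp
      then show ?thesis by simp
    next
      case False
      have "tdeg r > 0"
        using r(1) nz(1) tdeg_nonneg[of r] mpoly_unit_iff[of r] by (auto simp: irreducible_def)
      then have "nat (tdeg c') < nat (tdeg c)"
        using wdeg_mult[OF nz, of "\<lambda>_. 1"] c' tdeg_nonneg[of c'] by simp
      moreover have "u' \<in> T" using closedT[of r u'] u' False less.prems(4) by simp
      ultimately show ?thesis
        using less.hyps[OF _ rS(2) nz(2) less.prems(3) _ eq] by blast
    qed
  qed
qed

text \<open>A polynomial p free of the top variable is covered by Gauss's lemma. Otherwise Euclid's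
  argument over the fraction field applies: an h of least degree in that variable with p dvd h * g
  divides every other such polynomial up to a factor c free of the variable. As p is one of them, h
  is a multiple of p; as f is another, p divides c * f and hence f.\<close>

lemma prime_on_below:
  "irreducible p \<Longrightarrow> p \<in> polys_below n \<Longrightarrow> prime_on (polys_below n) p"
proof (induction n arbitrary: p)
  case 0
  obtain c where "p = mconst c" using polys_below_zero_const[OF 0(2)] .
  then have "p dvd 1" using 0(1) mpoly_unit_iff[of p] by (auto simp: irreducible_def)
  then show ?case using 0(1) by (auto simp: irreducible_def)
next
  case (Suc n)
  let ?S = "polys_below n" and ?T = "polys_below (Suc n)"
  have pnz: "p \<noteq> 0" using Suc.prems(1) by (auto simp: irreducible_def)
  have ST: "x \<in> ?T" if "x \<in> ?S" for x using that polys_below_mono by auto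
  show ?case
  proof (cases "p \<in> ?S")
    case True
    then show ?thesis using Suc.IH[OF Suc.prems(1)] prime_on_Suc pnz by blast
  next
    case False
    have primes: "prime_on ?T r" if "r \<in> ?S" "irreducible r" for r
      using Suc.IH[OF that(2,1)] prime_on_Suc[OF that(1)] that(2) by (auto simp: irreducible_def)
    have unitS: "r \<in> ?S" if "r dvd 1" for r
    proof -
      have "tdeg r = 0" using mpoly_unit_iff[of r] that by blast
      then obtain c where "r = mconst c" by (rule tdeg_eq_0_imp_const)
      then show ?thesis by (simp add: polys_below_const)
    qed
    have cancel: "p dvd f" if cc: "c \<in> ?S" "c \<noteq> 0" "f \<in> ?T" "p dvd c * f" for c f
    proof (cases "f = 0")
      case fnz: False
      obtain u where u: "c * f = p * u" using cc(4) by (auto simp: dvd_def)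
      have "p * u \<in> ?T" using polys_below_mult[OF ST[OF cc(1)] cc(3)] u by simp
      moreover have "p * u \<noteq> 0" using u cc(2) fnz by (metis mult_eq_0_iff)
      ultimately have "u \<in> ?T" using polys_below_factor by blast
      show ?thesis
      proof (rule cancel_coprime[of ?S ?T p c f u])
        show "prime_on ?T r" if "r \<in> ?S" "irreducible r" for r using primes that by blast
        show "x \<in> ?S \<and> y \<in> ?S" if "x * y \<in> ?S" "x * y \<noteq> 0" for x y
          using polys_below_factor[OF that] by blast
        show "x \<in> ?T \<and> y \<in> ?T" if "x * y \<in> ?T" "x * y \<noteq> 0" for x y
          using polys_below_factor[OF that] by blast
        show "x * y \<in> ?S" if "x \<in> ?S" "y \<in> ?S" for x y using polys_below_mult[OF that] .
        show "x \<in> ?S" if "x dvd 1" for x using unitS[OF that] .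
      qed (use Suc.prems False cc u \<open>u \<in> ?T\<close> in auto)
    qed simp
    \<comment> \<open>The irreducible factors of c are distributed over q and h; what is left of h
      is a true divisor h' of p.\<close>
    have peel: "\<exists>h' q' c1. p = q' * h' \<and> h = c1 * h' \<and> c1 \<in> ?S \<and> c1 \<noteq> 0"
      if "c \<in> ?S" "c \<noteq> 0" "q \<in> ?T" "h \<in> ?T" "h \<noteq> 0" "c * p = q * h" for c q h
      using that
    proof (induction "nat (tdeg c)" arbitrary: c q h rule: less_induct)
      case less
      show ?case
      proof (cases "c dvd 1")
        case True
        then obtain d where d: "1 = c * d" by (auto simp: dvd_def)
        have "p = d * (c * p)" using d by (simp add: ac_simps flip: d)
        then have "p = (d * q) * h" using less.prems(6) by (simp add: ac_simps)
        then show ?thesis using polys_below_const[of 1 n] by (intro exI[of _ h] exI[of _ "d * q"] exI[of _ 1]) auto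
      next
        case False
        obtain r where r: "irreducible r" "r dvd c"
          using irreducible_factor[OF less.prems(2) False] by blast
        then obtain c' where c': "c = r * c'" by (auto simp: dvd_def)
        have rS: "r \<in> ?S" "c' \<in> ?S" using polys_below_factor[of r c' n] c' less.prems(1,2) by auto
        have nz: "r \<noteq> 0" "c' \<noteq> 0" using c' less.prems(2) by auto
        have "tdeg r > 0"
          using r(1) nz(1) tdeg_nonneg[of r] mpoly_unit_iff[of r] by (auto simp: irreducible_def)
        then have lt: "nat (tdeg c') < nat (tdeg c)"
          using wdeg_mult[OF nz, of "\<lambda>_. 1"] c' tdeg_nonneg[of c'] by simp
        have qnz: "q \<noteq> 0" using less.prems(2,6) pnz by auto
        have "r dvd q * h" using less.prems(6) c' by (metis dvd_triv_left mult.assoc)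
        then consider "r dvd q" | "r dvd h"
          using primes[OF rS(1) r(1)] less.prems(3,4) unfolding prime_on_def by blast
        then show ?thesis
        proof cases
          case 1
          then obtain q' where q': "q = r * q'" by (auto simp: dvd_def)
          have "c' * p = q' * h" using less.prems(6) c' q' nz(1) by (metis mult.assoc mult_left_cancel)
          moreover have "q' \<in> ?T" using polys_below_factor[of r q'] q' qnz less.prems(3) by simp
          ultimately show ?thesis using less.hyps[OF lt rS(2) nz(2) _ less.prems(4,5)] by blast
        next
          case 2
          then obtain h0 where h0: "h = r * h0" by (auto simp: dvd_def)
          then have "h0 \<noteq> 0" using less.prems(5) by auto
          have "r * (c' * p) = r * (q * h0)" using less.prems(6) c' h0 by (simp add: ac_simps)
          then have "c' * p = q * h0" using nz(1) by simp
          moreover have "h0 \<in> ?T" using polys_below_factor[of r h0] h0 less.prems(4,5) by simp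
          ultimately obtain h' q' c1 where "p = q' * h'" "h0 = c1 * h'" "c1 \<in> ?S" "c1 \<noteq> 0"
            using less.hyps[OF lt rS(2) nz(2) less.prems(3) _ \<open>h0 \<noteq> 0\<close>] by blast
          then show ?thesis using h0 nz(1) rS(1)
            by (intro exI[of _ h'] exI[of _ q'] exI[of _ "r * c1"]) (auto intro: polys_below_mult simp: mult.assoc)
        qed
      qed
    qed
    have "p dvd f" if f: "f \<in> ?T" and g: "g \<in> ?T" and fg: "p dvd f * g" and ng: "\<not> p dvd g" for f g
    proof -
      define I where "I = {h. h \<in> ?T \<and> h \<noteq> 0 \<and> p dvd h * g}"
      have "p \<in> I" using Suc.prems(2) pnz by (simp add: I_def)
      then obtain h where h: "h \<in> I" "\<And>x. x \<in> I \<Longrightarrow> nat (vdeg n h) \<le> nat (vdeg n x)"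
        using ex_has_least_nat[of "\<lambda>x. x \<in> I" p "\<lambda>x. nat (vdeg n x)"] by auto
      have hT: "h \<in> ?T" "h \<noteq> 0" "p dvd h * g" using h(1) by (auto simp: I_def)
      have div: "\<exists>c q. c \<in> ?S \<and> c \<noteq> 0 \<and> q \<in> ?T \<and> c * x = q * h" if x: "x \<in> ?T" "p dvd x * g" for x
      proof -
        obtain c q r where *: "c \<in> ?S" "c \<noteq> 0" "q \<in> ?T" "r \<in> ?T" "c * x = q * h + r" "r \<noteq> 0 \<longrightarrow> vdeg n r < vdeg n h"
          using pseudo_division[OF hT(1,2) x(1)] by blast
        have "c * (x * g) = (q * h + r) * g" using *(5) by (metis mult.assoc)
        then have "r * g = c * (x * g) - q * (h * g)" by (simp add: algebra_simps)
        then have "p dvd r * g" using x(2) hT(3) by (metis dvd_diff dvd_mult)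
        then have "r = 0" using h(2)[of r] *(4,6) vdeg_nonneg[of n r] vdeg_nonneg[of n h] by (fastforce simp: I_def)
        then show ?thesis using * by auto
      qed
      obtain c q where "c \<in> ?S" "c \<noteq> 0" "q \<in> ?T" "c * p = q * h"
        using div[OF Suc.prems(2)] by auto
      then obtain h' q' c1 where p': "p = q' * h'" "h = c1 * h'" "c1 \<in> ?S" "c1 \<noteq> 0"
        using peel[OF _ _ _ hT(1,2)] by blast
      have h'T: "h' \<in> ?T" using polys_below_factor[of c1 h'] p' hT by auto
      have "p dvd h' * g"
        by (rule cancel[OF p'(3,4)]) (use h'T g hT(3) p'(2) in \<open>auto intro: polys_below_mult simp: mult.assoc\<close>)
      have "\<not> h' dvd 1"
      proof
        assume "h' dvd 1"
        then obtain e where "1 = h' * e" by (auto simp: dvd_def)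
        then have "g = (h' * e) * g" by simp
        then have "g = (h' * g) * e" by (simp add: ac_simps)
        then have "p dvd g" using \<open>p dvd h' * g\<close> by (metis dvd_mult2)
        then show False using ng by simp
      qed
      then have "q' dvd 1" using Suc.prems(1) p'(1) by (auto simp: irreducible_def)
      then obtain e where "1 = q' * e" by (auto simp: dvd_def)
      then have "h' = (q' * e) * h'" by simp
      also have "\<dots> = p * e" unfolding p'(1) by (simp add: ac_simps)
      finally have ph: "p dvd h" using p'(2) by simp
      obtain c q where cq: "c \<in> ?S" "c \<noteq> 0" "q \<in> ?T" "c * f = q * h"
        using div[OF f fg] by blast
      have "p dvd c * f" unfolding cq(4) using ph by (rule dvd_mult)
      then show ?thesis by (rule cancel[OF cq(1,2) f])
    qed
    then show ?thesis unfolding prime_on_def by metis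
  qed
qed

theorem mpoly_irreducible_imp_prime:
  fixes p :: mpoly
  assumes "irreducible p"
  shows "prime_elem p"
proof (rule prime_elemI)
  fix f g assume "p dvd f * g"
  obtain a b c where "p \<in> polys_below a" "f \<in> polys_below b" "g \<in> polys_below c"
    using polys_below_exhaust by metis
  then have "p \<in> polys_below (a + b + c)" "f \<in> polys_below (a + b + c)" "g \<in> polys_below (a + b + c)"
    by (auto intro: polys_below_mono)
  then show "p dvd f \<or> p dvd g"
    using prime_on_below[OF assms] \<open>p dvd f * g\<close> unfolding prime_on_def by blast
qed (use assms in \<open>auto simp: irreducible_def\<close>)

lemma mpoly_prime_factor:
  fixes f :: mpoly
  assumes "f \<noteq> 0" "\<not> f dvd 1"
  obtains p where "prime_elem p" "p dvd f"
proof -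
  obtain p where "irreducible p" "p dvd f" using irreducible_factor[OF assms] .
  then show ?thesis using that mpoly_irreducible_imp_prime by blast
qed

section \<open>Rational functions\<close>

definition pol :: "mpoly \<Rightarrow> ratfun" where
  "pol p = Fract p 1"

lemma pol_simps [simp]:
  "pol 0 = 0" "pol 1 = 1" "pol (p + q) = pol p + pol q" "pol (p * q) = pol p * pol q"
  "pol (- p) = - pol p" "pol (p - q) = pol p - pol q"
  by (simp_all add: pol_def Zero_fract_def One_fract_def)

lemma pol_power [simp]: "pol (p ^ n) = pol p ^ n"
  by (induction n) simp_all

lemma pol_sum: "pol (sum f S) = (\<Sum>i\<in>S. pol (f i))"
  by (induction S rule: infinite_finite_induct) simp_all

lemma pol_prod: "pol (prod f S) = (\<Prod>i\<in>S. pol (f i))"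
  by (induction S rule: infinite_finite_induct) simp_all

lemma pol_eq_iff [simp]: "pol p = pol q \<longleftrightarrow> p = q"
  by (simp add: pol_def eq_fract)

lemma pol_eq_0_iff [simp]: "pol p = 0 \<longleftrightarrow> p = 0"
  using pol_eq_iff[of p 0] by simp

lemma pol_mconst [simp]: "pol (mconst c) = rf_const c"
  by (simp add: pol_def mconst_def rf_const_def)

lemma pol_mvar [simp]: "pol (mvar i) = rf_var i"
  by (simp add: pol_def mvar_def rf_var_def)

lemma rf_var_neq_0 [simp]: "rf_var i \<noteq> 0"
  by (simp flip: pol_mvar)

lemma Fract_eq_pol: "q \<noteq> 0 \<Longrightarrow> Fract p q = pol p / pol q"
  by (simp add: pol_def)

lemma ratfun_cases:
  obtains p q where "q \<noteq> 0" "r = pol p / pol q"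
proof (cases r rule: Fract_cases_nonzero)
  case (Fract a b)
  then show ?thesis using that[of b a] by (simp add: Fract_eq_pol)
next
  case 0
  then show ?thesis using that[of 1 0] by simp
qed

abbreviation reval :: "(nat \<Rightarrow> ratfun) \<Rightarrow> mpoly \<Rightarrow> ratfun" where
  "reval \<equiv> peval rf_const"

lemma mpoly_subst_eq_reval: "mpoly_subst p y = reval y p"
  by (simp add: mpoly_subst_def peval_def mon_def)

lemmas reval_simps [simp] =
  peval_add[OF coeff_hom_rf_const] peval_mult[OF coeff_hom_rf_const] peval_const[OF coeff_hom_rf_const]
  peval_var[OF coeff_hom_rf_const] peval_1[OF coeff_hom_rf_const] peval_power[OF coeff_hom_rf_const]
  peval_uminus[OF coeff_hom_rf_const] peval_diff[OF coeff_hom_rf_const]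

lemmas meval_simps [simp] =
  peval_add[OF coeff_hom_mconst] peval_mult[OF coeff_hom_mconst] peval_const[OF coeff_hom_mconst]
  peval_var[OF coeff_hom_mconst] peval_1[OF coeff_hom_mconst] peval_power[OF coeff_hom_mconst]
  peval_uminus[OF coeff_hom_mconst] peval_diff[OF coeff_hom_mconst]

lemma reval_rf_var [simp]: "reval rf_var p = pol p"
  by (induction p rule: mpoly_induct) simp_all

lemma reval_pol: "reval (\<lambda>i. pol (z i)) p = pol (peval mconst z p)"
  by (induction p rule: mpoly_induct) simp_all

text \<open>Two fractions for the same function whose denominators survive the substitution give the
  same value, by cross multiplication; this justifies the definite description in
  \<open>rf_subst\<close>.\<close>

lemma rf_subst_eval:
  assumes "q \<noteq> 0" "reval y q \<noteq> 0"
  shows "rf_subst (pol p / pol q) y = reval y p / reval y q"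
  unfolding rf_subst_def mpoly_subst_eq_reval
proof (rule the_equality)
  show "\<exists>p' q'. q' \<noteq> 0 \<and> pol p / pol q = Fract p' q' \<and> reval y q' \<noteq> 0 \<and>
      reval y p / reval y q = reval y p' / reval y q'"
    using assms Fract_eq_pol by metis
next
  fix z assume "\<exists>p' q'. q' \<noteq> 0 \<and> pol p / pol q = Fract p' q' \<and> reval y q' \<noteq> 0 \<and> z = reval y p' / reval y q'"
  then obtain p' q' where *: "q' \<noteq> 0" "Fract p q = Fract p' q'" "reval y q' \<noteq> 0" "z = reval y p' / reval y q'"
    using Fract_eq_pol[OF assms(1)] by auto
  then have "p * q' = p' * q" using assms by (simp add: eq_fract)
  then have "reval y p * reval y q' = reval y p' * reval y q"
    by (metis reval_simps(2))
  then show "z = reval y p / reval y q" using *(3,4) assms by (simp add: frac_eq_eq)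
qed

lemma rf_subst_pol: "rf_subst (pol p) y = reval y p"
  using rf_subst_eval[of 1 y p] by simp

text \<open>Algebraic independence of all y i, including the indices outside 1..k. For this reason
  the coordinate changes below fix the remaining variables.\<close>

definition dominant :: "(nat \<Rightarrow> ratfun) \<Rightarrow> bool" where
  "dominant y \<longleftrightarrow> (\<forall>p. reval y p = 0 \<longrightarrow> p = 0)"

lemma rf_subst_hom:
  assumes y: "dominant y"
  shows "rf_subst (r + s) y = rf_subst r y + rf_subst s y"
    and "rf_subst (r * s) y = rf_subst r y * rf_subst s y"
    and "rf_subst (r / s) y = rf_subst r y / rf_subst s y"
proof -
  have nz: "reval y q \<noteq> 0" if "q \<noteq> 0" for q using y that by (auto simp: dominant_def)
  obtain p q where r: "q \<noteq> 0" "r = pol p / pol q" by (rule ratfun_cases)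
  obtain p' q' where s: "q' \<noteq> 0" "s = pol p' / pol q'" by (rule ratfun_cases)
  note e = rf_subst_eval[of _ y, OF _ nz]
  have er: "rf_subst r y = reval y p / reval y q" and es: "rf_subst s y = reval y p' / reval y q'"
    unfolding r(2) s(2) by (rule e, rule r(1), rule r(1), rule e, rule s(1), rule s(1))
  have "r + s = pol (p * q' + p' * q) / pol (q * q')"
    unfolding r(2) s(2) using r(1) s(1) by (simp add: add_frac_eq)
  then show "rf_subst (r + s) y = rf_subst r y + rf_subst s y"
    using r(1) s(1) nz[OF r(1)] nz[OF s(1)] e[of "q * q'" "p * q' + p' * q"]
    by (simp add: er es add_frac_eq)
  have "r * s = pol (p * p') / pol (q * q')" unfolding r(2) s(2) by simp
  then show "rf_subst (r * s) y = rf_subst r y * rf_subst s y"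
    using r(1) s(1) e[of "q * q'" "p * p'"] by (simp add: er es)
  show "rf_subst (r / s) y = rf_subst r y / rf_subst s y"
  proof (cases "p' = 0")
    case True
    then have "s = 0" using s(2) by simp
    then show ?thesis using e[of 1 0] by (simp add: True es)
  next
    case False
    have "r / s = pol (p * q') / pol (q * p')" unfolding r(2) s(2) by simp
    then show ?thesis
      using r(1) False e[of "q * p'" "p * q'"] by (simp add: er es)
  qed
qed

definition field_hom :: "(ratfun \<Rightarrow> ratfun) \<Rightarrow> bool" where
  "field_hom H \<longleftrightarrow> (\<forall>c. H (rf_const c) = rf_const c) \<and> (\<forall>r s. H (r + s) = H r + H s) \<and>
     (\<forall>r s. H (r * s) = H r * H s)"

lemma rf_const_0 [simp]: "rf_const 0 = 0" and rf_const_1 [simp]: "rf_const 1 = 1"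
  by (simp_all flip: pol_mconst)

lemma field_hom_simps:
  assumes "field_hom H"
  shows "H (rf_const c) = rf_const c" "H (r + s) = H r + H s" "H (r * s) = H r * H s"
    "H 0 = 0" "H 1 = 1" "H (r / s) = H r / H s" "H (r ^ n) = H r ^ n" "H (r - s) = H r - H s"
    "H r = 0 \<longleftrightarrow> r = 0"
proof -
  show 1: "H (rf_const c) = rf_const c" and 2: "H (r + s) = H r + H s" and 3: "H (r * s) = H r * H s"
    for c r s using assms by (auto simp: field_hom_def)
  show 4: "H 0 = 0" and 5: "H 1 = 1" using 1[of 0] 1[of 1] by simp_all
  show 9: "H r = 0 \<longleftrightarrow> r = 0" for r
  proof
    assume "H r = 0"
    then show "r = 0" using 3[of r "inverse r"] 5 by (cases "r = 0") auto
  qed (simp add: 4)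
  show "H (r / s) = H r / H s"
    using 3[of "r / s" s] 4 9[of s] by (cases "s = 0") (simp_all add: field_simps)
  show "H (r ^ n) = H r ^ n" by (induction n) (simp_all add: 3 5)
  show "H (r - s) = H r - H s" using 2[of "r - s" s] by simp
qed

lemma field_hom_sum: "field_hom H \<Longrightarrow> H (sum f S) = (\<Sum>i\<in>S. H (f i))"
  by (induction S rule: infinite_finite_induct) (simp_all add: field_hom_simps)

lemma field_hom_prod: "field_hom H \<Longrightarrow> H (prod f S) = (\<Prod>i\<in>S. H (f i))"
  by (induction S rule: infinite_finite_induct) (simp_all add: field_hom_simps)

lemma field_hom_reval:
  assumes "field_hom H"
  shows "H (reval y p) = reval (\<lambda>i. H (y i)) p"
  by (induction p rule: mpoly_induct) (simp_all add: field_hom_simps[OF assms])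

lemma field_hom_pol:
  assumes "field_hom H"
  shows "H (pol p) = reval (\<lambda>i. H (rf_var i)) p"
  using field_hom_reval[OF assms, of rf_var p] by simp

lemma field_hom_rf_subst:
  assumes "dominant y"
  shows "field_hom (\<lambda>r. rf_subst r y)"
  using rf_subst_hom[OF assms] rf_subst_pol[of "mconst _" y] by (simp add: field_hom_def)

lemma rf_subst_rf_var: "rf_subst (rf_var i) y = y i"
  using rf_subst_pol[of "mvar i" y] by simp

lemma field_hom_comp: "field_hom H \<Longrightarrow> field_hom G \<Longrightarrow> field_hom (\<lambda>r. H (G r))"
  by (simp add: field_hom_def)

lemma field_hom_id: "field_hom (\<lambda>r. r)"
  by (simp add: field_hom_def)

lemma field_hom_eqI:
  assumes H: "field_hom H" and G: "field_hom G" and eq: "\<And>i. H (rf_var i) = G (rf_var i)"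
  shows "H r = G r"
proof -
  obtain p q where r: "q \<noteq> 0" "r = pol p / pol q" by (rule ratfun_cases)
  show ?thesis
    using field_hom_pol[OF H] field_hom_pol[OF G] eq by (simp add: r(2) field_hom_simps[OF H] field_hom_simps[OF G])
qed

section \<open>Degrees of rational maps\<close>

lemma wdeg_sum_le:
  assumes "finite S" "sum f S \<noteq> 0" "\<And>i. i \<in> S \<Longrightarrow> f i \<noteq> 0 \<Longrightarrow> wdeg q (f i) \<le> e"
  shows "wdeg q (sum f S) \<le> e"
  using assms
proof (induction S)
  case (insert x S)
  have "wdeg q (f x + sum f S) \<le> e"
    by (rule wdeg_add_le) (use insert in auto)
  then show ?case using insert by simp
qed simp

text \<open>Highest and lowest degree agree. Written with two weighted degrees, which are additive
  on products, homogeneity passes to products and to factors.\<close>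

lemma homogeneous_iff:
  assumes "p \<noteq> 0"
  shows "homogeneous_mpoly k d p \<longleftrightarrow>
    tdeg p = int d \<and> wdeg (\<lambda>_. - 1) p = - int d \<and> p \<in> polys_below (Suc k)"
proof -
  have mw: "mweight (\<lambda>_. 1) m = int (\<Sum>i\<in>Poly_Mapping.keys m. Poly_Mapping.lookup m i)"
    "mweight (\<lambda>_. - 1) m = - int (\<Sum>i\<in>Poly_Mapping.keys m. Poly_Mapping.lookup m i)" for m
    by (simp_all add: mweight_def sum_negf)
  have sub: "{0..k} = {..<Suc k}" by auto
  show ?thesis
  proof
    assume h: "homogeneous_mpoly k d p"
    then have *: "mweight (\<lambda>_. 1) m = int d" "mweight (\<lambda>_. - 1) m = - int d" if "m \<in> Poly_Mapping.keys p" for m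
      using that by (auto simp: homogeneous_mpoly_def mw)
    have "tdeg p = int d" "wdeg (\<lambda>_. - 1) p = - int d"
      using wdeg_attained[OF assms] * by metis+
    moreover have "p \<in> polys_below (Suc k)"
      using h by (auto simp: homogeneous_mpoly_def polys_below_iff sub)
    ultimately show "tdeg p = int d \<and> wdeg (\<lambda>_. - 1) p = - int d \<and> p \<in> polys_below (Suc k)" by blast
  next
    assume h: "tdeg p = int d \<and> wdeg (\<lambda>_. - 1) p = - int d \<and> p \<in> polys_below (Suc k)"
    show "homogeneous_mpoly k d p"
      unfolding homogeneous_mpoly_def sub
    proof (intro ballI conjI)
      fix m assume m: "m \<in> Poly_Mapping.keys p"
      show "Poly_Mapping.keys m \<subseteq> {..<Suc k}" using h m by (auto simp: polys_below_iff)
      show "(\<Sum>i\<in>Poly_Mapping.keys m. Poly_Mapping.lookup m i) = d"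
        using wdeg_ge[OF m, of "\<lambda>_. 1"] wdeg_ge[OF m, of "\<lambda>_. - 1"] h unfolding mw by linarith
    qed
  qed
qed

lemma homogeneous_0 [simp]: "homogeneous_mpoly k d 0"
  by (simp add: homogeneous_mpoly_def)

lemma homogeneous_mult:
  assumes "homogeneous_mpoly k d p" "homogeneous_mpoly k e q"
  shows "homogeneous_mpoly k (d + e) (p * q)"
  by (cases "p = 0 \<or> q = 0")
     (use assms in \<open>auto simp: homogeneous_iff wdeg_mult intro: polys_below_mult\<close>)

lemma homogeneous_diff:
  assumes "homogeneous_mpoly k d p" "homogeneous_mpoly k d q"
  shows "homogeneous_mpoly k d (p - q)"
  using assms keys_diff[of p q] unfolding homogeneous_mpoly_def by blast

lemma homogeneous_factor:
  assumes "homogeneous_mpoly k d (p * q)" "p \<noteq> 0" "q \<noteq> 0"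
  shows "homogeneous_mpoly k (nat (tdeg p)) p \<and> homogeneous_mpoly k (d - nat (tdeg p)) q \<and> nat (tdeg p) \<le> d"
proof -
  have nonneg: "wdeg (\<lambda>_. 1) f + wdeg (\<lambda>_. - 1) f \<ge> 0" if "f \<noteq> 0" for f :: mpoly
  proof -
    have "Poly_Mapping.keys f \<noteq> {}" using that by simp
    then obtain m where m: "m \<in> Poly_Mapping.keys f" by blast
    have "mweight (\<lambda>_. 1) m + mweight (\<lambda>_. - 1) m = 0" by (simp add: mweight_def sum_negf)
    then show ?thesis using wdeg_ge[OF m, of "\<lambda>_. 1"] wdeg_ge[OF m, of "\<lambda>_. - 1"] by linarith
  qed
  have h: "tdeg p + tdeg q = int d" "wdeg (\<lambda>_. - 1) p + wdeg (\<lambda>_. - 1) q = - int d" "p * q \<in> polys_below (Suc k)"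
    using assms homogeneous_iff[of "p * q" k d] by (auto simp: wdeg_mult)
  then have "wdeg (\<lambda>_. - 1) p = - tdeg p" "wdeg (\<lambda>_. - 1) q = - tdeg q"
    using nonneg[OF assms(2)] nonneg[OF assms(3)] by linarith+
  then show ?thesis
    using h assms polys_below_factor[OF h(3)] tdeg_nonneg[of p] tdeg_nonneg[of q]
    by (auto simp: homogeneous_iff)
qed

definition dehom :: "mpoly \<Rightarrow> mpoly" where
  "dehom p = peval mconst (mvar(0 := 1)) p"

lemma mpoly_subst_dehom: "mpoly_subst p (rf_var(0 := 1)) = pol (dehom p)"
proof -
  have "rf_var(0 := 1) = (\<lambda>i. pol ((mvar(0 := 1)) i))" by auto
  then show ?thesis by (simp only: mpoly_subst_eq_reval dehom_def reval_pol)
qed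

lemma dehom_mult: "dehom (p * q) = dehom p * dehom q" and dehom_diff: "dehom (p - q) = dehom p - dehom q"
  by (simp_all add: dehom_def)

text \<open>Substituting x i / x 0 for x i and multiplying by a power of x 0 recovers a homogeneous
  polynomial from its dehomogenisation.\<close>

lemma dehom_eq_0:
  assumes hom: "homogeneous_mpoly k d p" and z: "dehom p = 0"
  shows "p = 0"
proof -
  define y where "y = (\<lambda>i. rf_var i / rf_var 0)"
  have "(\<lambda>i. reval y ((mvar(0 := 1)) i)) = y"
    by (auto simp: y_def)
  then have "reval y p = reval y (dehom p)"
    unfolding dehom_def peval_peval[OF coeff_hom_rf_const] by simp
  then have "reval y p * rf_var 0 ^ d = 0" using z by simp
  moreover have "reval y p * rf_var 0 ^ d = reval rf_var p"
    unfolding peval_def sum_distrib_right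
  proof (intro sum.cong refl)
    fix m assume "m \<in> Poly_Mapping.keys p"
    then have d: "d = (\<Sum>i\<in>Poly_Mapping.keys m. Poly_Mapping.lookup m i)"
      using hom by (auto simp: homogeneous_mpoly_def)
    have "mon y m * rf_var 0 ^ d = mon rf_var m"
      unfolding d mon_def power_sum prod.distrib[symmetric]
      by (intro prod.cong refl) (simp add: y_def power_divide)
    then show "rf_const (Poly_Mapping.lookup p m) * mon y m * rf_var 0 ^ d = rf_const (Poly_Mapping.lookup p m) * mon rf_var m"
      by (simp add: mult.assoc)
  qed
  ultimately show ?thesis by simp
qed

text \<open>A prime factor of a fails to divide some g j because the family has no common factor; it
  then divides b and is cancelled from a and b.\<close>

lemma dvd_if_dvd_all_mult:
  fixes a b :: mpoly
  assumes "a \<noteq> 0" "\<And>j. j \<in> J \<Longrightarrow> a dvd g j * b" "\<And>c. (\<forall>j\<in>J. c dvd g j) \<Longrightarrow> c dvd 1"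
  shows "a dvd b"
  using assms(1,2)
proof (induction "nat (tdeg a)" arbitrary: a b rule: less_induct)
  case less
  show ?case
  proof (cases "a dvd 1")
    case False
    obtain p where p: "prime_elem p" "p dvd a" using mpoly_prime_factor[OF less.prems(1) False] .
    then obtain a' where a': "a = p * a'" by (auto simp: dvd_def)
    have nz: "p \<noteq> 0" "a' \<noteq> 0" using a' less.prems(1) by auto
    have nu: "\<not> p dvd 1" using p(1) by (auto simp: prime_elem_def)
    then obtain j where j: "j \<in> J" "\<not> p dvd g j" using assms(3) by blast
    have "p dvd g j * b" using less.prems(2)[OF j(1)] p(2) by (rule dvd_trans[rotated])
    then have "p dvd b" using j p(1) by (simp add: prime_elem_dvd_mult_iff)
    then obtain b' where b': "b = p * b'" by (auto simp: dvd_def)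
    have "a' dvd g i * b'" if "i \<in> J" for i
    proof -
      have "p * a' dvd p * (g i * b')" using less.prems(2)[OF that] a' b' by (simp add: ac_simps)
      then show ?thesis using nz by simp
    qed
    moreover have "nat (tdeg a') < nat (tdeg a)"
      using a' nz nu wdeg_mult[OF nz, of "\<lambda>_. 1"] mpoly_unit_iff[of p] tdeg_nonneg[of p] tdeg_nonneg[of a'] by auto
    ultimately have "a' dvd b'" using less.hyps nz(2) by blast
    then show ?thesis using a' b' by simp
  next
    case True
    then show ?thesis using dvd_trans one_dvd by blast
  qed
qed

text \<open>Cross multiplication in the affine chart lifts to g i * g' 0 = g' i * g 0, both sides
  being homogeneous of the same degree. As the g i have no common factor, g 0 divides g' 0; the
  quotient divides every g' i, so it is a unit.\<close>

lemma proj_extension_degree_unique: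
  assumes g: "proj_extension k f d g" and g': "proj_extension k f d' g'"
  shows "d = d'"
proof -
  note G = g[unfolded proj_extension_def mpoly_subst_dehom]
  note G' = g'[unfolded proj_extension_def mpoly_subst_dehom]
  have nz: "g 0 \<noteq> 0" "g' 0 \<noteq> 0" using G G' by (auto simp: dehom_def)
  have cross: "g i * g' 0 = g' i * g 0" if "i \<in> {0..k}" for i
  proof (cases "i = 0")
    case False
    then have i: "i \<in> {1..k}" using that by auto
    have "f i = pol (dehom (g i)) / pol (dehom (g 0))" "f i = pol (dehom (g' i)) / pol (dehom (g' 0))"
      using G G' i by auto
    then have "pol (dehom (g i)) * pol (dehom (g' 0)) = pol (dehom (g' i)) * pol (dehom (g 0))"
      using G G' by (auto simp: field_simps)
    then have "pol (dehom (g i) * dehom (g' 0)) = pol (dehom (g' i) * dehom (g 0))"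
      by simp
    then have "dehom (g i * g' 0 - g' i * g 0) = 0"
      unfolding pol_eq_iff by (simp add: dehom_diff dehom_mult)
    moreover have "homogeneous_mpoly k (d + d') (g i * g' 0)" "homogeneous_mpoly k (d' + d) (g' i * g 0)"
      using G G' that by (auto intro!: homogeneous_mult)
    then have "homogeneous_mpoly k (d + d') (g i * g' 0 - g' i * g 0)"
      by (intro homogeneous_diff) (simp_all add: add.commute)
    ultimately show ?thesis using dehom_eq_0 by fastforce
  qed simp
  have "g 0 dvd g' 0"
  proof (rule dvd_if_dvd_all_mult[OF nz(1), of "{0..k}" g])
    show "g 0 dvd g j * g' 0" if "j \<in> {0..k}" for j using cross[OF that] by simp
    show "c dvd 1" if "\<forall>j\<in>{0..k}. c dvd g j" for c using G that by blast
  qed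
  then obtain c where c: "g' 0 = g 0 * c" by (auto simp: dvd_def)
  have "c dvd g' i" if "i \<in> {0..k}" for i
  proof -
    have "g 0 * (g i * c) = g 0 * g' i" using cross[OF that] c by (simp add: ac_simps)
    then show ?thesis using nz(1) by (metis dvd_triv_right mult_left_cancel)
  qed
  then have "c dvd 1" using G' by blast
  then have "tdeg (g' 0) = tdeg (g 0)"
    using c nz wdeg_mult[of "g 0" c "\<lambda>_. 1"] mpoly_unit_iff[of c] by auto
  moreover have "homogeneous_mpoly k d (g 0)" "homogeneous_mpoly k d' (g' 0)" using G G' by auto
  ultimately show ?thesis using homogeneous_iff nz by simp
qed

text \<open>The truncated difference is exact as soon as D is at least
  \<open>tdeg p\<close>.\<close>

definition homogenize :: "nat \<Rightarrow> mpoly \<Rightarrow> mpoly" where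
  "homogenize D p = (\<Sum>m\<in>Poly_Mapping.keys p. Poly_Mapping.single
     (m + Poly_Mapping.single 0 (D - nat (mweight (\<lambda>_. 1) m))) (Poly_Mapping.lookup p m))"

lemma homogenize:
  assumes "p \<in> polys_below (Suc k)" "vdeg 0 p = 0" "tdeg p \<le> int D"
  shows "homogeneous_mpoly k D (homogenize D p)" "dehom (homogenize D p) = p"
proof -
  let ?e = "\<lambda>m. m + Poly_Mapping.single 0 (D - nat (mweight (\<lambda>_. 1) m))"
  have w: "mweight (\<lambda>_. 1) m = int (\<Sum>i\<in>Poly_Mapping.keys m. Poly_Mapping.lookup m i)" for m
    by (simp add: mweight_def)
  have "Poly_Mapping.keys (?e m) \<subseteq> {0..k} \<and> (\<Sum>i\<in>Poly_Mapping.keys (?e m). Poly_Mapping.lookup (?e m) i) = D"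
    if m: "m \<in> Poly_Mapping.keys p" for m
  proof
    show "Poly_Mapping.keys (?e m) \<subseteq> {0..k}"
      using assms(1) m keys_add[of m "Poly_Mapping.single 0 (D - nat (mweight (\<lambda>_. 1) m))"]
      unfolding polys_below_iff by (force split: if_splits)
    have "mweight (\<lambda>_. 1) (?e m) = int D"
      using wdeg_ge[OF m, of "\<lambda>_. 1"] assms(3) w[of m] unfolding mweight_add mweight_single
      by linarith
    then show "(\<Sum>i\<in>Poly_Mapping.keys (?e m). Poly_Mapping.lookup (?e m) i) = D"
      unfolding w by linarith
  qed
  moreover have "Poly_Mapping.keys (homogenize D p) \<subseteq> (\<Union>m\<in>Poly_Mapping.keys p. {?e m})"
    unfolding homogenize_def by (rule order_trans[OF keys_sum]) (auto split: if_splits)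
  ultimately show "homogeneous_mpoly k D (homogenize D p)"
    unfolding homogeneous_mpoly_def by blast
  have "dehom (homogenize D p) = (\<Sum>m\<in>Poly_Mapping.keys p. mconst (Poly_Mapping.lookup p m) * mon (mvar(0 := 1)) (?e m))"
    unfolding homogenize_def dehom_def
    by (simp add: peval_sum[OF coeff_hom_mconst] peval_single[OF coeff_hom_mconst])
  also have "\<dots> = (\<Sum>m\<in>Poly_Mapping.keys p. Poly_Mapping.single m (Poly_Mapping.lookup p m))"
  proof (intro sum.cong refl)
    fix m assume m: "m \<in> Poly_Mapping.keys p"
    then have "0 \<notin> Poly_Mapping.keys m" using assms(2) by (simp add: vdeg_eq_0_iff)
    then have "mon (mvar(0 := 1)) m = mon mvar m"
      unfolding mon_def by (intro prod.cong refl) auto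
    then show "mconst (Poly_Mapping.lookup p m) * mon (mvar(0 := 1)) (?e m) = Poly_Mapping.single m (Poly_Mapping.lookup p m)"
      by (simp add: mon_add single_eq_const_mon)
  qed
  also have "\<dots> = p" using mpoly_eq_sum_singles[of p] by simp
  finally show "dehom (homogenize D p) = p" .
qed

lemma tdeg_dehom_le:
  assumes "dehom p \<noteq> 0"
  shows "tdeg (dehom p) \<le> tdeg p"
proof -
  have eq: "dehom p = (\<Sum>m\<in>Poly_Mapping.keys p. mconst (Poly_Mapping.lookup p m) * mon (mvar(0 := 1)) m)"
    by (simp add: dehom_def peval_def)
  show ?thesis
    unfolding eq
  proof (rule wdeg_sum_le)
    fix m assume m: "m \<in> Poly_Mapping.keys p"
    have pos: "tdeg ((mvar(0 := 1)) i ^ e) \<le> int e" "(mvar(0 := 1)) i ^ e \<noteq> (0::mpoly)" for i e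
      by (auto simp: wdeg_power)
    have "tdeg (mon (mvar(0 := 1)) m) = (\<Sum>i\<in>Poly_Mapping.keys m. tdeg ((mvar(0 := 1)) i ^ Poly_Mapping.lookup m i))"
      unfolding mon_def by (rule wdeg_prod) (rule pos(2))
    also have "\<dots> \<le> (\<Sum>i\<in>Poly_Mapping.keys m. int (Poly_Mapping.lookup m i))"
      by (intro sum_mono pos(1))
    also have "\<dots> \<le> tdeg p" using wdeg_ge[OF m, of "\<lambda>_. 1"] by (simp add: mweight_def)
    finally have "tdeg (mon (mvar(0 := 1)) m) \<le> tdeg p" .
    moreover have "mon (mvar(0 := 1)) m \<noteq> (0::mpoly)" unfolding mon_def prod_zero_iff[OF finite_keys] using pos(2) by blast
    ultimately show "tdeg (mconst (Poly_Mapping.lookup p m) * mon (mvar(0 := 1)) m) \<le> tdeg p"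
      using m by (simp add: wdeg_mult in_keys_iff)
  qed (use assms in \<open>simp_all flip: eq\<close>)
qed

text \<open>Among all homogeneous tuples representing f, one of least degree has no common factor,
  because dividing by a common factor would lower the degree.\<close>

lemma ratmap_degree_exists:
  assumes U: "\<And>i. i \<in> {1..k} \<Longrightarrow> f i = pol (U i) / pol V" and V: "V \<noteq> 0"
    and dV: "V \<in> polys_below (Suc k)" "vdeg 0 V = 0" "tdeg V \<le> int D"
    and dU: "\<And>i. i \<in> {1..k} \<Longrightarrow> U i \<in> polys_below (Suc k)" "\<And>i. i \<in> {1..k} \<Longrightarrow> vdeg 0 (U i) = 0"
      "\<And>i. i \<in> {1..k} \<Longrightarrow> tdeg (U i) \<le> int D"
  shows "ratmap_degree k f \<le> D"
    and "\<exists>g. proj_extension k f (ratmap_degree k f) g"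
proof -
  define T where "T = (\<lambda>d. \<exists>g. (\<forall>j\<in>{0..k}. homogeneous_mpoly k d (g j)) \<and> dehom (g 0) \<noteq> 0 \<and>
     (\<forall>i\<in>{1..k}. f i = pol (dehom (g i)) / pol (dehom (g 0))))"
  have "T D"
    unfolding T_def
    by (rule exI[of _ "\<lambda>j. if j = 0 then homogenize D V else homogenize D (U j)"])
       (use U V homogenize[OF dV] homogenize[OF dU] in auto)
  define d where "d = (LEAST d. T d)"
  have "T d" and dD: "d \<le> D" unfolding d_def using \<open>T D\<close> by (rule LeastI, rule Least_le)
  then obtain g where g: "\<forall>j\<in>{0..k}. homogeneous_mpoly k d (g j)" "dehom (g 0) \<noteq> 0"
    "\<forall>i\<in>{1..k}. f i = pol (dehom (g i)) / pol (dehom (g 0))" unfolding T_def by blast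
  have "c dvd 1" if c: "\<forall>j\<in>{0..k}. c dvd g j" for c
  proof (rule ccontr)
    assume nu: "\<not> c dvd 1"
    obtain e where e: "\<forall>j\<in>{0..k}. g j = c * e j" using c unfolding dvd_def by metis
    have nz: "c \<noteq> 0" "e 0 \<noteq> 0" "dehom c \<noteq> 0" "dehom (e 0) \<noteq> 0" using e g(2) by (auto simp: dehom_mult dehom_def)
    let ?d' = "d - nat (tdeg c)"
    have h: "homogeneous_mpoly k ?d' (e j)" if "j \<in> {0..k}" for j
      using homogeneous_factor[of k d c "e j"] g(1) e that nz(1) by (cases "e j = 0") auto
    have "T ?d'"
      unfolding T_def
      by (rule exI[of _ e]) (use h nz g(3) e in \<open>auto simp: dehom_mult\<close>)
    moreover have "nat (tdeg c) > 0" using nu nz mpoly_unit_iff[of c] tdeg_nonneg[of c] by simp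
    moreover have "nat (tdeg c) \<le> d"
      using homogeneous_factor[of k d c "e 0"] g(1) e nz by auto
    ultimately show False using not_less_Least[of ?d' T] unfolding d_def[symmetric] by simp
  qed
  then have pe: "proj_extension k f d g" using g unfolding proj_extension_def mpoly_subst_dehom by auto
  then have "ratmap_degree k f = d"
    unfolding ratmap_degree_def by (intro the_equality) (use proj_extension_degree_unique in blast)+
  then show "ratmap_degree k f \<le> D" "\<exists>g. proj_extension k f (ratmap_degree k f) g"
    using dD pe by auto
qed

lemma proj_extension_affine:
  assumes "proj_extension k f d g"
  obtains G0 G where "G0 \<noteq> 0" "\<And>i. i \<in> {1..k} \<Longrightarrow> f i = pol (G i) / pol G0"
    "\<And>i. i \<in> {1..k} \<Longrightarrow> tdeg (G i) \<le> int d"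
proof (rule that)
  note G = assms[unfolded proj_extension_def mpoly_subst_dehom]
  show "dehom (g 0) \<noteq> 0" using G by auto
  show "f i = pol (dehom (g i)) / pol (dehom (g 0))" if "i \<in> {1..k}" for i using G that by auto
  show "tdeg (dehom (g i)) \<le> int d" if "i \<in> {1..k}" for i
  proof (cases "dehom (g i) = 0")
    case False
    then have "g i \<noteq> 0" by (auto simp: dehom_def)
    then have "tdeg (g i) = int d" using G that homogeneous_iff[of "g i" k d] by auto
    then show ?thesis using tdeg_dehom_le[OF False] by simp
  qed simp
qed

section \<open>The Lyness sequence\<close>

text \<open>The disjunct \<open>k = 0\<close> secures termination. Index 0 is the homogenising
  variable; the recurrence refers to indices from 1 on.\<close>

function lys :: "nat \<Rightarrow> complex \<Rightarrow> nat \<Rightarrow> ratfun" where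
  "lys k a n = (if n \<le> k \<or> k = 0 then rf_var n
     else (rf_const a + (\<Sum>j\<in>{n - k + 1..<n}. lys k a j)) / lys k a (n - k))"
  by auto
termination by (relation "measure (\<lambda>(k, a, n). n)") auto

declare lys.simps [simp del]

text \<open>lcoef k z is the coefficient of t ^ z in 1 / ((1 - t ^ k) (1 - t ^ (k + 1))).\<close>

function lcoef :: "nat \<Rightarrow> int \<Rightarrow> nat" where
  "lcoef k z = (if z < 0 then 0 else (if int k dvd z then 1 else 0) + lcoef k (z - (int k + 1)))"
  by auto
termination by (relation "measure (\<lambda>(k, z). nat (z + 1))") auto

declare lcoef.simps [simp del]

lemma lcoef_neg [simp]: "z < 0 \<Longrightarrow> lcoef k z = 0"
  by (simp add: lcoef.simps)

locale lyness =
  fixes k :: nat and a :: complex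
  assumes k3: "k \<ge> 3"
begin

abbreviation X :: "nat \<Rightarrow> ratfun" where "X \<equiv> lys k a"
abbreviation c :: "int \<Rightarrow> nat" where "c \<equiv> lcoef k"

definition ell :: mpoly where
  "ell = mconst a + (\<Sum>j\<in>{2..k}. mvar j)"

lemma X_var: "n \<le> k \<Longrightarrow> X n = rf_var n"
  by (simp add: lys.simps)

lemma X_rec: "n > k \<Longrightarrow> X n = (rf_const a + (\<Sum>j\<in>{n - k + 1..<n}. X j)) / X (n - k)"
  using k3 by (subst lys.simps) auto

lemma pol_ell: "pol ell = rf_const a + (\<Sum>j\<in>{2..k}. rf_var j)"
  by (simp add: ell_def pol_sum)

lemma X_Suc_k: "X (k + 1) = pol ell / rf_var 1"
proof -
  have "(\<Sum>j\<in>{2..<Suc k}. X j) = (\<Sum>j\<in>{2..k}. rf_var j)"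
    by (intro sum.cong) (auto simp: X_var)
  then show ?thesis using X_rec[of "k + 1"] k3 X_var[of 1] by (simp add: pol_ell numeral_2_eq_2)
qed

section \<open>Reversibility: the shift as a product of two involutions\<close>

definition psi_vars :: "nat \<Rightarrow> ratfun" where
  "psi_vars i = (if i \<in> {1..k} then X (k + 2 - i) else rf_var i)"

text \<open>\<open>sig_vars\<close> reverses the indices by i -> k + 1 - i and
  \<open>psi_vars\<close> by i -> k + 2 - i, so that their product \<open>Theta\<close> is the shift
  i -> i + 1.\<close>

definition sig_vars :: "nat \<Rightarrow> mpoly" where
  "sig_vars i = (if i \<in> {1..k} then mvar (k + 1 - i) else mvar i)"

lemma reval_psi_ell: "reval psi_vars ell = pol ell"
proof -
  have "reval psi_vars ell = rf_const a + (\<Sum>j\<in>{2..k}. psi_vars j)"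
    by (simp add: ell_def peval_sum[OF coeff_hom_rf_const])
  also have "(\<Sum>j\<in>{2..k}. psi_vars j) = (\<Sum>j\<in>{2..k}. rf_var j)"
    by (rule sum.reindex_bij_witness[of _ "\<lambda>j. k + 2 - j" "\<lambda>j. k + 2 - j"])
       (auto simp: psi_vars_def X_var)
  finally show ?thesis by (simp add: pol_ell)
qed

text \<open>Only x 1 is inverted by the substitution, which accounts for the denominator. The second
  equation is the involution property in polynomial form; it yields dominance before
  \<open>Psi\<close> can be treated as a homomorphism, and later the transport of primes.\<close>

lemma psi_form: "\<exists>r U. reval psi_vars f = pol U / rf_var 1 ^ r \<and> reval psi_vars U = pol f * X (k + 1) ^ r"
proof (induction f rule: mpoly_induct)
  case (const b)
  then show ?case by (intro exI[of _ 0] exI[of _ "mconst b"]) simp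
next
  case (var i)
  consider "i = 1" | "i \<in> {2..k}" | "i \<notin> {1..k}" by force
  then show ?case
  proof cases
    case 1
    then have "reval psi_vars (mvar i) = pol ell / rf_var 1 ^ 1"
      using k3 X_Suc_k by (simp add: psi_vars_def)
    moreover have "reval psi_vars ell = pol (mvar i) * X (k + 1) ^ 1"
      unfolding reval_psi_ell X_Suc_k 1 by simp
    ultimately show ?thesis by blast
  next
    case 2
    then have "psi_vars i = rf_var (k + 2 - i)" "psi_vars (k + 2 - i) = rf_var i"
      using X_var[of "k + 2 - i"] X_var[of i] by (auto simp: psi_vars_def)
    then show ?thesis by (intro exI[of _ 0] exI[of _ "mvar (k + 2 - i)"]) simp
  next
    case 3
    then show ?thesis by (intro exI[of _ 0] exI[of _ "mvar i"]) (auto simp: psi_vars_def)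
  qed
next
  case (add f g)
  then obtain r U s V where *: "reval psi_vars f = pol U / rf_var 1 ^ r" "reval psi_vars U = pol f * X (k + 1) ^ r"
    "reval psi_vars g = pol V / rf_var 1 ^ s" "reval psi_vars V = pol g * X (k + 1) ^ s" by blast
  have p1: "psi_vars 1 = X (k + 1)" using k3 by (simp add: psi_vars_def)
  show ?case
    by (intro exI[of _ "r + s"] exI[of _ "U * mvar 1 ^ s + V * mvar 1 ^ r"])
       (use * p1 in \<open>simp add: field_simps power_add\<close>)
next
  case (mult f g)
  then obtain r U s V where *: "reval psi_vars f = pol U / rf_var 1 ^ r" "reval psi_vars U = pol f * X (k + 1) ^ r"
    "reval psi_vars g = pol V / rf_var 1 ^ s" "reval psi_vars V = pol g * X (k + 1) ^ s" by blast
  show ?case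
    by (intro exI[of _ "r + s"] exI[of _ "U * V"]) (use * in \<open>simp add: power_add\<close>)
qed

lemma ell_neq_0: "ell \<noteq> 0"
proof
  assume "ell = 0"
  then have "0 = peval id (\<lambda>i. if i = 2 then 1 - a else 0) ell" by simp
  also have "\<dots> = a + (\<Sum>j\<in>{2..k}. if j = 2 then 1 - a else 0)"
    by (simp add: ell_def peval_add[OF coeff_hom_id] peval_sum[OF coeff_hom_id] peval_var[OF coeff_hom_id] peval_const[OF coeff_hom_id])
  also have "\<dots> = 1" using k3 by (simp add: sum.delta')
  finally show False by simp
qed

lemma dominant_psi: "dominant psi_vars"
  unfolding dominant_def
proof (intro allI impI)
  fix f assume f: "reval psi_vars f = 0"
  obtain r U where *: "reval psi_vars f = pol U / rf_var 1 ^ r" "reval psi_vars U = pol f * X (k + 1) ^ r"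
    using psi_form by blast
  then have "U = 0" using f by simp
  then have "pol f * X (k + 1) ^ r = 0" using * by simp
  then show "f = 0" using X_Suc_k ell_neq_0 by simp
qed

lemma sig_sig: "peval mconst sig_vars (peval mconst sig_vars p) = p"
proof -
  have "(\<lambda>i. peval mconst sig_vars (sig_vars i)) = mvar"
    by (auto simp: sig_vars_def fun_eq_iff)
  then show ?thesis by (simp add: peval_peval[OF coeff_hom_mconst])
qed

lemma dominant_sig: "dominant (\<lambda>i. pol (sig_vars i))"
  unfolding dominant_def reval_pol pol_eq_0_iff by (metis peval_0 sig_sig)

definition Psi :: "ratfun \<Rightarrow> ratfun" where "Psi r = rf_subst r psi_vars"
definition Sig :: "ratfun \<Rightarrow> ratfun" where "Sig r = rf_subst r (\<lambda>i. pol (sig_vars i))"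
definition Theta :: "ratfun \<Rightarrow> ratfun" where "Theta r = Psi (Sig r)"

lemma hom_Psi: "field_hom Psi"
  using field_hom_rf_subst[OF dominant_psi] by (simp add: Psi_def[abs_def])

lemma hom_Sig: "field_hom Sig"
  using field_hom_rf_subst[OF dominant_sig] by (simp add: Sig_def[abs_def])

lemma hom_Theta: "field_hom Theta"
  using field_hom_comp[OF hom_Psi hom_Sig] by (simp add: Theta_def[abs_def])

lemma Psi_var: "Psi (rf_var i) = psi_vars i"
  by (simp add: Psi_def rf_subst_rf_var)

lemma Sig_var: "Sig (rf_var i) = (if i \<in> {1..k} then rf_var (k + 1 - i) else rf_var i)"
  by (simp add: Sig_def rf_subst_rf_var sig_vars_def)

lemma Sig_pol: "Sig (pol p) = pol (peval mconst sig_vars p)"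
  by (simp add: Sig_def rf_subst_pol reval_pol)

lemma Theta_var: "Theta (rf_var i) = (if i \<in> {1..k} then X (i + 1) else rf_var i)"
proof (cases "i \<in> {1..k}")
  case True
  then have "k + 2 - (k + 1 - i) = i + 1" by auto
  then show ?thesis using True by (auto simp: Theta_def Sig_var Psi_var psi_vars_def)
next
  case False
  then show ?thesis by (auto simp: Theta_def Sig_var Psi_var psi_vars_def)
qed

lemma Sig_Sig: "Sig (Sig r) = r"
  by (rule field_hom_eqI[OF field_hom_comp[OF hom_Sig hom_Sig] field_hom_id]) (auto simp: Sig_var)

lemma Psi_Psi: "Psi (Psi r) = r"
proof (rule field_hom_eqI[OF field_hom_comp[OF hom_Psi hom_Psi] field_hom_id])
  fix i
  have ell: "Psi (pol ell) = pol ell" by (simp add: Psi_def rf_subst_pol reval_psi_ell)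
  consider "i = 1" | "i \<in> {2..k}" | "i \<notin> {1..k}" by force
  then show "Psi (Psi (rf_var i)) = rf_var i"
  proof cases
    case 1
    then have "Psi (rf_var i) = pol ell / rf_var 1" using k3 X_Suc_k by (simp add: Psi_var psi_vars_def)
    then show ?thesis
      using 1 k3 X_Suc_k ell_neq_0
      by (simp add: field_hom_simps[OF hom_Psi] ell Psi_var psi_vars_def)
  next
    case 2
    then have "psi_vars i = rf_var (k + 2 - i)" "psi_vars (k + 2 - i) = rf_var i"
      using X_var[of "k + 2 - i"] X_var[of i] by (auto simp: psi_vars_def)
    then show ?thesis by (simp add: Psi_var)
  qed (auto simp: Psi_var psi_vars_def)
qed

text \<open>Both factors of \<open>Theta\<close> are involutions, so \<open>Sig\<close> conjugates
  \<open>Theta\<close> to its inverse.\<close>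

lemma Theta_Sig_Theta: "Theta (Sig (Theta r)) = Sig r"
  by (simp add: Theta_def Sig_Sig Psi_Psi)

lemma Theta_X: "n \<ge> 1 \<Longrightarrow> Theta (X n) = X (n + 1)"
proof (induction n rule: less_induct)
  case (less n)
  show ?case
  proof (cases "n \<le> k")
    case True
    then show ?thesis using less.prems by (simp add: X_var Theta_var)
  next
    case False
    have "Theta (X n) = (rf_const a + (\<Sum>j\<in>{n - k + 1..<n}. Theta (X j))) / Theta (X (n - k))"
      using False by (simp add: X_rec[of n] field_hom_simps[OF hom_Theta] field_hom_sum[OF hom_Theta])
    also have "Theta (X (n - k)) = X (n + 1 - k)"
      using less.IH[of "n - k"] False k3 by (simp add: Suc_diff_le)
    also have "(\<Sum>j\<in>{n - k + 1..<n}. Theta (X j)) = (\<Sum>j\<in>{n - k + 1..<n}. X (j + 1))"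
      by (intro sum.cong refl less.IH) auto
    also have "\<dots> = (\<Sum>j\<in>{n + 1 - k + 1..<n + 1}. X j)"
      by (rule sum.reindex_bij_witness[of _ "\<lambda>j. j - 1" "\<lambda>j. j + 1"]) (use False in auto)
    also have "(rf_const a + \<dots>) / X (n + 1 - k) = X (n + 1)"
      using X_rec[of "n + 1"] False by simp
    finally show ?thesis .
  qed
qed

lemma hom_Theta_pow: "field_hom (Theta ^^ m)"
  by (induction m) (auto intro: field_hom_id field_hom_comp[OF hom_Theta] simp: o_def id_def)

lemma Theta_pow_X: "n \<ge> 1 \<Longrightarrow> (Theta ^^ m) (X n) = X (n + m)"
  by (induction m) (simp_all add: Theta_X)

lemma X_neq_0 [simp]: "X n \<noteq> 0"
proof (cases "n \<ge> 1")
  case True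
  have "(Theta ^^ (n - 1)) (X 1) = X n" using Theta_pow_X[of 1 "n - 1"] True by simp
  moreover have "X 1 \<noteq> 0" using k3 by (simp add: X_var)
  ultimately show ?thesis by (metis field_hom_simps(9) hom_Theta_pow)
qed (simp add: X_var)

lemma X_mult: "n \<ge> 1 \<Longrightarrow> X n * X (n + k) = rf_const a + (\<Sum>j\<in>{n + 1..<n + k}. X j)"
  using X_rec[of "n + k"] by simp

text \<open>Subtracting two consecutive instances of the recurrence eliminates a and the common part
  of the sums. This is the usable form where the sum contains cancelling poles.\<close>

lemma X_shift: "n \<ge> 1 \<Longrightarrow> (1 + X (n + k + 1)) * X (n + 1) = X (n + k) * (1 + X n)"
proof -
  assume n: "n \<ge> 1"
  let ?S = "\<Sum>j\<in>{n + 2..<n + k}. X j"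
  have "{n + 1..<n + k} = insert (n + 1) {n + 2..<n + k}" using k3 by auto
  then have 1: "X n * X (n + k) = rf_const a + (X (n + 1) + ?S)" using X_mult[OF n] by simp
  have "{n + 2..<n + k + 1} = insert (n + k) {n + 2..<n + k}" using k3 by auto
  then have 2: "X (n + 1) * X (n + k + 1) = rf_const a + (X (n + k) + ?S)"
    using X_mult[of "n + 1"] by (simp add: add.commute add.left_commute)
  show ?thesis using 1 2 by (simp add: algebra_simps)
qed

text \<open>The reversal i -> M + k + 1 - i of the segment X 1, ..., X (M + k); M = 0 gives
  \<open>Sig\<close> and M = 1 gives \<open>Psi\<close>.\<close>

definition PsiM :: "nat \<Rightarrow> ratfun \<Rightarrow> ratfun" where "PsiM M r = (Theta ^^ M) (Sig r)"

lemma hom_PsiM: "field_hom (PsiM M)"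
  using field_hom_comp[OF hom_Theta_pow hom_Sig] by (simp add: PsiM_def[abs_def])

lemma PsiM_Theta: "PsiM M ((Theta ^^ M) r) = Sig r"
proof (induction M arbitrary: r)
  case (Suc M)
  have "PsiM (Suc M) ((Theta ^^ Suc M) r) = (Theta ^^ M) (Theta (Sig (Theta ((Theta ^^ M) r))))"
    by (simp only: PsiM_def funpow_Suc_right o_apply funpow_swap1)
  then show ?case using Suc.IH by (simp add: Theta_Sig_Theta PsiM_def)
qed (simp add: PsiM_def)

lemma PsiM_X:
  assumes "1 \<le> i" "i \<le> M + k"
  shows "PsiM M (X i) = X (M + k + 1 - i)"
proof -
  \<comment> \<open>The least shift that brings the index i - s into the window 1..k, where
    \<open>Sig\<close> acts by reversal.\<close>
  define s where "s = (if i \<le> k then 0 else i - k)"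
  have s: "s \<le> M" "1 \<le> i - s" "i - s \<le> k" "s \<le> i" using assms k3 by (auto simp: s_def)
  have "X i = (Theta ^^ s) (X (i - s))" using Theta_pow_X[of "i - s" s] s by simp
  moreover have "Theta ^^ M = Theta ^^ (M - s) \<circ> Theta ^^ s" using s by (simp flip: funpow_add)
  ultimately have "PsiM M (X i) = (Theta ^^ (M - s)) (PsiM s ((Theta ^^ s) (X (i - s))))"
    by (simp add: PsiM_def)
  also have "\<dots> = (Theta ^^ (M - s)) (X (k + 1 - (i - s)))"
    using s by (simp add: PsiM_Theta X_var Sig_var)
  also have "\<dots> = X (M + k + 1 - i)" using Theta_pow_X[of "k + 1 - (i - s)" "M - s"] s by (simp add: add.commute)
  finally show ?thesis .
qed

section \<open>Coordinates of the iterates\<close>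

lemma iterate_lyness:
  assumes "1 \<le> i" "i \<le> k"
  shows "ratmap_iterate n (lyness_map k a) i = X (n + i)"
  using assms
proof (induction n arbitrary: i)
  case 0
  then show ?case by (simp add: ratmap_iterate_def X_var)
next
  case (Suc n)
  let ?g = "ratmap_iterate n (lyness_map k a)"
  have it: "ratmap_iterate (Suc n) (lyness_map k a) i = rf_subst (lyness_map k a i) ?g"
    by (simp add: ratmap_iterate_def ratmap_comp_def)
  show ?case
  proof (cases "i < k")
    case True
    then have "lyness_map k a i = rf_var (i + 1)" by (simp add: lyness_map_def)
    then show ?thesis using Suc.IH[of "i + 1"] True by (simp add: it rf_subst_rf_var)
  next
    case False
    then have i: "i = k" using Suc.prems by simp
    have g1: "?g 1 = X (n + 1)" using Suc.IH[of 1] k3 by simp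
    have "lyness_map k a i = pol ell / pol (mvar 1)" by (simp add: lyness_map_def i pol_ell)
    then have "rf_subst (lyness_map k a i) ?g = reval ?g ell / reval ?g (mvar 1)"
      by (simp only:) (rule rf_subst_eval, use g1 in simp_all)
    also have "reval ?g ell = rf_const a + (\<Sum>j\<in>{2..k}. ?g j)"
      by (simp add: ell_def peval_sum[OF coeff_hom_rf_const])
    also have "(\<Sum>j\<in>{2..k}. ?g j) = (\<Sum>j\<in>{2..k}. X (n + j))"
      by (intro sum.cong refl Suc.IH) auto
    also have "\<dots> = (\<Sum>j\<in>{n + 1 + 1..<n + 1 + k}. X j)"
      by (rule sum.reindex_bij_witness[of _ "\<lambda>j. j - n" "\<lambda>j. n + j"]) auto
    also have "rf_const a + \<dots> = X (n + 1) * X (n + 1 + k)" using X_mult[of "n + 1"] by simp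
    finally have "rf_subst (lyness_map k a i) ?g = X (n + 1 + k)" using g1 by simp
    then show ?thesis unfolding it by (simp add: i ac_simps)
  qed
qed

section \<open>The exponents c and the tau functions\<close>

lemma c_step: "c z = (if z \<ge> 0 \<and> int k dvd z then 1 else 0) + c (z - (int k + 1))"
  by (cases "z < 0") (simp_all add: lcoef.simps[of k z])

text \<open>Coefficient of t^z in (1 - t^k) (1 - t^(k+1)) C(t) = 1, where C is the generating
  function of c; the negative terms are moved across because c takes natural values.\<close>

lemma c_identity: "c z + c (z - 2 * int k - 1) = c (z - int k) + c (z - int k - 1) + (if z = 0 then 1 else 0)"
proof -
  have b: "(if z \<ge> 0 \<and> int k dvd z then 1 else 0) =
    (if z - int k \<ge> 0 \<and> int k dvd (z - int k) then 1 else 0) + (if z = 0 then 1 else (0::nat))"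
  proof -
    have "int k dvd z - int k \<longleftrightarrow> int k dvd z" by (metis dvd_add_right_iff dvd_refl add.commute diff_add_cancel)
    moreover have "z = 0" if "int k dvd z" "0 \<le> z" "z < int k" using zdvd_not_zless[of z "int k"] that by force
    ultimately show ?thesis using k3 by auto
  qed
  show ?thesis
    using c_step[of z] c_step[of "z - int k"] b by (simp add: algebra_simps)
qed

lemma c_upper: "c z \<le> nat (z + 1)"
proof (induction "nat (z + 1)" arbitrary: z rule: less_induct)
  case less
  show ?case
  proof (cases "z < 0")
    case False
    then have "c (z - (int k + 1)) \<le> nat (z - (int k + 1) + 1)" by (intro less) auto
    then show ?thesis using False c_step[of z] by auto
  qed simp
qed

lemma c_iterate: "c (z + int n * (int k + 1)) = (\<Sum>s\<in>{1..n}. if z + int s * (int k + 1) \<ge> 0 \<and> int k dvd (z + int s * (int k + 1)) then 1 else 0) + c z"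
proof (induction n)
  case (Suc n)
  have "c (z + int (Suc n) * (int k + 1)) =
     (if z + int (Suc n) * (int k + 1) \<ge> 0 \<and> int k dvd (z + int (Suc n) * (int k + 1)) then 1 else 0) + c (z + int n * (int k + 1))"
    using c_step[of "z + int (Suc n) * (int k + 1)"] by (simp add: algebra_simps)
  then show ?case using Suc by (simp del: of_nat_Suc)
qed simp

text \<open>Since k + 1 is 1 modulo k, any k consecutive steps of length k + 1 meet all residues
  modulo k. One of them hits a multiple of k, so c grows by at least 1 over each distance k * (k +
  1).\<close>

lemma c_lower: "c (int m) \<ge> m div (k * (k + 1))"
proof (induction m rule: less_induct)
  case (less m)
  show ?case
  proof (cases "m < k * (k + 1)")
    case False
    let ?m = "m - k * (k + 1)"
    have kpos: "k * (k + 1) > 0" using k3 by simp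
    then have "m div (k * (k + 1)) = ?m div (k * (k + 1)) + 1"
      using False by (simp add: le_div_geq)
    also have "\<dots> \<le> c (int ?m) + 1" using less[of ?m] False kpos by auto
    also have "\<dots> \<le> c (int ?m + int k * (int k + 1))"
    proof -
      \<comment> \<open>Adding s * (k + 1) adds s modulo k, so this s turns the argument into a
        multiple of k.\<close>
      define s where "s = k - ?m mod k"
      have "?m mod k < k" using k3 by simp
      then have s: "s \<in> {1..k}" unfolding s_def by auto
      have "?m + s = k * (?m div k + 1)"
        using mult_div_mod_eq[of k ?m] \<open>?m mod k < k\<close> unfolding s_def distrib_left mult_1_right by linarith
      then have "int ?m + int s = int k * int (?m div k + 1)" by (metis of_nat_add of_nat_mult)
      then have "int k dvd int ?m + int s" by simp
      then have "int k dvd (int ?m + int s) + int s * int k" by (rule dvd_add) (rule dvd_triv_right)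
      then have d: "int k dvd int ?m + int s * (int k + 1)" by (simp add: algebra_simps)
      have "1 \<le> (\<Sum>s\<in>{1..k}. if int ?m + int s * (int k + 1) \<ge> 0 \<and> int k dvd (int ?m + int s * (int k + 1)) then 1 else (0::nat))"
        using member_le_sum[of s "{1..k}" "\<lambda>s. if int ?m + int s * (int k + 1) \<ge> 0 \<and> int k dvd (int ?m + int s * (int k + 1)) then 1 else (0::nat)"] s d
        by simp
      then show ?thesis using c_iterate[of "int ?m" k] by simp
    qed
    also have "int ?m + int k * (int k + 1) = int m"
    proof -
      have "int m = int ?m + int (k * (k + 1))" using False by simp
      then show ?thesis by (simp add: algebra_simps)
    qed
    finally show ?thesis .
  qed simp
qed

definition tau :: "nat \<Rightarrow> ratfun" where
  "tau n = (\<Prod>i\<in>{1..n}. X i ^ c (int n - int i))"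

lemma tau_neq_0 [simp]: "tau n \<noteq> 0"
  by (simp add: tau_def)

lemma tau_0 [simp]: "tau 0 = 1"
  by (simp add: tau_def)

text \<open>As c vanishes at negative arguments, the product may run up to any large N, and a
  negative z gives \<open>tau 0 = 1\<close>. This makes the truncated indices in
  \<open>tau_rel\<close> correct.\<close>

lemma tau_int:
  assumes "z \<le> int N"
  shows "tau (nat z) = (\<Prod>i\<in>{1..N}. X i ^ c (z - int i))"
proof -
  have "(\<Prod>i\<in>{1..N}. X i ^ c (z - int i)) = (\<Prod>i\<in>{1..nat z}. X i ^ c (z - int i))"
    by (rule prod.mono_neutral_right) (use assms in auto)
  also have "\<dots> = tau (nat z)" by (cases "z \<ge> 0") (simp_all add: tau_def)
  finally show ?thesis by simp
qed

text \<open>By \<open>c_identity\<close> at z = n - i the exponents of X i coming from the tau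
  functions balance except at i = n, which accounts for the factor X n.\<close>

lemma tau_rel:
  assumes "n \<ge> 1"
  shows "X n * (tau (n - k) * tau (n - k - 1)) = tau n * tau (n - 2 * k - 1)"
proof -
  have t: "tau (n - k) = (\<Prod>i\<in>{1..n}. X i ^ c (int n - int i - int k))"
    "tau (n - k - 1) = (\<Prod>i\<in>{1..n}. X i ^ c (int n - int i - int k - 1))"
    "tau (n - 2 * k - 1) = (\<Prod>i\<in>{1..n}. X i ^ c (int n - int i - 2 * int k - 1))"
  proof -
    have e: "int n - int k - int i = int n - int i - int k" "int n - int k - 1 - int i = int n - int i - int k - 1"
      "int n - 2 * int k - 1 - int i = int n - int i - 2 * int k - 1" for i by simp_all
    have "nat (int n - int k) = n - k" "nat (int n - int k - 1) = n - k - 1" "nat (int n - 2 * int k - 1) = n - 2 * k - 1"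
      by linarith+
    then show "tau (n - k) = (\<Prod>i\<in>{1..n}. X i ^ c (int n - int i - int k))"
      "tau (n - k - 1) = (\<Prod>i\<in>{1..n}. X i ^ c (int n - int i - int k - 1))"
      "tau (n - 2 * k - 1) = (\<Prod>i\<in>{1..n}. X i ^ c (int n - int i - 2 * int k - 1))"
      using tau_int[of "int n - int k" n] tau_int[of "int n - int k - 1" n] tau_int[of "int n - 2 * int k - 1" n]
      unfolding e by simp_all
  qed
  have "(\<Prod>i\<in>{1..n}. X i ^ (if int n - int i = 0 then 1 else 0)) = (\<Prod>i\<in>{1..n}. if i = n then X i else 1)"
    by (intro prod.cong) auto
  also have "\<dots> = X n" using assms by (simp add: prod.delta)
  finally have "X n = (\<Prod>i\<in>{1..n}. X i ^ (if int n - int i = 0 then 1 else 0))" ..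
  then have "X n * (tau (n - k) * tau (n - k - 1)) =
     (\<Prod>i\<in>{1..n}. X i ^ (if int n - int i = 0 then 1 else 0)) * (tau (n - k) * tau (n - k - 1))" by simp
  also have "\<dots> = (\<Prod>i\<in>{1..n}. X i ^ ((if int n - int i = 0 then 1 else 0) + (c (int n - int i - int k) + c (int n - int i - int k - 1))))"
    unfolding t by (simp only: power_add prod.distrib)
  also have "\<dots> = (\<Prod>i\<in>{1..n}. X i ^ (c (int n - int i) + c (int n - int i - 2 * int k - 1)))"
    by (simp only: c_identity add.commute)
  also have "\<dots> = tau n * tau (n - 2 * k - 1)"
    unfolding t tau_def[of n] by (simp only: power_add prod.distrib)
  finally show ?thesis .
qed

lemma tau_shift:
  assumes "M \<le> n"
  shows "tau n = (\<Prod>i\<in>{1..M}. X i ^ c (int n - int i)) * (Theta ^^ M) (tau (n - M))"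
proof -
  have "(Theta ^^ M) (tau (n - M)) = (\<Prod>i\<in>{1..n - M}. X (i + M) ^ c (int (n - M) - int i))"
    unfolding tau_def field_hom_prod[OF hom_Theta_pow] field_hom_simps(7)[OF hom_Theta_pow]
    by (intro prod.cong refl) (simp add: Theta_pow_X)
  also have "\<dots> = (\<Prod>i\<in>{M + 1..n}. X i ^ c (int n - int i))"
    by (rule prod.reindex_bij_witness[of _ "\<lambda>i. i - M" "\<lambda>i. i + M"]) (use assms in \<open>auto simp: algebra_simps of_nat_diff\<close>)
  finally have *: "(Theta ^^ M) (tau (n - M)) = (\<Prod>i\<in>{M + 1..n}. X i ^ c (int n - int i))" .
  have "{1..n} = {1..M} \<union> {M + 1..n}" using assms by auto
  then show ?thesis unfolding * tau_def[of n] by (simp add: prod.union_disjoint)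
qed

lemma tau_Suc: "tau (Suc n) = rf_var 1 ^ c (int n) * Theta (tau n)"
  using tau_shift[of 1 "Suc n"] k3 by (simp add: X_var)

end

declare One_nat_def [simp del]

section \<open>Localisation at a prime polynomial\<close>

text \<open>The local ring at p; \<open>lunit\<close> and \<open>ldvd\<close> describe its units and
  its maximal ideal, \<open>val\<close> the valuation. The latter is a relation, so that the order
  of a zero or pole is asserted by exhibiting a unit.\<close>

definition loc :: "mpoly \<Rightarrow> ratfun \<Rightarrow> bool" where
  "loc p f \<longleftrightarrow> (\<exists>U V. \<not> p dvd V \<and> f = pol U / pol V)"

definition lunit :: "mpoly \<Rightarrow> ratfun \<Rightarrow> bool" where
  "lunit p f \<longleftrightarrow> (\<exists>U V. \<not> p dvd U \<and> \<not> p dvd V \<and> f = pol U / pol V)"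

definition ldvd :: "mpoly \<Rightarrow> ratfun \<Rightarrow> bool" where
  "ldvd p f \<longleftrightarrow> (\<exists>U V. p dvd U \<and> \<not> p dvd V \<and> f = pol U / pol V)"

definition val :: "mpoly \<Rightarrow> ratfun \<Rightarrow> int \<Rightarrow> bool" where
  "val p f z \<longleftrightarrow> (\<exists>u. lunit p u \<and> f = u * pol p powi z)"

context
  fixes p :: mpoly
  assumes p: "prime_elem p"
begin

lemma prime_nz: "p \<noteq> 0" using p by (auto simp: prime_elem_def)

lemma loc_pol [simp]: "loc p (pol P)"
  unfolding loc_def using p by (intro exI[of _ P] exI[of _ 1]) (auto simp: prime_elem_def)

lemma not_dvd_mult: "\<not> p dvd U \<Longrightarrow> \<not> p dvd V \<Longrightarrow> \<not> p dvd U * V"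
  using p by (simp add: prime_elem_dvd_mult_iff)

lemma loc_add:
  assumes "loc p f" "loc p g" shows "loc p (f + g)"
proof -
  obtain U V U' V' where *: "\<not> p dvd V" "f = pol U / pol V" "\<not> p dvd V'" "g = pol U' / pol V'"
    using assms unfolding loc_def by blast
  then have "V \<noteq> 0" "V' \<noteq> 0" by auto
  then have "f + g = pol (U * V' + U' * V) / pol (V * V')"
    using * by (simp add: add_frac_eq)
  then show ?thesis unfolding loc_def using * not_dvd_mult by blast
qed

lemma loc_mult:
  assumes "loc p f" "loc p g" shows "loc p (f * g)"
proof -
  obtain U V U' V' where *: "\<not> p dvd V" "f = pol U / pol V" "\<not> p dvd V'" "g = pol U' / pol V'"
    using assms unfolding loc_def by blast
  then have "f * g = pol (U * U') / pol (V * V')" by simp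
  then show ?thesis unfolding loc_def using * not_dvd_mult by blast
qed

lemma loc_power: "loc p f \<Longrightarrow> loc p (f ^ n)"
  using loc_pol[of 1] by (induction n) (auto intro: loc_mult)

lemma ldvd_mult:
  assumes "ldvd p f" "loc p g" shows "ldvd p (f * g)"
proof -
  obtain U V U' V' where *: "p dvd U" "\<not> p dvd V" "f = pol U / pol V" "\<not> p dvd V'" "g = pol U' / pol V'"
    using assms unfolding loc_def ldvd_def by blast
  then have "f * g = pol (U * U') / pol (V * V')" "p dvd U * U'" by auto
  then show ?thesis unfolding ldvd_def using * not_dvd_mult by blast
qed

lemma lunit_mult:
  assumes "lunit p f" "lunit p g" shows "lunit p (f * g)"
proof -
  obtain U V U' V' where *: "\<not> p dvd U" "\<not> p dvd V" "f = pol U / pol V" "\<not> p dvd U'" "\<not> p dvd V'" "g = pol U' / pol V'"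
    using assms unfolding lunit_def by blast
  then have "f * g = pol (U * U') / pol (V * V')" by simp
  then show ?thesis unfolding lunit_def using * not_dvd_mult by blast
qed

lemma lunit_1 [simp]: "lunit p 1"
  unfolding lunit_def using p by (intro exI[of _ 1]) (auto simp: prime_elem_def)

lemma lunit_power: "lunit p f \<Longrightarrow> lunit p (f ^ n)"
  by (induction n) (auto intro: lunit_mult)

lemma lunit_prod: "(\<And>i. i \<in> S \<Longrightarrow> lunit p (f i)) \<Longrightarrow> lunit p (prod f S)"
  by (induction S rule: infinite_finite_induct) (auto intro: lunit_mult)

lemma lunit_inverse: "lunit p f \<Longrightarrow> lunit p (1 / f)"
  unfolding lunit_def by auto (metis divide_divide_eq_right mult_1)

lemma lunit_divide: "lunit p f \<Longrightarrow> lunit p g \<Longrightarrow> lunit p (f / g)"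
  using lunit_mult[OF _ lunit_inverse, of f g] by simp

lemma lunit_imp_loc: "lunit p f \<Longrightarrow> loc p f"
  unfolding lunit_def loc_def by blast

lemma ldvd_imp_loc: "ldvd p f \<Longrightarrow> loc p f"
  unfolding ldvd_def loc_def by blast

lemma lunit_neq_0: "lunit p f \<Longrightarrow> f \<noteq> 0"
  unfolding lunit_def by auto

lemma loc_divide: "loc p f \<Longrightarrow> lunit p g \<Longrightarrow> loc p (f / g)"
  using loc_mult[OF _ lunit_imp_loc[OF lunit_inverse], of f g] by simp

lemma lunit_not_ldvd:
  assumes "lunit p f" shows "\<not> ldvd p f"
proof
  assume "ldvd p f"
  then obtain U V U' V' where *: "\<not> p dvd U" "\<not> p dvd V" "f = pol U / pol V" "p dvd U'" "\<not> p dvd V'" "f = pol U' / pol V'"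
    using assms unfolding lunit_def ldvd_def by blast
  then have "V \<noteq> 0" "V' \<noteq> 0" by auto
  then have "pol (U * V') = pol (U' * V)" using * by (simp add: frac_eq_eq)
  then have "U * V' = U' * V" by (simp only: pol_eq_iff)
  then show False using * not_dvd_mult[of U V'] by (metis dvd_mult2)
qed

lemma ldvd_mult_lunit: "ldvd p (f * g) \<Longrightarrow> lunit p g \<Longrightarrow> ldvd p f"
  using ldvd_mult[of "f * g" "1 / g"] lunit_inverse[of g] lunit_imp_loc lunit_neq_0[of g] by simp

lemma ldvd_pol_iff: "ldvd p (pol P) \<longleftrightarrow> p dvd P"
proof
  assume "ldvd p (pol P)"
  then obtain U V where *: "p dvd U" "\<not> p dvd V" "pol P = pol U / pol V" unfolding ldvd_def by blast
  then have "V \<noteq> 0" by auto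
  then have "pol (P * V) = pol U" using * by simp
  then have "p dvd P * V" using * by (simp only: pol_eq_iff)
  then show "p dvd P" using * p by (simp add: prime_elem_dvd_mult_iff)
next
  assume "p dvd P"
  then show "ldvd p (pol P)"
    unfolding ldvd_def using p by (intro exI[of _ P] exI[of _ 1]) (auto simp: prime_elem_def)
qed

lemma lunit_pol_iff: "lunit p (pol P) \<longleftrightarrow> \<not> p dvd P"
proof
  assume "lunit p (pol P)" then show "\<not> p dvd P" using lunit_not_ldvd ldvd_pol_iff by blast
next
  assume "\<not> p dvd P"
  then show "lunit p (pol P)"
    unfolding lunit_def using p by (intro exI[of _ P] exI[of _ 1]) (auto simp: prime_elem_def)
qed

lemma loc_reval:
  assumes "\<And>i. loc p (y i)" shows "loc p (reval y P)"
proof (induction P rule: mpoly_induct)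
  case (const b) then show ?case using loc_pol[of "mconst b"] by simp
qed (auto simp: assms intro: loc_add loc_mult)

lemma val_mult: "val p f z \<Longrightarrow> val p g w \<Longrightarrow> val p (f * g) (z + w)"
proof -
  assume "val p f z" "val p g w"
  then obtain u v where "lunit p u" "f = u * pol p powi z" "lunit p v" "g = v * pol p powi w"
    unfolding val_def by blast
  then have "lunit p (u * v)" "f * g = (u * v) * pol p powi (z + w)"
    using prime_nz by (auto intro: lunit_mult simp: power_int_add)
  then show ?thesis unfolding val_def by blast
qed

lemma val_0_iff: "val p f 0 \<longleftrightarrow> lunit p f"
  by (simp add: val_def)

lemma val_power: "val p f z \<Longrightarrow> val p (f ^ n) (int n * z)"
proof (induction n)
  case 0 then show ?case by (simp add: val_0_iff)
next
  case (Suc n)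
  then show ?case using val_mult[of f z "f ^ n" "int n * z"] by (simp add: algebra_simps)
qed

lemma val_prod: "finite S \<Longrightarrow> (\<And>i. i \<in> S \<Longrightarrow> val p (f i) (z i)) \<Longrightarrow> val p (prod f S) (\<Sum>i\<in>S. z i)"
  by (induction S rule: finite_induct) (auto simp: val_0_iff intro: val_mult)

lemma val_1_imp_ldvd:
  assumes "val p f 1" shows "ldvd p f"
proof -
  obtain u where u: "lunit p u" "f = pol p * u" using assms by (auto simp: val_def)
  have "ldvd p (pol p)" by (simp add: ldvd_pol_iff)
  then show ?thesis using ldvd_mult lunit_imp_loc u by blast
qed

lemma power_dvd_cancel:
  assumes "p ^ r dvd Q * V" "\<not> p dvd V" shows "p ^ r dvd Q"
  using assms(1)
proof (induction r arbitrary: Q)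
  case (Suc r)
  then have "p dvd Q * V" by (metis dvd_mult_left power_Suc)
  then have "p dvd Q" using assms(2) p by (simp add: prime_elem_dvd_mult_iff)
  then obtain Q' where Q': "Q = p * Q'" by (auto simp: dvd_def)
  have "p * p ^ r dvd p * (Q' * V)" using Suc.prems unfolding Q' power_Suc mult.assoc .
  then have "p ^ r dvd Q' * V" unfolding dvd_mult_cancel_left using prime_nz by blast
  then have "p ^ r dvd Q'" by (rule Suc.IH)
  then show ?case unfolding Q' power_Suc by (rule mult_dvd_mono[OF dvd_refl])
qed simp

end

section \<open>The Laurent property\<close>

context lyness
begin

definition sig :: "mpoly \<Rightarrow> mpoly" where "sig p = peval mconst sig_vars p"

lemma Sig_pol': "Sig (pol p) = pol (sig p)"
  by (simp add: Sig_pol sig_def)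

lemma sig_invol [simp]: "sig (sig p) = p"
  by (simp add: sig_def sig_sig)

lemma sig_mult: "sig (p * q) = sig p * sig q"
  by (simp add: sig_def)

lemma sig_dvd_iff: "sig p dvd sig q \<longleftrightarrow> p dvd q"
  by (metis dvd_def sig_invol sig_mult)

lemma sig_prime: "prime_elem p \<Longrightarrow> prime_elem (sig p)"
proof (rule prime_elemI)
  assume p: "prime_elem p"
  have "sig 0 = 0" by (simp add: sig_def)
  then have "p = 0" if "sig p = 0" using sig_invol[of p] that by simp
  then show "sig p \<noteq> 0" using p by (auto simp: prime_elem_def)
  have "sig 1 = 1" by (simp add: sig_def)
  then show "\<not> sig p dvd 1" using p sig_dvd_iff[of p 1] by (simp add: prime_elem_def)
  show "sig p dvd f \<or> sig p dvd g" if "sig p dvd f * g" for f g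
    using that p sig_dvd_iff[of p "sig f"] sig_dvd_iff[of p "sig g"] sig_dvd_iff[of p "sig f * sig g"]
    by (simp add: sig_mult prime_elem_dvd_mult_iff)
qed

definition mx :: mpoly where "mx = (\<Prod>i\<in>{1..k}. mvar i)"
definition mx' :: mpoly where "mx' = (\<Prod>i\<in>{2..k}. mvar i)"

lemma mx_eq: "mx = mvar 1 * mx'"
proof -
  have "{1..k} = insert 1 {2..k}" using k3 by auto
  then show ?thesis by (simp add: mx_def mx'_def)
qed

lemma mx_neq_0 [simp]: "mx \<noteq> 0"
  by (simp add: mx_def)

lemma sig_mx: "sig mx = mx"
proof -
  have "sig mx = (\<Prod>i\<in>{1..k}. mvar (k + 1 - i))"
    by (simp add: sig_def mx_def peval_prod[OF coeff_hom_mconst] sig_vars_def)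
  also have "\<dots> = mx"
    unfolding mx_def by (rule prod.reindex_bij_witness[of _ "\<lambda>i. k + 1 - i" "\<lambda>i. k + 1 - i"]) auto
  finally show ?thesis .
qed

lemma mvar_dvd_mx: "i \<in> {1..k} \<Longrightarrow> mvar i dvd mx"
  unfolding mx_def by (rule dvd_prodI) auto

lemma pol_mx: "pol mx = (\<Prod>i\<in>{1..k}. rf_var i)"
  by (simp add: mx_def pol_prod)

text \<open>ell is x 2 minus a polynomial r free of x 2, so divisibility by ell means vanishing
  under x 2 := r, a substitution with values in a domain.\<close>

lemma prime_ell [simp]: "prime_elem ell"
proof -
  define r where "r = - (mconst a + (\<Sum>j\<in>{3..k}. mvar j))"
  define \<phi> where "\<phi> = peval mconst (mvar(2 := r))"
  have s: "{2..k} = insert 2 {3..k}" using k3 by auto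
  then have ell: "ell = mvar 2 - r" by (simp add: ell_def r_def)
  have "\<phi> r = r"
  proof -
    have "\<phi> (\<Sum>j\<in>{3..k}. mvar j) = (\<Sum>j\<in>{3..k}. mvar j)"
      unfolding \<phi>_def peval_sum[OF coeff_hom_mconst] by (intro sum.cong) auto
    then show ?thesis by (simp add: r_def \<phi>_def)
  qed
  then have phi_ell: "\<phi> ell = 0" by (simp add: ell \<phi>_def)
  have rem: "ell dvd f - \<phi> f" for f
  proof (induction f rule: mpoly_induct)
    case (var i)
    then show ?case by (cases "i = 2") (simp_all add: \<phi>_def ell)
  next
    case (add f g)
    then have "ell dvd (f - \<phi> f) + (g - \<phi> g)" by (rule dvd_add)
    then show ?case by (simp add: \<phi>_def algebra_simps)
  next
    case (mult f g)
    then have "ell dvd (f - \<phi> f) * g + \<phi> f * (g - \<phi> g)" by simp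
    then show ?case by (simp add: \<phi>_def algebra_simps)
  qed (simp add: \<phi>_def)
  have iff: "ell dvd f \<longleftrightarrow> \<phi> f = 0" for f
  proof
    assume "ell dvd f"
    then show "\<phi> f = 0" using phi_ell by (auto simp: dvd_def \<phi>_def)
  next
    assume "\<phi> f = 0" then show "ell dvd f" using rem[of f] by simp
  qed
  show ?thesis
    by (rule prime_elemI) (use ell_neq_0 in \<open>auto simp: iff \<phi>_def\<close>)
qed

definition laurent :: "ratfun \<Rightarrow> bool" where
  "laurent f \<longleftrightarrow> (\<exists>P r. f * pol mx ^ r = pol P)"

lemma laurent_pol [simp]: "laurent (pol P)"
  unfolding laurent_def by (intro exI[of _ P] exI[of _ 0]) simp

lemma laurent_mult:
  assumes "laurent f" "laurent g" shows "laurent (f * g)"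
proof -
  obtain P r Q s where "f * pol mx ^ r = pol P" "g * pol mx ^ s = pol Q"
    using assms unfolding laurent_def by blast
  moreover have "f * g * pol mx ^ (r + s) = (f * pol mx ^ r) * (g * pol mx ^ s)" by (simp add: power_add ac_simps)
  ultimately have "f * g * pol mx ^ (r + s) = pol (P * Q)" by simp
  then show ?thesis unfolding laurent_def by blast
qed

lemma laurent_add:
  assumes "laurent f" "laurent g" shows "laurent (f + g)"
proof -
  obtain P r Q s where "f * pol mx ^ r = pol P" "g * pol mx ^ s = pol Q"
    using assms unfolding laurent_def by blast
  moreover have "(f + g) * pol mx ^ (r + s) = (f * pol mx ^ r) * pol mx ^ s + (g * pol mx ^ s) * pol mx ^ r"
    by (simp add: power_add algebra_simps)
  ultimately have "(f + g) * pol mx ^ (r + s) = pol (P * mx ^ s + Q * mx ^ r)" by simp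
  then show ?thesis unfolding laurent_def by blast
qed

lemma laurent_prod: "(\<And>i. i \<in> S \<Longrightarrow> laurent (f i)) \<Longrightarrow> laurent (prod f S)"
  using laurent_pol[of 1] by (induction S rule: infinite_finite_induct) (auto intro: laurent_mult)

lemma laurent_power: "laurent f \<Longrightarrow> laurent (f ^ n)"
  using laurent_pol[of 1] by (induction n) (auto intro: laurent_mult)

lemma Psi_pol_form:
  obtains r U where "Psi (pol f) = pol U / rf_var 1 ^ r" "Psi (pol U) = pol f * X (k + 1) ^ r"
  using psi_form[of f] by (auto simp: Psi_def rf_subst_pol)

lemma Psi_mx: "Psi (pol mx) * rf_var 1 ^ 2 = pol mx * pol ell"
proof -
  have "Psi (pol mx) = psi_vars 1 * (\<Prod>i\<in>{2..k}. psi_vars i)"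
    by (simp add: mx_eq mx'_def field_hom_simps[OF hom_Psi] field_hom_prod[OF hom_Psi] pol_prod Psi_var)
  also have "(\<Prod>i\<in>{2..k}. psi_vars i) = (\<Prod>i\<in>{2..k}. rf_var i)"
    by (rule prod.reindex_bij_witness[of _ "\<lambda>j. k + 2 - j" "\<lambda>j. k + 2 - j"])
       (auto simp: psi_vars_def X_var)
  also have "psi_vars 1 = pol ell / rf_var 1"
  proof -
    have "psi_vars 1 = X (k + 2 - 1)" using k3 by (simp only: psi_vars_def) auto
    also have "k + 2 - 1 = k + 1" by simp
    finally show ?thesis unfolding X_Suc_k .
  qed
  finally show ?thesis by (simp add: mx_eq mx'_def pol_prod power2_eq_square)
qed

lemma Theta_pol: "Theta (pol P) = Psi (pol (sig P))"
  by (simp add: Theta_def Sig_pol')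

lemma Theta_mx: "Theta (pol mx) * rf_var 1 ^ 2 = pol mx * pol ell"
  by (simp add: Theta_pol sig_mx Psi_mx)

text \<open>\<open>Theta\<close> sends mx to mx * ell / x 1 ^ 2, so ell is the only new factor in
  the denominator.\<close>

lemma laurent_Theta:
  assumes "laurent f"
  shows "\<exists>Q r s. Theta f * pol ell ^ r * pol mx ^ s = pol Q"
proof -
  obtain P r where P: "f * pol mx ^ r = pol P" using assms unfolding laurent_def by blast
  obtain s U where U: "Psi (pol (sig P)) = pol U / rf_var 1 ^ s" by (rule Psi_pol_form)
  have "Theta f * Theta (pol mx) ^ r = pol U / rf_var 1 ^ s"
    using arg_cong[OF P, of Theta] U by (simp add: field_hom_simps[OF hom_Theta] Theta_pol)
  then have "(Theta f * Theta (pol mx) ^ r) * (rf_var 1 ^ 2) ^ r = pol U / rf_var 1 ^ s * (rf_var 1 ^ 2) ^ r"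
    by simp
  then have "Theta f * (Theta (pol mx) * rf_var 1 ^ 2) ^ r = pol U / rf_var 1 ^ s * (rf_var 1 ^ 2) ^ r"
    by (simp only: power_mult_distrib mult.assoc)
  then have "Theta f * pol ell ^ r * pol mx ^ r * pol mx ^ s = pol U / rf_var 1 ^ s * (rf_var 1 ^ 2) ^ r * pol mx ^ s"
    unfolding Theta_mx by (simp add: power_mult_distrib ac_simps)
  also have "\<dots> = pol (U * (mvar 1 ^ 2) ^ r * mx' ^ s)"
    by (simp add: mx_eq power_mult_distrib)
  finally have "Theta f * pol ell ^ r * pol mx ^ (r + s) = pol (U * (mvar 1 ^ 2) ^ r * mx' ^ s)"
    by (simp only: power_add mult.assoc)
  then show ?thesis by blast
qed

lemma laurent_if_loc:
  assumes f: "f * pol ell ^ r * pol mx ^ s = pol Q" and loc: "loc ell f"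
  shows "laurent f"
proof -
  obtain U V where UV: "\<not> ell dvd V" "f = pol U / pol V" using loc unfolding loc_def by blast
  then have "V \<noteq> 0" by auto
  then have "pol (U * ell ^ r * mx ^ s) = pol (Q * V)" using f UV(2) by (simp add: field_simps)
  then have "ell ^ r * (U * mx ^ s) = Q * V" by (simp only: pol_eq_iff) (simp add: ac_simps)
  then have "ell ^ r dvd Q * V" by (metis dvd_triv_left)
  then obtain Q' where "Q = ell ^ r * Q'"
    using power_dvd_cancel[OF prime_ell] UV(1) unfolding dvd_def by blast
  then have "pol ell ^ r * (f * pol mx ^ s) = pol ell ^ r * pol Q'" using f by (simp add: ac_simps)
  then have "f * pol mx ^ s = pol Q'" using ell_neq_0 by simp
  then show ?thesis unfolding laurent_def by blast
qed

text \<open>Index of the second zero, the last singular entry; the next k entries are expected to be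
  units along ell again.\<close>

definition M :: nat where "M = 3 * k + 2"

lemma M_ge: "2 * k + 3 \<le> M" "M \<ge> 1" "M > 0"
  using k3 by (simp_all add: M_def)

definition patw :: "nat \<Rightarrow> int" where
  "patw i = (if i = k + 1 \<or> i = 3 * k + 2 then 1 else if i = 2 * k + 1 \<or> i = 2 * k + 2 then - 1 else 0)"

end

text \<open>The singularity pattern is an assumption here and is discharged later at a special
  point; this is how k > 3 or a \<noteq> 1 enters. It reaches up to M + k in order to contain the
  full window of units behind the singularity.\<close>

locale lyness_pattern = lyness +
  assumes pattern: "1 \<le> i \<Longrightarrow> i \<le> M + k \<Longrightarrow> val ell (X i) (patw i)"
begin

text \<open>\<open>patw\<close> has the generating function t^(k+1) (1 - t^k) (1 - t^(k+1)); its
  convolution with c is the single term t^(k+1).\<close>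

lemma patw_sum:
  assumes "M \<le> N"
  shows "(\<Sum>i\<in>{1..N}. int (c (z - int i)) * patw i) = (if z = int k + 1 then 1 else 0)"
proof -
  have "(\<Sum>i\<in>{1..N}. int (c (z - int i)) * patw i) = (\<Sum>i\<in>{k + 1, M, 2 * k + 1, 2 * k + 2}. int (c (z - int i)) * patw i)"
    by (rule sum.mono_neutral_right) (use assms k3 in \<open>auto simp: patw_def M_def\<close>)
  also have "\<dots> = int (c (z - int (k + 1))) + int (c (z - int M)) - int (c (z - int (2 * k + 1))) - int (c (z - int (2 * k + 2)))"
    using k3 by (simp add: patw_def M_def)
  also have "\<dots> = (if z = int k + 1 then 1 else 0)"
  proof -
    let ?z = "z - (int k + 1)"
    have e: "z - int (k + 1) = ?z" "z - int M = ?z - 2 * int k - 1" "z - int (2 * k + 1) = ?z - int k"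
      "z - int (2 * k + 2) = ?z - int k - 1" "(z = int k + 1) = (?z = 0)"
      by (auto simp: M_def)
    have "int (c ?z) + int (c (?z - 2 * int k - 1)) = int (c (?z - int k)) + int (c (?z - int k - 1)) + (if ?z = 0 then 1 else 0)"
      using arg_cong[OF c_identity[of ?z], of int] by (simp only: of_nat_add if_distrib[of int] of_nat_1 of_nat_0)
    then show ?thesis unfolding e by linarith
  qed
  finally show ?thesis .
qed

lemma val_X_prod:
  assumes "M \<le> N" "N \<le> M + k"
  shows "val ell (\<Prod>i\<in>{1..N}. X i ^ c (z - int i)) (if z = int k + 1 then 1 else 0)"
  unfolding patw_sum[OF assms(1), symmetric]
  by (intro val_prod prime_ell val_power pattern) (use assms in auto)

lemma val_tau:
  assumes "n \<le> M + k"
  shows "val ell (tau n) (if n = k + 1 then 1 else 0)"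
proof -
  have "(int n = int k + 1) = (n = k + 1)" by linarith
  then show ?thesis using val_X_prod[of "M + k" "int n"] tau_int[of "int n" "M + k"] assms by simp
qed

lemma lunit_X_window:
  assumes "M < i" "i \<le> M + k" shows "lunit ell (X i)"
  using pattern[of i] assms by (simp add: patw_def val_0_iff M_def)

lemma lunit_X_start:
  assumes "1 \<le> i" "i \<le> k" shows "lunit ell (X i)"
  using pattern[of i] assms by (simp add: patw_def val_0_iff M_def)

lemma ell_not_dvd_mx: "\<not> ell dvd mx"
proof -
  have "lunit ell (pol mx)" unfolding pol_mx
    by (intro lunit_prod prime_ell) (use lunit_X_start X_var in auto)
  then show ?thesis using lunit_pol_iff[OF prime_ell] by simp
qed

lemma Theta_pow_mx: "lunit ell ((Theta ^^ M) (pol mx))"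
  unfolding pol_mx field_hom_prod[OF hom_Theta_pow]
proof (intro lunit_prod prime_ell)
  fix i assume i: "i \<in> {1..k}"
  then have "(Theta ^^ M) (rf_var i) = X (i + M)" using Theta_pow_X[of i M] by (simp add: X_var)
  then show "lunit ell ((Theta ^^ M) (rf_var i))" using lunit_X_window[of "i + M"] i by simp
qed

lemma Theta_var_outside: "i \<notin> {1..k} \<Longrightarrow> (Theta ^^ m) (rf_var i) = rf_var i"
  by (induction m) (auto simp: Theta_var)

lemma loc_Theta_pow_pol: "loc ell ((Theta ^^ M) (pol P))"
  unfolding field_hom_pol[OF hom_Theta_pow]
proof (rule loc_reval[OF prime_ell])
  fix i show "loc ell ((Theta ^^ M) (rf_var i))"
  proof (cases "i \<in> {1..k}")
    case True
    then have "(Theta ^^ M) (rf_var i) = X (i + M)" using Theta_pow_X[of i M] by (simp add: X_var)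
    then show ?thesis using lunit_X_window[of "i + M"] True lunit_imp_loc[OF prime_ell] by simp
  next
    case False
    then show ?thesis using loc_pol[OF prime_ell, of "mvar i"] by (simp add: Theta_var_outside)
  qed
qed

lemma loc_Theta_pow: 
  assumes "laurent f" shows "loc ell ((Theta ^^ M) f)"
proof -
  obtain P r where "f * pol mx ^ r = pol P" using assms unfolding laurent_def by blast
  then have "f = pol P / pol mx ^ r" by (simp add: eq_divide_eq)
  then have "(Theta ^^ M) f = (Theta ^^ M) (pol P) / (Theta ^^ M) (pol mx) ^ r"
    by (simp add: field_hom_simps[OF hom_Theta_pow])
  then show ?thesis
    using loc_divide[OF prime_ell loc_Theta_pow_pol lunit_power[OF prime_ell Theta_pow_mx]] by simp
qed

lemma tau_shift_M:
  assumes "n > M + k"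
  obtains u where "lunit ell u" "tau n = u * (Theta ^^ M) (tau (n - M))"
proof (rule that)
  show "tau n = (\<Prod>i\<in>{1..M}. X i ^ c (int n - int i)) * (Theta ^^ M) (tau (n - M))"
    using assms by (intro tau_shift) simp
  show "lunit ell (\<Prod>i\<in>{1..M}. X i ^ c (int n - int i))"
    using val_X_prod[of M "int n"] assms val_0_iff[OF prime_ell] M_ge by simp
qed

text \<open>One shift leaves ell as the only possible extra denominator, so integrality along ell
  suffices. Up to n = M + k the valuation of tau n is known; beyond that, tau n is a unit times the
  Laurent polynomial tau (n - M) evaluated at the window of units X (M + 1), ..., X (M + k).\<close>

theorem laurent_tau: "laurent (tau n)"
proof (induction n rule: less_induct)
  case (less n)
  show ?case
  proof (cases n)
    case 0
    then show ?thesis using laurent_pol[of 1] by simp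
  next
    case (Suc m)
    obtain Q r s where Q: "Theta (tau m) * pol ell ^ r * pol mx ^ s = pol Q"
      using laurent_Theta[OF less[of m]] Suc by auto
    have "tau n * pol ell ^ r * pol mx ^ s = rf_var 1 ^ c (int m) * (Theta (tau m) * pol ell ^ r * pol mx ^ s)"
      unfolding Suc tau_Suc by (simp only: ac_simps)
    also have "\<dots> = pol (mvar 1 ^ c (int m) * Q)" unfolding Q by simp
    finally have e: "tau n * pol ell ^ r * pol mx ^ s = pol (mvar 1 ^ c (int m) * Q)" .
    have "loc ell (tau n)"
    proof (cases "n \<le> M + k")
      case True
      then show ?thesis
        using val_tau[of n] val_1_imp_ldvd[OF prime_ell] ldvd_imp_loc[OF prime_ell] val_0_iff[OF prime_ell] lunit_imp_loc[OF prime_ell]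
        by (auto split: if_splits)
    next
      case False
      then obtain u where u: "lunit ell u" "tau n = u * (Theta ^^ M) (tau (n - M))"
        using tau_shift_M by (metis not_le)
      have "laurent (tau (n - M))" using less[of "n - M"] False M_ge by simp
      then show ?thesis unfolding u(2)
        by (intro loc_mult[OF prime_ell] lunit_imp_loc[OF prime_ell] u(1) loc_Theta_pow)
    qed
    then show ?thesis using laurent_if_loc[OF e] by simp
  qed
qed

section \<open>Coprimality\<close>

lemma loc_PsiM_pol: "loc ell (PsiM M (pol P))"
  unfolding field_hom_pol[OF hom_PsiM]
proof (rule loc_reval[OF prime_ell])
  fix i show "loc ell (PsiM M (rf_var i))"
  proof (cases "i \<in> {1..k}")
    case True
    then have "PsiM M (rf_var i) = X (M + k + 1 - i)" using PsiM_X[of i M] by (simp add: X_var)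
    moreover have "M < M + k + 1 - i" "M + k + 1 - i \<le> M + k" using True by auto
    ultimately show ?thesis using lunit_X_window[of "M + k + 1 - i"] lunit_imp_loc[OF prime_ell] by simp
  next
    case False
    then have "PsiM M (rf_var i) = rf_var i" by (simp only: PsiM_def Sig_var if_False Theta_var_outside[OF False])
    then show ?thesis using loc_pol[OF prime_ell, of "mvar i"] by simp
  qed
qed

lemma lunit_PsiM_mx: "lunit ell (PsiM M (pol mx))"
  unfolding pol_mx field_hom_prod[OF hom_PsiM]
proof (intro lunit_prod prime_ell)
  fix i assume i: "i \<in> {1..k}"
  then have "PsiM M (rf_var i) = X (M + k + 1 - i)" using PsiM_X[of i M] by (simp add: X_var)
  moreover have "M < M + k + 1 - i" "M + k + 1 - i \<le> M + k" using i by auto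
  ultimately show "lunit ell (PsiM M (rf_var i))" using lunit_X_window[of "M + k + 1 - i"] by simp
qed

text \<open>\<open>patw\<close> is symmetric under i -> M + k + 1 - i, so after the reversal every X
  i keeps its valuation and the computation for tau n applies again.\<close>

lemma lunit_PsiM_tau:
  assumes "n \<le> M + k" "n \<noteq> k + 1"
  shows "lunit ell (PsiM M (tau n))"
proof -
  have patw_sym: "patw (M + k + 1 - i) = patw i" if "i \<in> {1..M + k}" for i
    using that k3 by (auto simp: patw_def M_def)
  have "PsiM M (tau n) = (\<Prod>i\<in>{1..M + k}. X (M + k + 1 - i) ^ c (int n - int i))"
    using tau_int[of "int n" "M + k"] assms(1)
    by (simp add: field_hom_prod[OF hom_PsiM] field_hom_simps[OF hom_PsiM] PsiM_X)
  moreover have "val ell (\<Prod>i\<in>{1..M + k}. X (M + k + 1 - i) ^ c (int n - int i))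
      (\<Sum>i\<in>{1..M + k}. int (c (int n - int i)) * patw i)"
  proof (intro val_prod prime_ell val_power)
    fix i assume i: "i \<in> {1..M + k}"
    then have "1 \<le> M + k + 1 - i" "M + k + 1 - i \<le> M + k" by auto
    then show "val ell (X (M + k + 1 - i)) (patw i)"
      using pattern[of "M + k + 1 - i"] patw_sym[OF i] by simp
  qed simp
  moreover have "(\<Sum>i\<in>{1..M + k}. int (c (int n - int i)) * patw i) = 0"
    using patw_sum[of "M + k" "int n"] assms by simp
  ultimately show ?thesis using val_0_iff[OF prime_ell] by simp
qed

text \<open>Its square clears the denominators of X (M + 1), ..., X (M + k), which are products of
  two tau j with j from 2 k + 2 to M. The range avoids j = k + 1, the only tau j up to M + k that
  vanishes along ell.\<close>

definition W :: ratfun where "W = (\<Prod>j\<in>{k + 2..M + k}. tau j)"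

lemma laurent_W: "laurent W"
  unfolding W_def by (intro laurent_prod laurent_tau)

lemma laurent_X_W:
  assumes "i \<in> {1..k}" shows "laurent (X (M + i) * W ^ 2)"
proof -
  have split: "\<exists>V. W = tau j * V \<and> laurent V" if "j \<in> {k + 2..M + k}" for j
    using prod.remove[OF _ that, of tau] by (auto simp: W_def intro!: exI[of _ "prod tau ({k + 2..M + k} - {j})"] laurent_prod laurent_tau)
  obtain V1 where V1: "W = tau (M + i - k) * V1" "laurent V1" using split[of "M + i - k"] assms M_ge by force
  obtain V2 where V2: "W = tau (M + i - k - 1) * V2" "laurent V2" using split[of "M + i - k - 1"] assms M_ge by force
  have "X (M + i) * W ^ 2 = X (M + i) * (tau (M + i - k) * tau (M + i - k - 1)) * (V1 * V2)"
    by (simp only: power2_eq_square) (subst (1) V1(1), subst V2(1), simp only: ac_simps)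
  also have "\<dots> = tau (M + i) * tau (M + i - 2 * k - 1) * (V1 * V2)"
    using tau_rel[of "M + i"] M_ge by simp
  finally show ?thesis using V1 V2 by (auto intro!: laurent_mult laurent_tau)
qed

lemma laurent_Theta_W: "\<exists>s. laurent ((Theta ^^ M) (pol P) * W ^ s)"
proof (induction P rule: mpoly_induct)
  case (const b)
  show ?case using laurent_pol[of "mconst b"] by (intro exI[of _ 0]) (simp add: field_hom_simps[OF hom_Theta_pow])
next
  case (var i)
  show ?case
  proof (cases "i \<in> {1..k}")
    case True
    then have "(Theta ^^ M) (rf_var i) = X (M + i)" using Theta_pow_X[of i M] by (simp add: X_var add.commute)
    then show ?thesis using laurent_X_W[OF True] by (intro exI[of _ 2]) simp
  next
    case False
    then show ?thesis using laurent_pol[of "mvar i"] by (intro exI[of _ 0]) (simp add: Theta_var_outside)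
  qed
next
  case (add f g)
  then obtain s t where st: "laurent ((Theta ^^ M) (pol f) * W ^ s)" "laurent ((Theta ^^ M) (pol g) * W ^ t)" by blast
  have "laurent ((Theta ^^ M) (pol f) * W ^ s * W ^ t + (Theta ^^ M) (pol g) * W ^ t * W ^ s)"
    by (intro laurent_add laurent_mult st laurent_power laurent_W)
  then show ?case
    by (intro exI[of _ "s + t"]) (simp add: field_hom_simps[OF hom_Theta_pow] power_add algebra_simps)
next
  case (mult f g)
  then obtain s t where st: "laurent ((Theta ^^ M) (pol f) * W ^ s)" "laurent ((Theta ^^ M) (pol g) * W ^ t)" by blast
  from laurent_mult[OF this] show ?case
    by (intro exI[of _ "s + t"]) (simp add: field_hom_simps[OF hom_Theta_pow] power_add ac_simps)
qed

text \<open>Clearing denominators with W and mx, both units along ell, gives a polynomial multiple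
  of ell, to which the reversal \<open>PsiM M\<close> is applied. It turns \<open>Theta ^^ M\<close>
  into \<open>Sig\<close>, keeps W and mx units, and sends ell = X 1 X (k + 1) to X (M + k) X M,
  which still vanishes along ell.\<close>

lemma ell_dvd_sig:
  assumes "ldvd ell ((Theta ^^ M) (pol P))"
  shows "ell dvd sig P"
proof -
  obtain s where s: "laurent ((Theta ^^ M) (pol P) * W ^ s)" using laurent_Theta_W by blast
  have uW: "lunit ell W" unfolding W_def
  proof (intro lunit_prod prime_ell)
    fix j assume "j \<in> {k + 2..M + k}"
    then show "lunit ell (tau j)" using val_tau[of j] val_0_iff[OF prime_ell] by simp
  qed
  obtain G r where G: "(Theta ^^ M) (pol P) * W ^ s * pol mx ^ r = pol G" using s unfolding laurent_def by blast
  have "ldvd ell (pol G)" unfolding G[symmetric]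
    by (intro ldvd_mult[OF prime_ell] assms loc_power[OF prime_ell] lunit_imp_loc[OF prime_ell] uW loc_pol[OF prime_ell])
  then obtain G' where G': "G = ell * G'" using ldvd_pol_iff[OF prime_ell] by (auto simp: dvd_def)
  have "PsiM M ((Theta ^^ M) (pol P) * W ^ s * pol mx ^ r) = PsiM M (pol ell * pol G')"
    unfolding G G' by simp
  then have e: "pol (sig P) * (PsiM M W ^ s * PsiM M (pol mx) ^ r) = PsiM M (pol ell) * PsiM M (pol G')"
    by (simp add: field_hom_simps[OF hom_PsiM] PsiM_Theta Sig_pol' mult.assoc)
  have "pol ell = X 1 * X (k + 1)" using X_Suc_k X_var[of 1] k3 by simp
  then have "PsiM M (pol ell) = X (M + k) * X M"
    using PsiM_X[of 1 M] PsiM_X[of "k + 1" M] M_ge by (simp add: field_hom_simps[OF hom_PsiM])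
  moreover have "ldvd ell (X M * X (M + k))"
  proof (rule ldvd_mult[OF prime_ell])
    show "ldvd ell (X M)" using pattern[of M] val_1_imp_ldvd[OF prime_ell] by (simp add: patw_def M_def)
    show "loc ell (X (M + k))" using lunit_X_window[of "M + k"] k3 lunit_imp_loc[OF prime_ell] by simp
  qed
  ultimately have "ldvd ell (PsiM M (pol ell))" by (simp add: mult.commute)
  then have "ldvd ell (pol (sig P) * (PsiM M W ^ s * PsiM M (pol mx) ^ r))"
    unfolding e by (rule ldvd_mult[OF prime_ell _ loc_PsiM_pol])
  moreover have "lunit ell (PsiM M W)" unfolding W_def field_hom_prod[OF hom_PsiM]
    by (intro lunit_prod prime_ell lunit_PsiM_tau) auto
  then have "lunit ell (PsiM M W ^ s * PsiM M (pol mx) ^ r)"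
    by (intro lunit_mult lunit_power prime_ell lunit_PsiM_mx)
  ultimately have "ldvd ell (pol (sig P))"
    by (rule ldvd_mult_lunit[OF prime_ell])
  then show ?thesis using ldvd_pol_iff[OF prime_ell] by simp
qed

lemma dvd_power_if_primes_dvd:
  fixes P B :: mpoly
  assumes "P \<noteq> 0" "\<And>q. prime_elem q \<Longrightarrow> q dvd P \<Longrightarrow> q dvd B"
  shows "\<exists>N. P dvd B ^ N"
  using assms
proof (induction "nat (tdeg P)" arbitrary: P rule: less_induct)
  case less
  show ?case
  proof (cases "P dvd 1")
    case True
    then show ?thesis by (intro exI[of _ 0]) simp
  next
    case False
    obtain q where q: "prime_elem q" "q dvd P" using mpoly_prime_factor[OF less.prems(1) False] .
    then obtain R where R: "P = q * R" by (auto simp: dvd_def)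
    have nz: "q \<noteq> 0" "R \<noteq> 0" using R less.prems(1) by auto
    have "nat (tdeg R) < nat (tdeg P)"
      using R nz q wdeg_mult[OF nz, of "\<lambda>_. 1"] mpoly_unit_iff[of q] tdeg_nonneg[of q] tdeg_nonneg[of R]
      by (auto simp: prime_elem_def)
    then obtain N where "R dvd B ^ N" using less.hyps[of R] nz less.prems(2) R by fastforce
    then have "P dvd B ^ Suc N" using R less.prems(2)[OF q] by (simp add: mult_dvd_mono)
    then show ?thesis by blast
  qed
qed

text \<open>\<open>Psi\<close> is an involution of the ring with mx and ell inverted, so p cannot
  become a unit there: if the numerator p' of its image had only prime factors dividing mx * ell,
  applying \<open>Psi\<close> again would make p divide such a product. Any other prime factor q of
  p' follows p under \<open>Psi\<close>, and \<open>sig q\<close> does so under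
  \<open>Theta\<close>.\<close>

lemma transport_prime:
  assumes p: "prime_elem p" and mx: "\<not> p dvd mx" and ell: "\<not> p dvd ell"
  shows "\<exists>q. prime_elem q \<and> \<not> q dvd mx \<and> (\<forall>P. ldvd p (Theta (pol P)) \<longrightarrow> q dvd P)"
proof -
  have x1: "mvar 1 dvd mx" using mvar_dvd_mx[of 1] k3 by simp
  have px1: "\<not> p dvd mvar 1" using mx x1 dvd_trans by blast
  obtain s p' where p': "Psi (pol p) = pol p' / rf_var 1 ^ s" "Psi (pol p') = pol p * X (k + 1) ^ s"
    by (rule Psi_pol_form)
  have p'nz: "p' \<noteq> 0" using p' p by (auto simp: field_hom_simps[OF hom_Psi] prime_elem_def)
  have "\<exists>q. prime_elem q \<and> q dvd p' \<and> \<not> q dvd mx * ell"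
  proof (rule ccontr)
    assume "\<not> ?thesis"
    then have "\<And>q. prime_elem q \<Longrightarrow> q dvd p' \<Longrightarrow> q dvd mx * ell" by simp
    then obtain N where "p' dvd (mx * ell) ^ N" using dvd_power_if_primes_dvd[OF p'nz, of "mx * ell"] by auto
    then obtain R where R: "(mx * ell) ^ N = p' * R" by (auto simp: dvd_def)
    obtain t R' where R': "Psi (pol R) = pol R' / rf_var 1 ^ t" by (rule Psi_pol_form)
    have Psi_ell: "Psi (pol ell) = pol ell" by (simp add: Psi_def rf_subst_pol reval_psi_ell)
    have "Psi (pol ((mx * ell) ^ N)) = Psi (pol (p' * R))" unfolding R ..
    then have "(Psi (pol mx) * pol ell) ^ N = pol p * (pol ell / rf_var 1) ^ s * (pol R' / rf_var 1 ^ t)"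
      using X_Suc_k by (simp add: field_hom_simps[OF hom_Psi] p' R' Psi_ell)
    then have "(Psi (pol mx) * pol ell) ^ N * (rf_var 1 ^ 2) ^ N = pol p * (pol ell / rf_var 1) ^ s * (pol R' / rf_var 1 ^ t) * (rf_var 1 ^ 2) ^ N"
      by simp
    then have "(Psi (pol mx) * rf_var 1 ^ 2 * pol ell) ^ N = pol p * (pol ell / rf_var 1) ^ s * (pol R' / rf_var 1 ^ t) * (rf_var 1 ^ 2) ^ N"
      by (simp only: power_mult_distrib mult.assoc mult.commute[of "pol ell ^ N"])
    then have "(pol mx * pol ell * pol ell) ^ N * (rf_var 1 ^ s * rf_var 1 ^ t) = pol p * pol ell ^ s * pol R' * (rf_var 1 ^ 2) ^ N"
      unfolding Psi_mx by (simp add: power_divide)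
    then have "pol ((mx * ell * ell) ^ N * (mvar 1 ^ s * mvar 1 ^ t)) = pol (p * (ell ^ s * R' * (mvar 1 ^ 2) ^ N))"
      by (simp add: ac_simps)
    then have "p dvd (mx * ell * ell) ^ N * (mvar 1 ^ s * mvar 1 ^ t)" by (simp only: pol_eq_iff dvd_triv_left)
    then show False using p px1 mx ell
      by (auto simp: prime_elem_dvd_mult_iff dest!: prime_elem_dvd_power[OF p])
  qed
  then obtain q where q: "prime_elem q" "q dvd p'" "\<not> q dvd mx * ell" by blast
  then have qn: "\<not> q dvd mx" "\<not> q dvd ell" by auto
  have qx1: "\<not> q dvd mvar 1" using qn x1 dvd_trans by blast
  have "sig q dvd P" if P: "ldvd p (Theta (pol P))" for P
  proof -
    obtain r U where U: "Psi (pol (sig P)) = pol U / rf_var 1 ^ r" "Psi (pol U) = pol (sig P) * X (k + 1) ^ r"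
      by (rule Psi_pol_form)
    have "pol U = Theta (pol P) * pol (mvar 1 ^ r)" using U(1) by (simp add: Theta_pol)
    then have "ldvd p (pol U)" using ldvd_mult[OF p P loc_pol[OF p, of "mvar 1 ^ r"]] by simp
    then obtain V where V: "U = p * V" using ldvd_pol_iff[OF p] by (auto simp: dvd_def)
    obtain t V' where V': "Psi (pol V) = pol V' / rf_var 1 ^ t" by (rule Psi_pol_form)
    have "pol (sig P) * (pol ell / rf_var 1) ^ r = pol p' / rf_var 1 ^ s * (pol V' / rf_var 1 ^ t)"
      using U(2) X_Suc_k p' V' by (simp add: V field_hom_simps[OF hom_Psi])
    then have "pol (sig P) * pol ell ^ r * (rf_var 1 ^ s * rf_var 1 ^ t) = pol p' * pol V' * rf_var 1 ^ r"
      by (simp add: power_divide frac_eq_eq)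
    then have "pol (sig P * ell ^ r * (mvar 1 ^ s * mvar 1 ^ t)) = pol (p' * (V' * mvar 1 ^ r))"
      by (simp add: ac_simps)
    then have "sig P * ell ^ r * (mvar 1 ^ s * mvar 1 ^ t) = p' * (V' * mvar 1 ^ r)"
      by (simp only: pol_eq_iff)
    then have "q dvd sig P * ell ^ r * (mvar 1 ^ s * mvar 1 ^ t)" using q(2) by (metis dvd_mult2)
    then have "q dvd sig P" using q(1) qn qx1
      by (auto simp: prime_elem_dvd_mult_iff dest!: prime_elem_dvd_power[OF q(1)])
    then show ?thesis using sig_dvd_iff[of q "sig P"] by simp
  qed
  moreover have "\<not> sig q dvd mx" using qn(1) sig_dvd_iff[of q mx] by (simp add: sig_mx)
  ultimately show ?thesis using sig_prime[OF q(1)] by blast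
qed

text \<open>Induction on n with p varying. A prime not dividing ell is transported back by one
  index; a prime associated to ell is replaced by \<open>sig ell\<close> while both indices drop by
  M. The distance j is preserved in either case.\<close>

theorem tau_coprime:
  assumes j: "1 \<le> j" "j \<le> 3 * k" and p: "prime_elem p" "\<not> p dvd mx"
  shows "\<not> (ldvd p (tau n) \<and> ldvd p (tau (n - j)))"
  using p
proof (induction n arbitrary: p rule: less_induct)
  case (less n)
  have one: "\<not> ldvd p (tau 0)" using lunit_not_ldvd[OF less.prems(1) lunit_1[OF less.prems(1)]] by simp
  have pol_of: "\<exists>P r. tau m * pol mx ^ r = pol P" for m using laurent_tau[of m] unfolding laurent_def .
  have descend: "ldvd q (tau m)" if "prime_elem q" "\<not> q dvd mx" "tau m * pol mx ^ r = pol P" "q dvd P" for q m r P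
  proof -
    have "ldvd q (tau m * pol mx ^ r)" unfolding that(3) using that by (simp only: ldvd_pol_iff)
    moreover have "lunit q (pol mx ^ r)" using that lunit_power[OF that(1)] lunit_pol_iff[OF that(1)] by blast
    ultimately show ?thesis by (rule ldvd_mult_lunit[OF that(1)])
  qed
  show ?case
  proof (cases "n \<le> j")
    case True
    then show ?thesis using one by simp
  next
    case False
    show ?thesis
    proof (cases "p dvd ell")
      case nell: False
      show ?thesis
      proof
        assume L: "ldvd p (tau n) \<and> ldvd p (tau (n - j))"
        obtain q where q: "prime_elem q" "\<not> q dvd mx" "\<And>P. ldvd p (Theta (pol P)) \<Longrightarrow> q dvd P"
          using transport_prime[OF less.prems nell] by blast
        have step: "ldvd q (tau m)" if m: "ldvd p (tau (Suc m))" for m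
        proof -
          obtain P r where P: "tau m * pol mx ^ r = pol P" using pol_of by blast
          have "\<not> p dvd mvar 1" using less.prems(2) mvar_dvd_mx[of 1] k3 dvd_trans by auto
          then have ux: "lunit p (rf_var 1 ^ e)" for e
            using lunit_power[OF less.prems(1)] lunit_pol_iff[OF less.prems(1), of "mvar 1"] by simp
          have "ldvd p (Theta (tau m) * rf_var 1 ^ c (int m))" using m by (simp add: tau_Suc mult.commute)
          then have "ldvd p (Theta (tau m))" using ldvd_mult_lunit[OF less.prems(1) _ ux] by blast
          moreover have "loc p (Theta (pol mx))"
          proof -
            have "Theta (pol mx) = pol (mx * ell) / rf_var 1 ^ 2" using Theta_mx by (simp add: eq_divide_eq)
            then show ?thesis
              using loc_divide[OF less.prems(1) loc_pol[OF less.prems(1), of "mx * ell"] ux[of 2]] by (simp only:)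
          qed
          ultimately have "ldvd p (Theta (tau m) * Theta (pol mx) ^ r)"
            by (intro ldvd_mult[OF less.prems(1)] loc_power[OF less.prems(1)])
          then have "ldvd p (Theta (pol P))" by (simp flip: P add: field_hom_simps[OF hom_Theta])
          then show ?thesis using descend[OF q(1,2) P] q(3) by blast
        qed
        have "n = Suc (n - 1)" "n - j = Suc (n - 1 - j)" using False by auto
        then have "ldvd q (tau (n - 1)) \<and> ldvd q (tau (n - 1 - j))" using step L by metis
        then show False using less.IH[of "n - 1" q] q(1,2) False by auto
      qed
    next
      case pell: True
      then obtain e where e: "ell = p * e" by (auto simp: dvd_def)
      have "\<not> ell dvd p \<Longrightarrow> False"
      proof -
        assume ne: "\<not> ell dvd p"
        have "ell dvd e" using prime_ell e ne by (metis dvd_refl prime_elem_dvd_mult_iff)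
        then obtain h where "e = ell * h" by (auto simp: dvd_def)
        then have "ell * 1 = ell * (p * h)" using e by (metis mult.left_commute mult_1_right)
        then have "1 = p * h" using ell_neq_0 by (metis mult_left_cancel)
        then show False using less.prems(1) by (metis dvd_triv_left prime_elem_def)
      qed
      then have iff: "ell dvd U \<longleftrightarrow> p dvd U" for U using pell dvd_trans by blast
      then have ld: "ldvd ell f \<longleftrightarrow> ldvd p f" for f by (simp add: ldvd_def)
      have unit: "\<not> ldvd ell (tau m)" if "m \<le> M + k" "m \<noteq> k + 1" for m
        using val_tau[of m] that val_0_iff[OF prime_ell] lunit_not_ldvd[OF prime_ell] by simp
      show ?thesis
      proof (cases "n - j \<le> M + k")
        case True
        then show ?thesis
        proof (cases "n - j = k + 1")
          case True
          \<comment> \<open>Here n = k + 1 + j \<le> 4 * k + 1 < M + k, so tau n is a unit along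
            ell; this is where the upper bound on j enters.\<close>
          then show ?thesis using unit[of n] j ld by (auto simp: M_def)
        qed (use unit[of "n - j"] ld in auto)
      next
        case big: False
        show ?thesis
        proof
          assume L: "ldvd p (tau n) \<and> ldvd p (tau (n - j))"
          have q: "prime_elem (sig ell)" "\<not> sig ell dvd mx"
            using sig_prime[OF prime_ell] ell_not_dvd_mx sig_dvd_iff[of ell mx] by (simp_all add: sig_mx)
          have step: "ldvd (sig ell) (tau (m - M))" if m: "ldvd ell (tau m)" "m > M + k" for m
          proof -
            obtain P r where P: "tau (m - M) * pol mx ^ r = pol P" using pol_of by blast
            obtain u where u: "lunit ell u" "tau m = u * (Theta ^^ M) (tau (m - M))" using tau_shift_M[OF m(2)] .
            then have "ldvd ell ((Theta ^^ M) (tau (m - M)))"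
              using m(1) ldvd_mult_lunit[OF prime_ell] by (simp add: mult.commute)
            then have "ldvd ell ((Theta ^^ M) (tau (m - M)) * (Theta ^^ M) (pol mx) ^ r)"
              by (intro ldvd_mult[OF prime_ell] lunit_imp_loc[OF prime_ell] lunit_power[OF prime_ell] Theta_pow_mx)
            then have "ldvd ell ((Theta ^^ M) (pol P))" by (simp flip: P add: field_hom_simps[OF hom_Theta_pow])
            then have "ell dvd sig P" by (rule ell_dvd_sig)
            then have "sig ell dvd P" using sig_dvd_iff[of ell "sig P"] by simp
            then show ?thesis using descend[OF q P] by blast
          qed
          have "ldvd (sig ell) (tau (n - M)) \<and> ldvd (sig ell) (tau (n - j - M))"
            using step[of n] step[of "n - j"] L ld big by auto
          then show False using less.IH[of "n - M" "sig ell"] q big M_ge by (simp add: add.commute)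
        qed
      qed
    qed
  qed
qed

end

section \<open>Values at a point\<close>

definition has_val :: "(nat \<Rightarrow> complex) \<Rightarrow> ratfun \<Rightarrow> complex \<Rightarrow> bool" where
  "has_val x f v \<longleftrightarrow> (\<exists>U V. f = pol U / pol V \<and> peval id x V \<noteq> 0 \<and> v = peval id x U / peval id x V)"

lemmas ceval_simps [simp] =
  peval_add[OF coeff_hom_id] peval_mult[OF coeff_hom_id] peval_const[OF coeff_hom_id]
  peval_var[OF coeff_hom_id] peval_1[OF coeff_hom_id] peval_power[OF coeff_hom_id]
  peval_uminus[OF coeff_hom_id] peval_diff[OF coeff_hom_id]

lemma has_val_pol: "has_val x (pol P) (peval id x P)"
  unfolding has_val_def by (intro exI[of _ P] exI[of _ 1]) simp

lemma has_val_var: "has_val x (rf_var i) (x i)"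
  using has_val_pol[of x "mvar i"] by simp

lemma has_val_const: "has_val x (rf_const b) b"
  using has_val_pol[of x "mconst b"] by simp

lemma has_val_1: "has_val x 1 1"
  using has_val_const[of x 1] by simp

lemma has_val_0: "has_val x 0 0"
  using has_val_const[of x 0] by simp

lemma has_val_add:
  assumes "has_val x f v" "has_val x g w" shows "has_val x (f + g) (v + w)"
proof -
  obtain U V U' V' where *: "f = pol U / pol V" "peval id x V \<noteq> 0" "v = peval id x U / peval id x V"
    "g = pol U' / pol V'" "peval id x V' \<noteq> 0" "w = peval id x U' / peval id x V'"
    using assms unfolding has_val_def by blast
  then have "V \<noteq> 0" "V' \<noteq> 0" by auto
  then have "f + g = pol (U * V' + U' * V) / pol (V * V')"
    "v + w = peval id x (U * V' + U' * V) / peval id x (V * V')" "peval id x (V * V') \<noteq> 0"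
    using * by (simp_all add: add_frac_eq)
  then show ?thesis unfolding has_val_def by blast
qed

lemma has_val_mult:
  assumes "has_val x f v" "has_val x g w" shows "has_val x (f * g) (v * w)"
proof -
  obtain U V U' V' where *: "f = pol U / pol V" "peval id x V \<noteq> 0" "v = peval id x U / peval id x V"
    "g = pol U' / pol V'" "peval id x V' \<noteq> 0" "w = peval id x U' / peval id x V'"
    using assms unfolding has_val_def by blast
  then have "f * g = pol (U * U') / pol (V * V')"
    "v * w = peval id x (U * U') / peval id x (V * V')" "peval id x (V * V') \<noteq> 0" by simp_all
  then show ?thesis unfolding has_val_def by blast
qed

lemma has_val_inverse:
  assumes "has_val x f v" "v \<noteq> 0" shows "has_val x (1 / f) (1 / v)"
proof -
  obtain U V where *: "f = pol U / pol V" "peval id x V \<noteq> 0" "v = peval id x U / peval id x V"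
    using assms unfolding has_val_def by blast
  then have "1 / f = pol V / pol U" "1 / v = peval id x V / peval id x U" "peval id x U \<noteq> 0"
    using assms(2) by auto
  then show ?thesis unfolding has_val_def by blast
qed

lemma has_val_divide:
  assumes "has_val x f v" "has_val x g w" "w \<noteq> 0" shows "has_val x (f / g) (v / w)"
  using has_val_mult[OF assms(1) has_val_inverse[OF assms(2,3)]] by simp

lemma has_val_uminus: "has_val x f v \<Longrightarrow> has_val x (- f) (- v)"
  using has_val_mult[OF has_val_const[of x "- 1"], of f v] by (simp flip: pol_mconst add: mconst_def single_uminus)

lemma has_val_diff: "has_val x f v \<Longrightarrow> has_val x g w \<Longrightarrow> has_val x (f - g) (v - w)"
  using has_val_add[OF _ has_val_uminus, of x f v g w] by simp

lemma has_val_power: "has_val x f v \<Longrightarrow> has_val x (f ^ n) (v ^ n)"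
  by (induction n) (auto intro: has_val_1 has_val_mult)

lemma has_val_sum: "(\<And>i. i \<in> S \<Longrightarrow> has_val x (f i) (v i)) \<Longrightarrow> has_val x (sum f S) (\<Sum>i\<in>S. v i)"
  by (induction S rule: infinite_finite_induct) (auto intro: has_val_0 has_val_add)

lemma has_val_prod: "(\<And>i. i \<in> S \<Longrightarrow> has_val x (f i) (v i)) \<Longrightarrow> has_val x (prod f S) (\<Prod>i\<in>S. v i)"
  by (induction S rule: infinite_finite_induct) (auto intro: has_val_1 has_val_mult)

lemma has_val_unique:
  assumes "has_val x f v" "has_val x f w" shows "v = w"
proof -
  obtain U V U' V' where *: "f = pol U / pol V" "peval id x V \<noteq> 0" "v = peval id x U / peval id x V"
    "f = pol U' / pol V'" "peval id x V' \<noteq> 0" "w = peval id x U' / peval id x V'"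
    using assms unfolding has_val_def by blast
  then have "V \<noteq> 0" "V' \<noteq> 0" by auto
  then have "pol (U * V') = pol (U' * V)" using *(1,4) by (simp add: frac_eq_eq)
  then have "U * V' = U' * V" by (simp only: pol_eq_iff)
  then have "peval id x U * peval id x V' = peval id x U' * peval id x V"
    by (metis ceval_simps(2))
  then show ?thesis using * by (simp add: frac_eq_eq)
qed

lemma has_val_solve:
  assumes "g * f = h" "has_val x g w" "has_val x h v" "w \<noteq> 0" "v = w * u"
  shows "has_val x f u"
proof -
  have "g \<noteq> 0" using assms(2,4) has_val_unique[OF _ has_val_0] by blast
  then have "f = h / g" using assms(1) by (simp add: eq_divide_eq mult.commute)
  moreover have "u = v / w" using assms(4,5) by simp
  ultimately show ?thesis using has_val_divide assms by metis
qed

text \<open>Numerator and denominator are nonzero at a zero of p, so p divides neither: one point of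
  the divisor decides that the valuation is 0.\<close>

lemma has_val_lunit:
  assumes "has_val x f v" "v \<noteq> 0" "peval id x p = 0"
  shows "lunit p f"
proof -
  obtain U V where *: "f = pol U / pol V" "peval id x V \<noteq> 0" "v = peval id x U / peval id x V"
    using assms unfolding has_val_def by blast
  then have "peval id x U \<noteq> 0" using assms(2) by auto
  then have "\<not> p dvd U" "\<not> p dvd V" using * assms(3) by (auto simp: dvd_def)
  then show ?thesis using * unfolding lunit_def by blast
qed

section \<open>The singularity pattern\<close>

text \<open>A point on the divisor of ell, chosen so that X (k + 3), ..., X (2 k) and X (2 k + 3), ..., X (3 k)
  take a common value d there; e_rel and x_1 express these two requirements. The poles
  X (2 k + 1) and X (2 k + 2) have residues S and - S relative to X (k + 1).\<close>

locale lyness_point = lyness +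
  fixes d S :: complex and e :: "nat \<Rightarrow> complex" and x :: "nat \<Rightarrow> complex"
  assumes d: "d \<noteq> 0" and S: "S = a - 1 + of_nat (k - 2) * d" "S \<noteq> 0"
    and e_rel: "\<And>i. i \<le> k - 2 \<Longrightarrow> d * e (i + 1) = a - 1 + (of_nat k - 3 - of_nat i) * d + (\<Sum>l\<in>{1..i}. e l)"
    and x_e: "\<And>i. 3 \<le> i \<Longrightarrow> i \<le> k \<Longrightarrow> x i = e (k + 1 - i)"
    and x_2: "x 2 = - (1 + d + d * e (k - 1))"
    and x_1: "1 + x 1 = - d * (1 + d) * x 2 / S"
    and x_nz: "\<And>i. 1 \<le> i \<Longrightarrow> i \<le> k \<Longrightarrow> x i \<noteq> 0"
begin

text \<open>The case i = k - 2 of \<open>e_rel\<close>; the value of x 2 is chosen so that this puts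
  the point on ell = 0.\<close>

lemma sum_x: "a + (\<Sum>i\<in>{3..k}. x i) = - x 2"
proof -
  have "(\<Sum>i\<in>{3..k}. x i) = (\<Sum>l\<in>{1..k - 2}. e l)"
    by (rule sum.reindex_bij_witness[of _ "\<lambda>l. k + 1 - l" "\<lambda>i. k + 1 - i"]) (use k3 in \<open>auto simp: x_e\<close>)
  moreover have "k - 2 + 1 = k - 1" "(of_nat (k - 2) :: complex) = of_nat k - 2" using k3 by (auto simp: of_nat_diff)
  ultimately show ?thesis using e_rel[of "k - 2"] by (simp add: x_2 algebra_simps)
qed

lemma ell_x: "peval id x ell = 0"
proof -
  have "{2..k} = insert 2 {3..k}" using k3 by auto
  then have "peval id x ell = x 2 + (a + (\<Sum>i\<in>{3..k}. x i))"
    by (simp add: ell_def peval_sum[OF coeff_hom_id])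
  then show ?thesis unfolding sum_x by simp
qed

text \<open>Local parameter along ell: it is ell / x 1, and x 1 is nonzero at the point. Zeros and
  poles are tested by dividing or multiplying by it.\<close>

definition eps :: ratfun where "eps = X (k + 1)"

lemma v_init: "i \<le> k \<Longrightarrow> has_val x (X i) (x i)"
  using has_val_var[of x i] by (simp add: X_var)

lemma v_eps: "has_val x eps 0"
proof -
  have "has_val x (pol ell / rf_var 1) (0 / x 1)"
    using has_val_pol[of x ell] ell_x x_nz[of 1] k3 by (intro has_val_divide has_val_var) auto
  then show ?thesis by (simp only: eps_def X_Suc_k div_0)
qed

lemma eps_nz: "eps \<noteq> 0" by (simp add: eps_def)

lemma X_mult': "n \<ge> 1 \<Longrightarrow> m = n + k \<Longrightarrow> l = n + 1 \<Longrightarrow> X n * X m = rf_const a + (\<Sum>j\<in>{l..<m}. X j)"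
  using X_mult by blast

lemma X_shift': "n \<ge> 1 \<Longrightarrow> p = n + k + 1 \<Longrightarrow> q = n + 1 \<Longrightarrow> r = n + k \<Longrightarrow> (1 + X p) * X q = X r * (1 + X n)"
  using X_shift by blast

text \<open>The first-order deviation of X (k + 2) from its value - 1 on the divisor; it meets the
  pole of X (2 * k + 2) in the computation of X (2 * k + 3).\<close>

lemma v_u: "has_val x ((1 + X (k + 2)) / eps) ((1 + x 1) / x 2)"
proof -
  have "(1 + X (k + 2)) * X 2 = eps * (1 + X 1)"
    unfolding eps_def by (rule X_shift') auto
  then have "(1 + X (k + 2)) / eps = (1 + X 1) / X 2" using eps_nz by (simp add: frac_eq_eq mult.commute)
  then show ?thesis
    using has_val_divide[OF has_val_add[OF has_val_1 v_init[of 1]] v_init[of 2]] x_nz[of 2] k3 by simp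
qed

lemma v_k2: "has_val x (X (k + 2)) (- 1)"
proof -
  have "has_val x ((1 + X (k + 2)) / eps * eps - 1) ((1 + x 1) / x 2 * 0 - 1)"
    by (intro has_val_diff has_val_mult v_u v_eps has_val_1)
  then show ?thesis using eps_nz by simp
qed

text \<open>\<open>e_rel\<close> at index k - j - 1 is the recurrence for X (k + 1 + j) with the
  value d inserted; the values 0 and - 1 of X (k + 1) and X (k + 2) turn a into a - 1.\<close>

lemma v_C: "2 \<le> j \<Longrightarrow> j \<le> k - 1 \<Longrightarrow> has_val x (X (k + 1 + j)) d"
proof (induction j rule: less_induct)
  case (less j)
  let ?v = "\<lambda>i. if i \<le> k then x i else if i = k + 1 then 0 else if i = k + 2 then - 1 else d"
  show ?case
  proof (rule has_val_solve)
    show "X (j + 1) * X (k + 1 + j) = rf_const a + (\<Sum>i\<in>{j + 2..<k + 1 + j}. X i)"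
      by (rule X_mult') auto
    show "has_val x (X (j + 1)) (x (j + 1))" "x (j + 1) \<noteq> 0"
      using v_init[of "j + 1"] x_nz[of "j + 1"] less.prems by auto
    show "has_val x (rf_const a + (\<Sum>i\<in>{j + 2..<k + 1 + j}. X i)) (a + (\<Sum>i\<in>{j + 2..<k + 1 + j}. ?v i))"
    proof (intro has_val_add has_val_const has_val_sum)
      fix i assume i: "i \<in> {j + 2..<k + 1 + j}"
      consider "i \<le> k" | "i = k + 1" | "i = k + 2" | "i > k + 2" by linarith
      then show "has_val x (X i) (?v i)"
      proof cases
        case 4
        then have eq: "k + 1 + (i - (k + 1)) = i" by simp
        show ?thesis using less.IH[of "i - (k + 1)", unfolded eq] i 4 less.prems by auto
      qed (use v_init v_eps v_k2 in \<open>auto simp: eps_def\<close>)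
    qed
    have "{j + 2..<k + 1 + j} = {j + 2..k} \<union> ({k + 1, k + 2} \<union> {k + 3..<k + 1 + j})"
      using less.prems k3 by auto
    then have "(\<Sum>i\<in>{j + 2..<k + 1 + j}. ?v i) = (\<Sum>i\<in>{j + 2..k}. ?v i) + (\<Sum>i\<in>{k + 1, k + 2} \<union> {k + 3..<k + 1 + j}. ?v i)"
      by (simp only:) (rule sum.union_disjoint, auto)
    also have "(\<Sum>i\<in>{k + 1, k + 2} \<union> {k + 3..<k + 1 + j}. ?v i) = (\<Sum>i\<in>{k + 1, k + 2}. ?v i) + (\<Sum>i\<in>{k + 3..<k + 1 + j}. ?v i)"
      by (rule sum.union_disjoint) auto
    also have "(\<Sum>i\<in>{k + 1, k + 2}. ?v i) = - 1" by simp
    also have "(\<Sum>i\<in>{k + 3..<k + 1 + j}. ?v i) = (\<Sum>i\<in>{k + 3..<k + 1 + j}. d)"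
      by (intro sum.cong) auto
    also have "\<dots> = of_nat (j - 2) * d"
    proof -
      have "k + 1 + j - (k + 3) = j - 2" by simp
      then show ?thesis by simp
    qed
    also have "(\<Sum>i\<in>{j + 2..k}. ?v i) = (\<Sum>l\<in>{1..k - j - 1}. e l)"
      by (rule sum.reindex_bij_witness[of _ "\<lambda>l. k + 1 - l" "\<lambda>i. k + 1 - i"]) (use less.prems in \<open>auto simp: x_e\<close>)
    finally have s: "(\<Sum>i\<in>{j + 2..<k + 1 + j}. ?v i) = (\<Sum>l\<in>{1..k - j - 1}. e l) + (- 1 + of_nat (j - 2) * d)" .
    have "k + 1 - (j + 1) = k - j - 1 + 1" using less.prems by auto
    then have "x (j + 1) = e (k - j - 1 + 1)" using x_e[of "j + 1"] less.prems by auto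
    moreover have "of_nat k - 3 - of_nat (k - j - 1) = (of_nat (j - 2) :: complex)"
      using less.prems by (simp add: of_nat_diff)
    ultimately show "a + (\<Sum>i\<in>{j + 2..<k + 1 + j}. ?v i) = x (j + 1) * d"
      using e_rel[of "k - j - 1"] less.prems unfolding s by (simp add: mult.commute)
  qed
qed

lemma v_C': "k + 3 \<le> i \<Longrightarrow> i \<le> 2 * k \<Longrightarrow> has_val x (X i) d"
proof -
  assume i: "k + 3 \<le> i" "i \<le> 2 * k"
  then have eq: "k + 1 + (i - (k + 1)) = i" by simp
  show ?thesis using v_C[of "i - (k + 1)", unfolded eq] i k3 by simp
qed

lemma v_S: "has_val x (eps * X (2 * k + 1)) S"
proof -
  have "eps * X (2 * k + 1) = rf_const a + (\<Sum>i\<in>{k + 2..<2 * k + 1}. X i)"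
    unfolding eps_def by (rule X_mult') auto
  also have "{k + 2..<2 * k + 1} = insert (k + 2) {k + 3..<2 * k + 1}" using k3 by auto
  finally have eq: "eps * X (2 * k + 1) = rf_const a + (X (k + 2) + (\<Sum>i\<in>{k + 3..<2 * k + 1}. X i))" by simp
  have "has_val x (rf_const a + (X (k + 2) + (\<Sum>i\<in>{k + 3..<2 * k + 1}. X i))) (a + (- 1 + (\<Sum>i\<in>{k + 3..<2 * k + 1}. d)))"
  proof (intro has_val_add has_val_const has_val_sum v_k2)
    fix i assume i: "i \<in> {k + 3..<2 * k + 1}"
    then show "has_val x (X i) d" using v_C'[of i] by auto
  qed
  moreover have "a + (- 1 + (\<Sum>i\<in>{k + 3..<2 * k + 1}. d)) = S"
  proof -
    have "2 * k + 1 - (k + 3) = k - 2" by simp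
    then show ?thesis by (simp add: S)
  qed
  ultimately show ?thesis using eq by simp
qed

lemma v_S': "has_val x (eps * X (2 * k + 2)) (- S)"
proof -
  have "(1 + X (2 * k + 2)) * X (k + 2) = X (2 * k + 1) * (1 + X (k + 1))"
    by (rule X_shift') auto
  then have "eps * ((1 + X (2 * k + 2)) * X (k + 2)) = eps * (X (2 * k + 1) * (1 + eps))"
    by (simp only: eps_def)
  then have "X (k + 2) * (eps * X (2 * k + 2)) = eps * X (2 * k + 1) * (1 + eps) - eps * X (k + 2)"
    by (simp only: algebra_simps mult_1_left mult_1_right)
  then show ?thesis
  proof (rule has_val_solve)
    show "has_val x (eps * X (2 * k + 1) * (1 + eps) - eps * X (k + 2)) (S * (1 + 0) - 0 * - 1)"
      by (intro has_val_diff has_val_mult has_val_add v_S v_eps has_val_1 v_k2)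
  qed (use v_k2 in auto)
qed

lemma v_D: "2 \<le> j \<Longrightarrow> j \<le> k - 1 \<Longrightarrow> has_val x (X (2 * k + 1 + j)) d"
proof (induction j rule: dec_induct)
  case base
  have k: "k + 3 = k + 1 + 2" "2 * k + 3 = 2 * k + 1 + 2" by simp_all
  have "(1 + X (2 * k + 3)) * X (k + 3) = X (2 * k + 2) * (1 + X (k + 2))"
    by (rule X_shift') auto
  then have "X (k + 3) * (1 + X (2 * k + 3)) = eps * X (2 * k + 2) * ((1 + X (k + 2)) / eps)"
    using eps_nz by (simp add: mult.commute)
  then have "has_val x (1 + X (2 * k + 3)) (1 + d)"
  proof (rule has_val_solve)
    show "has_val x (X (k + 3)) d" using v_C'[of "k + 3"] k3 by auto
    show "has_val x (eps * X (2 * k + 2) * ((1 + X (k + 2)) / eps)) (- S * ((1 + x 1) / x 2))"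
      by (intro has_val_mult v_S' v_u)
    \<comment> \<open>The prescribed value of x 1 enters here: residue times first-order deviation
      has to give d * (1 + d).\<close>
    show "- S * ((1 + x 1) / x 2) = d * (1 + d)" unfolding x_1 using S(2) x_nz[of 2] k3 by simp
  qed (rule d)
  then have "has_val x (1 + X (2 * k + 3) - 1) (1 + d - 1)" by (intro has_val_diff has_val_1)
  then show ?case unfolding k by simp
next
  case (step j)
  have "(1 + X (2 * k + 2 + j)) * X (k + 2 + j) = X (2 * k + 1 + j) * (1 + X (k + 1 + j))"
    by (rule X_shift') auto
  then have "X (k + 2 + j) * (1 + X (2 * k + 2 + j)) = X (2 * k + 1 + j) * (1 + X (k + 1 + j))"
    by (simp add: mult.commute)
  then have "has_val x (1 + X (2 * k + 2 + j)) (1 + d)"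
  proof (rule has_val_solve)
    show "has_val x (X (k + 2 + j)) d" using v_C'[of "k + 2 + j"] step by auto
    show "has_val x (X (2 * k + 1 + j) * (1 + X (k + 1 + j))) (d * (1 + d))"
      using step v_C'[of "k + 1 + j"] by (intro has_val_mult has_val_add has_val_1) auto
  qed (use d in auto)
  then have "has_val x (1 + X (2 * k + 2 + j) - 1) (1 + d - 1)" by (intro has_val_diff has_val_1)
  moreover have "2 * k + 2 + j = 2 * k + 1 + Suc j" by simp
  ultimately show ?case by (simp only: add_diff_cancel_left')
qed

lemma v_D': "2 * k + 3 \<le> i \<Longrightarrow> i \<le> 3 * k \<Longrightarrow> has_val x (X i) d"
proof -
  assume i: "2 * k + 3 \<le> i" "i \<le> 3 * k"
  then have eq: "2 * k + 1 + (i - (2 * k + 1)) = i" by simp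
  show ?thesis using v_D[of "i - (2 * k + 1)", unfolded eq] i k3 by simp
qed

lemma v_v: "has_val x ((1 + X (3 * k + 1)) / eps) (d * (1 + d) / S)"
proof -
  have "(1 + X (3 * k + 1)) * X (2 * k + 1) = X (3 * k) * (1 + X (2 * k))"
    by (rule X_shift') (use k3 in auto)
  then have "eps * X (2 * k + 1) * ((1 + X (3 * k + 1)) / eps) = X (3 * k) * (1 + X (2 * k))"
    using eps_nz by (simp add: mult.commute)
  then show ?thesis
  proof (rule has_val_solve)
    show "has_val x (X (3 * k) * (1 + X (2 * k))) (d * (1 + d))"
      by (intro has_val_mult has_val_add has_val_1 v_C' v_D') (use k3 in auto)
  qed (use S(2) v_S in auto)
qed

lemma v_3k1: "has_val x (X (3 * k + 1)) (- 1)"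
proof -
  have "has_val x ((1 + X (3 * k + 1)) / eps * eps - 1) (d * (1 + d) / S * 0 - 1)"
    by (intro has_val_diff has_val_mult v_v v_eps has_val_1)
  then show ?thesis using eps_nz by simp
qed

lemma v_M: "has_val x (X (3 * k + 2) / eps) (- 1)"
proof -
  have "X (2 * k + 2) * X (3 * k + 2) = rf_const a + (\<Sum>i\<in>{2 * k + 3..<3 * k + 2}. X i)"
    by (rule X_mult') auto
  also have "{2 * k + 3..<3 * k + 2} = insert (3 * k + 1) {2 * k + 3..<3 * k + 1}" using k3 by auto
  finally have "eps * X (2 * k + 2) * (X (3 * k + 2) / eps) = rf_const a + (X (3 * k + 1) + (\<Sum>i\<in>{2 * k + 3..<3 * k + 1}. X i))"
    using eps_nz by simp
  then show ?thesis
  proof (rule has_val_solve)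
    show "has_val x (rf_const a + (X (3 * k + 1) + (\<Sum>i\<in>{2 * k + 3..<3 * k + 1}. X i))) (a + (- 1 + (\<Sum>i\<in>{2 * k + 3..<3 * k + 1}. d)))"
    proof (intro has_val_add has_val_const has_val_sum v_3k1)
      fix i assume i: "i \<in> {2 * k + 3..<3 * k + 1}"
      then show "has_val x (X i) d" using v_D'[of i] by auto
    qed
    have "3 * k + 1 - (2 * k + 3) = k - 2" by simp
    then show "a + (- 1 + (\<Sum>i\<in>{2 * k + 3..<3 * k + 1}. d)) = - S * - 1" by (simp add: S)
  qed (use v_S' S(2) in auto)
qed

lemma v_M0: "has_val x (X (3 * k + 2)) 0"
proof -
  have "has_val x (X (3 * k + 2) / eps * eps) (- 1 * 0)" by (intro has_val_mult v_M v_eps)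
  then show ?thesis using eps_nz by simp
qed

text \<open>The window behind the singularity takes the initial values in reverse order, x (k + 1 -
  i) at the index M + i; for i \<le> k - 2 these are the e i.\<close>

lemma v_F: "1 \<le> i \<Longrightarrow> i \<le> k - 2 \<Longrightarrow> has_val x (X (3 * k + 2 + i)) (e i)"
proof (induction i rule: less_induct)
  case (less i)
  show ?case
  proof (rule has_val_solve)
    show "X (2 * k + 2 + i) * X (3 * k + 2 + i) = rf_const a + (\<Sum>j\<in>{2 * k + 3 + i..<3 * k + 2 + i}. X j)"
      by (rule X_mult') auto
    show "has_val x (X (2 * k + 2 + i)) d" using v_D'[of "2 * k + 2 + i"] less.prems by auto
    show "d \<noteq> 0" by (rule d)
    let ?v = "\<lambda>j. if j \<le> 3 * k then d else if j = 3 * k + 1 then - 1 else if j = 3 * k + 2 then 0 else e (j - (3 * k + 2))"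
    show "has_val x (rf_const a + (\<Sum>j\<in>{2 * k + 3 + i..<3 * k + 2 + i}. X j)) (a + (\<Sum>j\<in>{2 * k + 3 + i..<3 * k + 2 + i}. ?v j))"
    proof (intro has_val_add has_val_const has_val_sum)
      fix j assume j: "j \<in> {2 * k + 3 + i..<3 * k + 2 + i}"
      consider "j \<le> 3 * k" | "j = 3 * k + 1" | "j = 3 * k + 2" | "j > 3 * k + 2" by linarith
      then show "has_val x (X j) (?v j)"
      proof cases
        case 1
        then show ?thesis using v_D'[of j] j by auto
      next
        case 4
        then have eq: "3 * k + 2 + (j - (3 * k + 2)) = j" by auto
        show ?thesis using less.IH[of "j - (3 * k + 2)", unfolded eq] 4 j less.prems by auto
      qed (use v_3k1 v_M0 in auto)
    qed
    have "{2 * k + 3 + i..<3 * k + 2 + i} = {2 * k + 3 + i..3 * k} \<union> ({3 * k + 1, 3 * k + 2} \<union> {3 * k + 3..<3 * k + 2 + i})"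
      using less.prems k3 by auto
    then have "(\<Sum>j\<in>{2 * k + 3 + i..<3 * k + 2 + i}. ?v j) = (\<Sum>j\<in>{2 * k + 3 + i..3 * k}. ?v j) + (\<Sum>j\<in>{3 * k + 1, 3 * k + 2} \<union> {3 * k + 3..<3 * k + 2 + i}. ?v j)"
      by (simp only:) (rule sum.union_disjoint, auto)
    also have "(\<Sum>j\<in>{3 * k + 1, 3 * k + 2} \<union> {3 * k + 3..<3 * k + 2 + i}. ?v j) = (\<Sum>j\<in>{3 * k + 1, 3 * k + 2}. ?v j) + (\<Sum>j\<in>{3 * k + 3..<3 * k + 2 + i}. ?v j)"
      by (rule sum.union_disjoint) auto
    also have "(\<Sum>j\<in>{3 * k + 1, 3 * k + 2}. ?v j) = - 1" by simp
    also have "(\<Sum>j\<in>{2 * k + 3 + i..3 * k}. ?v j) = (\<Sum>j\<in>{2 * k + 3 + i..3 * k}. d)"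
      by (intro sum.cong) auto
    also have "\<dots> = of_nat (k - 2 - i) * d"
    proof -
      have "Suc (3 * k) - (2 * k + 3 + i) = k - 2 - i" by simp
      then show ?thesis by simp
    qed
    also have "(\<Sum>j\<in>{3 * k + 3..<3 * k + 2 + i}. ?v j) = (\<Sum>l\<in>{1..i - 1}. e l)"
      by (rule sum.reindex_bij_witness[of _ "\<lambda>l. 3 * k + 2 + l" "\<lambda>j. j - (3 * k + 2)"]) auto
    finally have s: "(\<Sum>j\<in>{2 * k + 3 + i..<3 * k + 2 + i}. ?v j) = of_nat (k - 2 - i) * d + (- 1 + (\<Sum>l\<in>{1..i - 1}. e l))" .
    have "of_nat k - 3 - of_nat (i - 1) = (of_nat (k - 2 - i) :: complex)" "i - 1 + 1 = i"
      using less.prems by (simp_all add: of_nat_diff)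
    then show "a + (\<Sum>j\<in>{2 * k + 3 + i..<3 * k + 2 + i}. ?v j) = d * e i"
      using e_rel[of "i - 1"] less.prems unfolding s by simp
  qed
qed

lemma v_F2: "3 * k + 3 \<le> i \<Longrightarrow> i \<le> 4 * k \<Longrightarrow> has_val x (X i) (e (i - (3 * k + 2)))"
proof -
  assume i: "3 * k + 3 \<le> i" "i \<le> 4 * k"
  then have eq: "3 * k + 2 + (i - (3 * k + 2)) = i" by simp
  show ?thesis using v_F[of "i - (3 * k + 2)", unfolded eq] i k3 by simp
qed

lemma v_F': "has_val x (X (4 * k + 1)) (x 2)"
proof (rule has_val_solve)
  show "X (3 * k + 1) * X (4 * k + 1) = rf_const a + (\<Sum>j\<in>{3 * k + 2..<4 * k + 1}. X j)"
    by (rule X_mult') auto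
  show "has_val x (rf_const a + (\<Sum>j\<in>{3 * k + 2..<4 * k + 1}. X j)) (a + (\<Sum>j\<in>{3 * k + 2..<4 * k + 1}. if j = 3 * k + 2 then 0 else e (j - (3 * k + 2))))"
  proof (intro has_val_add has_val_const has_val_sum)
    fix j assume j: "j \<in> {3 * k + 2..<4 * k + 1}"
    then show "has_val x (X j) (if j = 3 * k + 2 then 0 else e (j - (3 * k + 2)))"
      using v_F2[of j] v_M0 by (cases "j = 3 * k + 2") auto
  qed
  have "{3 * k + 2..<4 * k + 1} = insert (3 * k + 2) {3 * k + 3..<4 * k + 1}" using k3 by auto
  then have "(\<Sum>j\<in>{3 * k + 2..<4 * k + 1}. if j = 3 * k + 2 then 0 else e (j - (3 * k + 2))) = (\<Sum>j\<in>{3 * k + 3..<4 * k + 1}. e (j - (3 * k + 2)))"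
    by simp
  also have "\<dots> = (\<Sum>i\<in>{3..k}. x i)"
    by (rule sum.reindex_bij_witness[of _ "\<lambda>i. 4 * k + 3 - i" "\<lambda>j. 4 * k + 3 - j"]) (auto simp: x_e)
  finally show "a + (\<Sum>j\<in>{3 * k + 2..<4 * k + 1}. if j = 3 * k + 2 then 0 else e (j - (3 * k + 2))) = - 1 * x 2"
    using sum_x by simp
qed (use v_3k1 in auto)

lemma v_F'': "has_val x (X (4 * k + 2)) (x 1)"
proof -
  have "(1 + X (4 * k + 2)) * X (3 * k + 2) = X (4 * k + 1) * (1 + X (3 * k + 1))"
    by (rule X_shift') auto
  then have "X (3 * k + 2) / eps * (1 + X (4 * k + 2)) = X (4 * k + 1) * ((1 + X (3 * k + 1)) / eps)"
    using eps_nz by (simp add: mult.commute)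
  then have "has_val x (1 + X (4 * k + 2)) (1 + x 1)"
  proof (rule has_val_solve)
    show "has_val x (X (4 * k + 1) * ((1 + X (3 * k + 1)) / eps)) (x 2 * (d * (1 + d) / S))"
      by (intro has_val_mult v_F' v_v)
    show "x 2 * (d * (1 + d) / S) = - 1 * (1 + x 1)" unfolding x_1 by simp
  qed (use v_M in auto)
  then have "has_val x (1 + X (4 * k + 2) - 1) (1 + x 1 - 1)" by (intro has_val_diff has_val_1)
  then show ?thesis by simp
qed

lemma pattern_at_point:
  assumes "1 \<le> i" "i \<le> M + k"
  shows "val ell (X i) (patw i)"
proof -
  have unit: "val ell (X j) 0" if "has_val x (X j) v" "v \<noteq> 0" for j v
    using has_val_lunit[OF that ell_x] val_0_iff by simp
  have e_nz: "e j \<noteq> 0" if "1 \<le> j" "j \<le> k - 2" for j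
    using x_nz[of "k + 1 - j"] x_e[of "k + 1 - j"] that by auto
  have x1: "lunit ell (rf_var 1)" using has_val_lunit[OF has_val_var x_nz ell_x, of 1] k3 by simp
  have plus: "val ell (X j) 1" if "has_val x (X j / eps) v" "v \<noteq> 0" for j v
  proof -
    have "X j = X j / eps / rf_var 1 * pol ell powi 1"
      using eps_nz ell_neq_0 unfolding eps_def X_Suc_k by simp
    moreover have "lunit ell (X j / eps / rf_var 1)"
      using has_val_lunit[OF that ell_x] by (rule lunit_divide[OF prime_ell _ x1])
    ultimately show ?thesis unfolding val_def by blast
  qed
  have minus: "val ell (X j) (- 1)" if "has_val x (eps * X j) v" "v \<noteq> 0" for j v
  proof -
    have "X j = eps * X j * rf_var 1 * pol ell powi (- 1)"
      using eps_nz ell_neq_0 unfolding eps_def X_Suc_k by (simp add: power_int_minus)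
    moreover have "lunit ell (eps * X j * rf_var 1)"
      using has_val_lunit[OF that ell_x] by (rule lunit_mult[OF prime_ell _ x1])
    ultimately show ?thesis unfolding val_def by blast
  qed
  consider (a) "i \<le> k" | (b) "i = k + 1" | (c) "i = k + 2" | (d) "k + 3 \<le> i" "i \<le> 2 * k"
    | (e) "i = 2 * k + 1" | (f) "i = 2 * k + 2" | (g) "2 * k + 3 \<le> i" "i \<le> 3 * k" | (h) "i = 3 * k + 1"
    | (i) "i = 3 * k + 2" | (j) "3 * k + 3 \<le> i" "i \<le> 4 * k" | (k) "i = 4 * k + 1" | (l) "i = 4 * k + 2"
    using assms unfolding M_def by linarith
  then show ?thesis
  proof cases
    case a
    then show ?thesis using unit[OF v_init x_nz] assms by (simp add: patw_def)
  next
    case b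
    have "has_val x (X (k + 1) / eps) 1" using has_val_1 eps_nz by (simp add: eps_def)
    then show ?thesis using plus b by (simp add: patw_def)
  next
    case c
    then show ?thesis using unit[OF v_k2] k3 by (simp add: patw_def)
  next
    case d
    then show ?thesis using unit[OF v_C'[of i]] lyness_point.d[OF lyness_point_axioms] d by (simp add: patw_def)
  next
    case e
    then show ?thesis using minus[OF v_S S(2)] k3 by (simp add: patw_def)
  next
    case f
    then show ?thesis using minus[OF v_S'] S(2) k3 by (simp add: patw_def)
  next
    case g
    then show ?thesis using unit[OF v_D'[of i]] lyness_point.d[OF lyness_point_axioms] g by (simp add: patw_def)
  next
    case h
    then show ?thesis using unit[OF v_3k1] k3 by (simp add: patw_def)
  next
    case i
    then show ?thesis using plus[OF v_M] k3 by (simp add: patw_def)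
  next
    case j
    then show ?thesis using unit[OF v_F2[of i] e_nz] by (simp add: patw_def)
  next
    case k
    then show ?thesis using unit[OF v_F' x_nz] k3 by (simp add: patw_def)
  next
    case l
    then show ?thesis using unit[OF v_F'' x_nz] k3 by (simp add: patw_def)
  qed
qed

end

lemma eventually_nonzero_at_0:
  fixes g :: "complex \<Rightarrow> complex"
  assumes "isCont g 0" "g 0 \<noteq> 0"
  shows "\<forall>\<^sub>F z in at 0. g z \<noteq> 0"
  using tendsto_imp_eventually_ne[of g "g 0" "at 0" 0] assms by (simp add: isCont_def)

text \<open>Differences of \<open>e_rel\<close> give d * e (i + 2) = (d + 1) * e (i + 1) - d, solved
  by e i = d + (1 + 1 / d)^(i - 1) * w. The conditions left are inequalities; after clearing powers
  of d they are polynomial in d, and each of them holds for all small d \<noteq> 0.\<close>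

lemma (in lyness) singular_orbit_values:
  assumes cond: "k > 3 \<or> a \<noteq> 1"
  shows "\<exists>d S e x. lyness_point k a d S e x"
proof -
  \<comment> \<open>The order of the pole of w at d = 0. Then W d = w * d ^ m is regular, and W 0 is
    a - 1 if a \<noteq> 1 and k - 3 if a = 1; the hypothesis makes it nonzero.\<close>
  define m :: nat where "m = (if a = 1 then 0 else 1)"
  define \<kappa> :: complex where "\<kappa> = of_nat k - 3"
  define W where "W = (\<lambda>d. if a = 1 then \<kappa> - d else a - 1 + \<kappa> * d - d\<^sup>2)"
  define V where "V = (\<lambda>d. if a = 1 then of_nat k - 2 else a - 1 + (of_nat k - 2) * d)"
  have km: "k - 3 + m \<ge> 1" using cond k3 by (auto simp: m_def)
  have "\<kappa> \<noteq> 0" if "k > 3" using that of_nat_eq_iff[of k 3, where 'a = complex] by (simp add: \<kappa>_def)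
  then have W0: "W 0 \<noteq> 0" using cond by (auto simp: W_def)
  have "(of_nat k :: complex) \<noteq> 2" using k3 of_nat_eq_iff[of k 2, where 'a = complex] by simp
  then have V0: "V 0 \<noteq> 0" by (simp add: V_def)
  have contW: "isCont W 0" and contV: "isCont V 0"
    unfolding W_def V_def by (cases "a = 1", simp_all)+
  \<comment> \<open>H d stands for Y * d ^ (k - 3 + m), where Y = - x 2; likewise V d * d stands for
    S * d ^ m.\<close>
  define H where "H = (\<lambda>d. (1 + d) * d ^ (k - 3 + m) + d ^ (k - 1 + m) + (1 + d) ^ (k - 2) * W d)"
  have "(0::complex) ^ (k - 3 + m) = 0" "(0::complex) ^ (k - 1 + m) = 0"
    using km k3 by (simp_all only: power_0_left) auto
  then have H0: "H 0 = W 0" unfolding H_def by (simp only: mult_zero_right add_0 add_0_right power_one mult_1)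
  have contH: "isCont H 0" unfolding H_def by (intro continuous_intros contW)
  have ev_e: "\<forall>\<^sub>F d in at 0. \<forall>i\<in>{1..k - 2}. d ^ (i + m) + (1 + d) ^ (i - 1) * W d \<noteq> 0"
    by (intro eventually_ball_finite ballI eventually_nonzero_at_0 continuous_intros contW) (use W0 in \<open>auto simp: power_0_left\<close>)
  have ev_H: "\<forall>\<^sub>F d in at 0. H d \<noteq> 0"
    by (rule eventually_nonzero_at_0[OF contH]) (simp add: H0 W0)
  have ev_V: "\<forall>\<^sub>F d in at 0. V d \<noteq> 0"
    by (rule eventually_nonzero_at_0[OF contV V0])
  have ev_0: "\<forall>\<^sub>F d in at (0::complex). d \<noteq> 0"
    by (simp add: eventually_at_filter)
  \<comment> \<open>This will give x 1 \<noteq> 0. For k = 3 the two sides agree at d = 0, so a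
    factor d is split off explicitly.\<close>
  have ev_x1: "\<forall>\<^sub>F d in at 0. (1 + d) * H d \<noteq> V d * d ^ (k - 3)"
  proof (cases "k = 3")
    case True
    then have a1: "a \<noteq> 1" using cond by simp
    have "\<forall>\<^sub>F d in at 0. 2 * (a - 1) + d * a \<noteq> 0"
      by (intro eventually_nonzero_at_0 continuous_intros) (use a1 in auto)
    then show ?thesis
      using ev_0
    proof eventually_elim
      case (elim d)
      have "(1 + d) * H d - V d * d ^ (k - 3) = d * (2 * (a - 1) + d * a)"
        using True a1 by (simp add: H_def V_def W_def m_def \<kappa>_def algebra_simps power2_eq_square power3_eq_cube)
      then show ?case using elim by auto
    qed
  next
    case False
    then have "\<forall>\<^sub>F d in at 0. (1 + d) * H d - V d * d ^ (k - 3) \<noteq> 0"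
      using k3 H0 W0 by (intro eventually_nonzero_at_0 continuous_intros contH contV) auto
    then show ?thesis by eventually_elim auto
  qed
  have "\<exists>d. (\<forall>i\<in>{1..k - 2}. d ^ (i + m) + (1 + d) ^ (i - 1) * W d \<noteq> 0) \<and> H d \<noteq> 0 \<and> V d \<noteq> 0 \<and> d \<noteq> 0
      \<and> (1 + d) * H d \<noteq> V d * d ^ (k - 3)"
    by (rule eventually_happens'[of "at (0::complex)"], simp) (intro eventually_conj ev_e ev_H ev_V ev_0 ev_x1)
  then obtain d where d: "\<And>i. i \<in> {1..k - 2} \<Longrightarrow> d ^ (i + m) + (1 + d) ^ (i - 1) * W d \<noteq> 0"
    "H d \<noteq> 0" "V d \<noteq> 0" "d \<noteq> 0" "(1 + d) * H d \<noteq> V d * d ^ (k - 3)" by blast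
  define w where "w = (a - 1) / d + \<kappa> - d"
  define e where "e = (\<lambda>i. d + (1 + 1 / d) ^ (i - 1) * w)"
  define S where "S = a - 1 + of_nat (k - 2) * d"
  define Y where "Y = 1 + d + d * e (k - 1)"
  define x where "x = (\<lambda>i::nat. if i = 1 then d * (1 + d) * Y / S - 1 else if i = 2 then - Y else e (k + 1 - i))"
  have wW: "w * d ^ m = W d" using d(4) by (simp add: w_def W_def m_def field_simps power2_eq_square)
  have k2: "(of_nat (k - 2) :: complex) = of_nat k - 2" using k3 by (simp add: of_nat_diff)
  have SV: "S * d ^ m = V d * d" using d(4) by (simp add: S_def V_def m_def k2)
  have q: "(1 + 1 / d) ^ n * d ^ n = (1 + d) ^ n" for n
    using d(4) by (simp add: power_mult_distrib[symmetric] field_simps)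
  have e_pow: "e (n + 1) * d ^ (n + m) = d ^ (n + 1 + m) + (1 + d) ^ n * W d" for n
  proof -
    have "e (n + 1) * d ^ (n + m) = d ^ (n + 1 + m) + ((1 + 1 / d) ^ n * d ^ n) * (w * d ^ m)"
      by (simp add: e_def power_add algebra_simps)
    then show ?thesis by (simp only: q wW)
  qed
  have e_nz: "e i \<noteq> 0" if "1 \<le> i" "i \<le> k - 2" for i
    using e_pow[of "i - 1"] d(1)[of i] that by auto
  have YH: "Y * d ^ (k - 3 + m) = H d"
  proof -
    have k1: "k - 1 = (k - 2) + 1" and k2': "k - 2 + m = Suc (k - 3 + m)" using k3 by auto
    have "Y * d ^ (k - 3 + m) = (1 + d) * d ^ (k - 3 + m) + e (k - 1) * d ^ (k - 2 + m)"
      unfolding Y_def k2' power_Suc by (simp add: algebra_simps)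
    also have "e (k - 1) * d ^ (k - 2 + m) = d ^ (k - 1 + m) + (1 + d) ^ (k - 2) * W d"
      unfolding k1 by (rule e_pow)
    finally show ?thesis by (simp add: H_def)
  qed
  have S_nz: "S \<noteq> 0" using SV d(3,4) by auto
  have Y_nz: "Y \<noteq> 0" using YH d(2) by auto
  have x1_nz: "x 1 \<noteq> 0"
  proof
    assume "x 1 = 0"
    then have "d * (1 + d) * Y = S" using S_nz by (simp add: x_def)
    then have "(d * (1 + d) * Y) * d ^ (k - 3 + m) = S * d ^ (k - 3 + m)" by simp
    then have "d * (1 + d) * (Y * d ^ (k - 3 + m)) = (S * d ^ m) * d ^ (k - 3)"
      by (simp only: power_add ac_simps)
    then have "(1 + d) * H d = V d * d ^ (k - 3)" unfolding YH SV using d(4) by simp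
    then show False using d(5) by simp
  qed
  have e_rel: "d * e (i + 1) = a - 1 + (of_nat k - 3 - of_nat i) * d + (\<Sum>l\<in>{1..i}. e l)" for i
  proof (induction i)
    case 0
    then show ?case using d(4) by (simp add: e_def w_def \<kappa>_def field_simps)
  next
    case (Suc i)
    have "e (Suc i + 1) = d + (1 + 1 / d) * ((1 + 1 / d) ^ i * w)"
      unfolding e_def add_diff_cancel_right' power_Suc mult.assoc ..
    then have "d * e (Suc i + 1) = d * d + (d * (1 + 1 / d)) * ((1 + 1 / d) ^ i * w)"
      by (simp only: distrib_left[of d d] mult.assoc)
    also have "d * (1 + 1 / d) = d + 1" using d(4) by (simp add: field_simps)
    also have "d * d + (d + 1) * ((1 + 1 / d) ^ i * w) = d * e (i + 1) + e (i + 1) - d"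
      by (simp add: e_def algebra_simps)
    finally have "d * e (Suc i + 1) = d * e (i + 1) + e (i + 1) - d" .
    then show ?case unfolding Suc by (simp add: algebra_simps One_nat_def)
  qed
  have "lyness_point k a d S e x"
  proof
    show "x i \<noteq> 0" if "1 \<le> i" "i \<le> k" for i
      using that x1_nz Y_nz e_nz[of "k + 1 - i"] by (auto simp: x_def)
    show "1 + x 1 = - d * (1 + d) * x 2 / S" by (simp add: x_def)
    show "x 2 = - (1 + d + d * e (k - 1))" by (simp add: x_def Y_def)
  qed (use d S_nz e_rel in \<open>auto simp: S_def x_def\<close>)
  then show ?thesis by blast
qed

lemma (in lyness) lyness_pattern_holds:
  assumes "k > 3 \<or> a \<noteq> 1"
  shows "lyness_pattern k a"
proof -
  obtain d S e x where "lyness_point k a d S e x" using singular_orbit_values[OF assms] by blast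
  then interpret P: lyness_point k a d S e x .
  show ?thesis by unfold_locales (rule P.pattern_at_point)
qed

section \<open>Weighted degrees of rational functions\<close>

definition rdeg :: "(nat \<Rightarrow> int) \<Rightarrow> ratfun \<Rightarrow> int" where
  "rdeg q f = (THE e. \<exists>U V. U \<noteq> 0 \<and> V \<noteq> 0 \<and> f = pol U / pol V \<and> e = wdeg q U - wdeg q V)"

lemma rdeg_eq:
  assumes "U \<noteq> 0" "V \<noteq> 0"
  shows "rdeg q (pol U / pol V) = wdeg q U - wdeg q V"
  unfolding rdeg_def
proof (rule the_equality)
  show "\<exists>U' V'. U' \<noteq> 0 \<and> V' \<noteq> 0 \<and> pol U / pol V = pol U' / pol V' \<and> wdeg q U - wdeg q V = wdeg q U' - wdeg q V'"
    using assms by blast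
next
  fix e assume "\<exists>U' V'. U' \<noteq> 0 \<and> V' \<noteq> 0 \<and> pol U / pol V = pol U' / pol V' \<and> e = wdeg q U' - wdeg q V'"
  then obtain U' V' where *: "U' \<noteq> 0" "V' \<noteq> 0" "pol U / pol V = pol U' / pol V'" "e = wdeg q U' - wdeg q V'" by blast
  then have "pol (U * V') = pol (U' * V)" using assms by (simp add: frac_eq_eq)
  then have "U * V' = U' * V" by (simp only: pol_eq_iff)
  then have "wdeg q U + wdeg q V' = wdeg q U' + wdeg q V"
    using wdeg_mult[of U V' q] wdeg_mult[of U' V q] assms * by simp
  then show "e = wdeg q U - wdeg q V" using * by simp
qed

lemma rdeg_pol: "U \<noteq> 0 \<Longrightarrow> rdeg q (pol U) = wdeg q U"
  using rdeg_eq[of U 1 q] by simp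

lemma ratfun_cases_nz:
  assumes "f \<noteq> 0"
  obtains U V where "U \<noteq> 0" "V \<noteq> 0" "f = pol U / pol V"
proof -
  obtain U V where "V \<noteq> 0" "f = pol U / pol V" by (rule ratfun_cases)
  moreover from this assms have "U \<noteq> 0" by auto
  ultimately show ?thesis using that by blast
qed

lemma rdeg_mult:
  assumes "f \<noteq> 0" "g \<noteq> 0" shows "rdeg q (f * g) = rdeg q f + rdeg q g"
proof -
  obtain U V where f: "U \<noteq> 0" "V \<noteq> 0" "f = pol U / pol V" using assms ratfun_cases_nz by blast
  obtain U' V' where g: "U' \<noteq> 0" "V' \<noteq> 0" "g = pol U' / pol V'" using assms ratfun_cases_nz by blast
  have "f * g = pol (U * U') / pol (V * V')" using f g by simp
  then show ?thesis using f g rdeg_eq[of "U * U'" "V * V'" q] by (simp add: rdeg_eq wdeg_mult)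
qed

lemma rdeg_1 [simp]: "rdeg q 1 = 0"
  using rdeg_pol[of 1 q] by simp

lemma rdeg_var [simp]: "rdeg q (rf_var i) = q i"
  using rdeg_pol[of "mvar i" q] by simp

lemma rdeg_divide:
  assumes "f \<noteq> 0" "g \<noteq> 0" shows "rdeg q (f / g) = rdeg q f - rdeg q g"
  using rdeg_mult[of "f / g" g q] assms by simp

lemma rdeg_power: "f \<noteq> 0 \<Longrightarrow> rdeg q (f ^ n) = int n * rdeg q f"
  by (induction n) (simp_all add: rdeg_mult algebra_simps)

lemma rdeg_prod: "(\<And>i. i \<in> S \<Longrightarrow> f i \<noteq> 0) \<Longrightarrow> rdeg q (prod f S) = (\<Sum>i\<in>S. rdeg q (f i))"
  by (induction S rule: infinite_finite_induct) (simp_all add: rdeg_mult)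

lemma rdeg_add_le:
  assumes "f + g \<noteq> 0" "f \<noteq> 0 \<Longrightarrow> rdeg q f \<le> e" "g \<noteq> 0 \<Longrightarrow> rdeg q g \<le> e"
  shows "rdeg q (f + g) \<le> e"
proof (cases "f = 0 \<or> g = 0")
  case False
  obtain U V where f: "U \<noteq> 0" "V \<noteq> 0" "f = pol U / pol V" using False ratfun_cases_nz by blast
  obtain U' V' where g: "U' \<noteq> 0" "V' \<noteq> 0" "g = pol U' / pol V'" using False ratfun_cases_nz by blast
  have fg: "f + g = pol (U * V' + U' * V) / pol (V * V')" using f g by (simp add: add_frac_eq)
  then have nz: "U * V' + U' * V \<noteq> 0" using assms(1) by (metis div_0 pol_simps(1))
  have "wdeg q (U * V' + U' * V) \<le> e + wdeg q V + wdeg q V'"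
  proof (rule wdeg_add_le[OF nz])
    show "wdeg q (U * V') \<le> e + wdeg q V + wdeg q V'" using assms(2) False f g by (simp add: rdeg_eq wdeg_mult)
    show "wdeg q (U' * V) \<le> e + wdeg q V + wdeg q V'" using assms(3) False f g by (simp add: rdeg_eq wdeg_mult)
  qed
  then show ?thesis unfolding fg using nz f g rdeg_eq[of "U * V' + U' * V" "V * V'" q] by (simp add: wdeg_mult)
qed (use assms in auto)

lemma rdeg_sum_le:
  assumes "finite S" "sum f S \<noteq> 0" "\<And>i. i \<in> S \<Longrightarrow> f i \<noteq> 0 \<Longrightarrow> rdeg q (f i) \<le> e"
  shows "rdeg q (sum f S) \<le> e"
  using assms
proof (induction S)
  case (insert x S)
  have "rdeg q (f x + sum f S) \<le> e"
    by (rule rdeg_add_le) (use insert in auto)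
  then show ?case using insert by simp
qed simp

lemma rdeg_reval_le:
  assumes nz: "reval y P \<noteq> 0" and y: "\<And>i. y i \<noteq> 0" "\<And>i. rdeg q (y i) = q' i"
  shows "rdeg q (reval y P) \<le> wdeg q' P"
  unfolding peval_def
proof (rule rdeg_sum_le)
  show "(\<Sum>m\<in>Poly_Mapping.keys P. rf_const (Poly_Mapping.lookup P m) * mon y m) \<noteq> 0"
    using nz by (simp add: peval_def)
  fix m assume m: "m \<in> Poly_Mapping.keys P"
  have "rdeg q (mon y m) = mweight q' m"
    unfolding mon_def mweight_def using y by (simp add: rdeg_prod rdeg_power)
  moreover have "mon y m \<noteq> 0" using y by (simp add: mon_def)
  moreover have "rf_const (Poly_Mapping.lookup P m) \<noteq> 0" "rdeg q (rf_const (Poly_Mapping.lookup P m)) = 0"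
    using m rdeg_pol[of "mconst (Poly_Mapping.lookup P m)" q] pol_eq_0_iff[of "mconst (Poly_Mapping.lookup P m)"]
    by (simp_all add: in_keys_iff)
  ultimately show "rdeg q (rf_const (Poly_Mapping.lookup P m) * mon y m) \<le> wdeg q' P"
    using wdeg_ge[OF m, of q'] by (simp add: rdeg_mult)
qed simp

section \<open>Upper bounds by the tropical recurrence\<close>

context lyness
begin

text \<open>The tropical Lyness map: the weights of the shifted variables, by
  \<open>rdeg_Theta_var\<close>. The weight of ell is the maximum of q 2, ..., q k, and of 0 if a
  \<noteq> 0.\<close>

definition nextw :: "(nat \<Rightarrow> int) \<Rightarrow> nat \<Rightarrow> int" where
  "nextw q i = (if 1 \<le> i \<and> i < k then q (i + 1) else if i = k then wdeg q ell - q 1 else q i)"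

definition orb :: "(nat \<Rightarrow> int) \<Rightarrow> nat \<Rightarrow> int" where
  "orb q i = (nextw ^^ (i - 1)) q 1"

lemma lookup_ell:
  "Poly_Mapping.lookup ell m = (if m = 0 then a else 0) + (if \<exists>j\<in>{2..k}. m = Poly_Mapping.single j 1 then 1 else 0)"
proof -
  have inj: "Poly_Mapping.single i (1::nat) = Poly_Mapping.single j 1 \<longleftrightarrow> i = j" for i j :: nat
    by (metis lookup_single_eq lookup_single_not_eq zero_neq_one)
  have "(\<Sum>j\<in>{2..k}. Poly_Mapping.lookup (mvar j) m) = (if \<exists>j\<in>{2..k}. m = Poly_Mapping.single j 1 then 1 else 0)"
  proof (cases "\<exists>j\<in>{2..k}. m = Poly_Mapping.single j 1")
    case True
    then obtain j where j: "j \<in> {2..k}" "m = Poly_Mapping.single j 1" by blast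
    then have "(\<Sum>i\<in>{2..k}. Poly_Mapping.lookup (mvar i) m) = (\<Sum>i\<in>{2..k}. if i = j then 1 else 0)"
      by (intro sum.cong) (auto simp: mvar_def lookup_single inj)
    then show ?thesis using j by auto
  next
    case False
    then show ?thesis by (auto simp: mvar_def lookup_single when_def intro!: sum.neutral)
  qed
  then show ?thesis by (simp add: ell_def lookup_add lookup_sum mconst_def lookup_single when_def)
qed

text \<open>A maximum characterised by its upper bounds, which treats a = 0 and a \<noteq> 0
  together.\<close>

lemma wdeg_ell_le_iff: "wdeg q ell \<le> e \<longleftrightarrow> (\<forall>j\<in>{2..k}. q j \<le> e) \<and> (a \<noteq> 0 \<longrightarrow> 0 \<le> e)"
proof -
  have single_nz: "Poly_Mapping.single j (1::nat) \<noteq> 0" for j :: nat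
    by (metis lookup_single_eq lookup_zero zero_neq_one)
  have keys: "m \<in> Poly_Mapping.keys ell \<longleftrightarrow> (m = 0 \<and> a \<noteq> 0) \<or> (\<exists>j\<in>{2..k}. m = Poly_Mapping.single j 1)" for m
    using single_nz by (auto simp: in_keys_iff lookup_ell)
  show ?thesis
  proof
    assume "wdeg q ell \<le> e"
    then have le: "mweight q m \<le> e" if "m \<in> Poly_Mapping.keys ell" for m using wdeg_ge[OF that, of q] by simp
    show "(\<forall>j\<in>{2..k}. q j \<le> e) \<and> (a \<noteq> 0 \<longrightarrow> 0 \<le> e)"
    proof (intro conjI ballI impI)
      fix j assume "j \<in> {2..k}"
      then have "Poly_Mapping.single j 1 \<in> Poly_Mapping.keys ell" using keys by blast
      then show "q j \<le> e" using le by fastforce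
    next
      show "0 \<le> e" if "a \<noteq> 0" using le[of 0] that unfolding keys by simp
    qed
  next
    assume "(\<forall>j\<in>{2..k}. q j \<le> e) \<and> (a \<noteq> 0 \<longrightarrow> 0 \<le> e)"
    then show "wdeg q ell \<le> e" by (intro wdeg_leI ell_neq_0) (auto simp: keys)
  qed
qed

definition pot :: "(nat \<Rightarrow> int) \<Rightarrow> int" where
  "pot q = max (wdeg q ell) (q 1) + (\<Sum>i\<in>{1..k}. max 0 (- q i))"

text \<open>The tropical version of the first integral (1 + 1 / x 1) ... (1 + 1 / x k) (a + x 1 + ... + x k).\<close>

lemma pot_nextw: "pot (nextw q) = pot q"
proof -
  let ?m = "wdeg q ell"
  have all: "(\<forall>j\<in>{2..k}. nextw q j \<le> e) \<and> nextw q 1 \<le> e \<longleftrightarrow> (\<forall>j\<in>{2..k}. q j \<le> e) \<and> ?m - q 1 \<le> e" for e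
  proof -
    have "(\<forall>j\<in>{2..k}. nextw q j \<le> e) \<and> nextw q 1 \<le> e \<longleftrightarrow> (\<forall>j\<in>{1..<k}. q (j + 1) \<le> e) \<and> ?m - q 1 \<le> e"
    proof -
      have "{2..k} = insert k {2..<k}" "{1..<k} = insert 1 {2..<k}" using k3 by auto
      then show ?thesis using k3 by (auto simp: nextw_def)
    qed
    moreover have "(\<forall>j\<in>{1..<k}. q (j + 1) \<le> e) \<longleftrightarrow> (\<forall>j\<in>{2..k}. q j \<le> e)"
    proof
      assume h: "\<forall>j\<in>{1..<k}. q (j + 1) \<le> e"
      show "\<forall>j\<in>{2..k}. q j \<le> e"
      proof
        fix j assume "j \<in> {2..k}"
        then have "j - 1 \<in> {1..<k}" "j - 1 + 1 = j" by auto
        then show "q j \<le> e" using h by metis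
      qed
    qed auto
    ultimately show ?thesis by simp
  qed
  have "max (wdeg (nextw q) ell) (nextw q 1) \<le> e \<longleftrightarrow> max ?m (?m - q 1) \<le> e" for e
    using all[of e] wdeg_ell_le_iff[of "nextw q" e] wdeg_ell_le_iff[of q e] by auto
  then have mu: "max (wdeg (nextw q) ell) (nextw q 1) = max ?m (?m - q 1)"
    by (metis order_antisym order_refl)
  have "(\<Sum>i\<in>{1..k}. max 0 (- nextw q i)) = max 0 (q 1 - ?m) + (\<Sum>i\<in>{1..<k}. max 0 (- q (i + 1)))"
  proof -
    have "{1..k} = insert k {1..<k}" using k3 by auto
    then have "(\<Sum>i\<in>{1..k}. max 0 (- nextw q i)) = max 0 (- nextw q k) + (\<Sum>i\<in>{1..<k}. max 0 (- nextw q i))" by simp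
    moreover have "(\<Sum>i\<in>{1..<k}. max 0 (- nextw q i)) = (\<Sum>i\<in>{1..<k}. max 0 (- q (i + 1)))"
      by (intro sum.cong) (auto simp: nextw_def)
    ultimately show ?thesis using k3 by (simp add: nextw_def)
  qed
  also have "(\<Sum>i\<in>{1..<k}. max 0 (- q (i + 1))) = (\<Sum>i\<in>{2..k}. max 0 (- q i))"
    by (rule sum.reindex_bij_witness[of _ "\<lambda>i. i - 1" "\<lambda>i. i + 1"]) auto
  finally have s1: "(\<Sum>i\<in>{1..k}. max 0 (- nextw q i)) = max 0 (q 1 - ?m) + (\<Sum>i\<in>{2..k}. max 0 (- q i))" .
  have "{1..k} = insert 1 {2..k}" using k3 by auto
  then have s2: "(\<Sum>i\<in>{1..k}. max 0 (- q i)) = max 0 (- q 1) + (\<Sum>i\<in>{2..k}. max 0 (- q i))" by simp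
  \<comment> \<open>Apart from the common sum over 2..k, both sides are ?m + max 0 (- q 1) + max 0
    (q 1 - ?m).\<close>
  show ?thesis unfolding pot_def mu s1 s2 by (auto simp: max_def)
qed

lemma pot_nextw_pow: "pot ((nextw ^^ n) q) = pot q"
  by (induction n) (simp_all add: pot_nextw)

lemma pot_ge: "wdeg q ell \<le> pot q" "q 1 \<le> pot q"
proof -
  have "(\<Sum>i\<in>{1..k}. max 0 (- q i)) \<ge> 0" by (intro sum_nonneg) simp
  then show "wdeg q ell \<le> pot q" "q 1 \<le> pot q" by (auto simp: pot_def)
qed

lemma orb_le_pot: "orb q i \<le> pot q"
  using pot_ge(2)[of "(nextw ^^ (i - 1)) q"] by (simp add: orb_def pot_nextw_pow)

lemma orb_nextw: "1 \<le> i \<Longrightarrow> orb (nextw q) i = orb q (i + 1)"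
proof -
  assume "1 \<le> i"
  then have "i + 1 - 1 = Suc (i - 1)" by simp
  then show ?thesis unfolding orb_def by (simp only: funpow_Suc_right o_apply)
qed

lemma nextw_pow: "1 \<le> i \<Longrightarrow> i + n \<le> k \<Longrightarrow> (nextw ^^ n) q i = q (i + n)"
  by (induction n arbitrary: i) (auto simp: nextw_def One_nat_def)

text \<open>By the tropical recurrence the left side is the weight of ell on the window that starts
  at i, and this is at most the conserved \<open>pot\<close>.\<close>

lemma orb_pair_le: "1 \<le> i \<Longrightarrow> orb q i + orb q (i + k) \<le> pot q"
proof -
  assume i: "1 \<le> i"
  define r where "r = (nextw ^^ (i - 1)) q"
  have "i + k - 1 = (k - 1) + (1 + (i - 1))" using i k3 by auto
  then have "(nextw ^^ (i + k - 1)) q = (nextw ^^ (k - 1)) (nextw r)"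
    by (simp only: funpow_add o_apply r_def) (simp add: One_nat_def)
  then have "orb q (i + k) = nextw r k"
    using nextw_pow[of 1 "k - 1" "nextw r"] k3 by (simp add: orb_def)
  also have "\<dots> = wdeg r ell - orb q i" using k3 by (simp add: nextw_def orb_def r_def)
  finally show ?thesis using pot_ge(1)[of r] by (simp add: r_def pot_nextw_pow)
qed

lemma rdeg_Theta_var: "rdeg q (Theta (rf_var i)) = nextw q i"
proof -
  consider "1 \<le> i" "i < k" | "i = k" | "i \<notin> {1..k}" by force
  then show ?thesis
  proof cases
    case 1
    then show ?thesis by (simp add: Theta_var nextw_def X_var)
  next
    case 2
    then show ?thesis using k3 by (simp add: Theta_var nextw_def X_Suc_k[simplified] rdeg_divide rdeg_pol ell_neq_0)
  next
    case 3
    then show ?thesis using k3 by (auto simp: Theta_var nextw_def)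
  qed
qed

text \<open>For f = P / mx ^ r the weight of mx is transformed exactly, while that of P can only
  drop by cancellation. A general denominator could drop as well, hence the restriction to Laurent
  polynomials.\<close>

lemma rdeg_Theta_le:
  assumes "laurent f" "f \<noteq> 0"
  shows "rdeg q (Theta f) \<le> rdeg (nextw q) f"
proof -
  obtain P r where P: "f * pol mx ^ r = pol P" using assms unfolding laurent_def by blast
  have "P \<noteq> 0" using P assms(2) by auto
  have nz: "Theta g \<noteq> 0" if "g \<noteq> 0" for g using that field_hom_simps(9)[OF hom_Theta] by simp
  have mxd: "rdeg q (Theta (pol mx)) = wdeg (nextw q) mx"
  proof -
    have "rdeg q (Theta (pol mx)) = (\<Sum>i\<in>{1..k}. nextw q i)"
      unfolding pol_mx field_hom_prod[OF hom_Theta] by (subst rdeg_prod) (simp_all add: nz rdeg_Theta_var)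
    then show ?thesis by (simp add: mx_def wdeg_prod)
  qed
  have "Theta f * Theta (pol mx) ^ r = Theta (pol P)"
    using arg_cong[OF P, of Theta] by (simp add: field_hom_simps[OF hom_Theta])
  then have "rdeg q (Theta f) + int r * wdeg (nextw q) mx = rdeg q (Theta (pol P))"
    using rdeg_mult[of "Theta f" "Theta (pol mx) ^ r" q] nz assms(2) by (simp add: rdeg_power mxd)
  also have "\<dots> \<le> wdeg (nextw q) P"
    unfolding field_hom_pol[OF hom_Theta]
    by (rule rdeg_reval_le) (use nz \<open>P \<noteq> 0\<close> in \<open>auto simp: rdeg_Theta_var simp flip: field_hom_pol[OF hom_Theta]\<close>)
  also have "wdeg (nextw q) P = rdeg (nextw q) (f * pol mx ^ r)" using P \<open>P \<noteq> 0\<close> by (simp add: rdeg_pol)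
  also have "\<dots> = rdeg (nextw q) f + int r * wdeg (nextw q) mx"
    using assms(2) by (simp add: rdeg_mult rdeg_power rdeg_pol)
  finally show ?thesis by simp
qed

end

context lyness_pattern
begin

text \<open>\<open>tau_Suc\<close> splits off the power of X 1, and the remaining shift is moved
  into the weight.\<close>

lemma rdeg_tau_le: "rdeg q (tau n) \<le> (\<Sum>i\<in>{1..n}. int (c (int n - int i)) * orb q i)"
proof (induction n arbitrary: q)
  case (Suc n)
  have "rdeg q (tau (Suc n)) = int (c (int n)) * q 1 + rdeg q (Theta (tau n))"
    using field_hom_simps(9)[OF hom_Theta] by (simp add: tau_Suc rdeg_mult rdeg_power)
  also have "\<dots> \<le> int (c (int n)) * q 1 + (\<Sum>i\<in>{1..n}. int (c (int n - int i)) * orb (nextw q) i)"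
    using rdeg_Theta_le[OF laurent_tau tau_neq_0, of q n] Suc[of "nextw q"] by linarith
  also have "(\<Sum>i\<in>{1..n}. int (c (int n - int i)) * orb (nextw q) i) = (\<Sum>i\<in>{2..Suc n}. int (c (int (Suc n) - int i)) * orb q i)"
    by (rule sum.reindex_bij_witness[of _ "\<lambda>i. i - 1" "\<lambda>i. i + 1"]) (auto simp: orb_nextw)
  also have "int (c (int n)) * q 1 = int (c (int (Suc n) - int 1)) * orb q 1"
    by (simp add: orb_def)
  also have "int (c (int (Suc n) - int 1)) * orb q 1 + (\<Sum>i\<in>{2..Suc n}. int (c (int (Suc n) - int i)) * orb q i) = (\<Sum>i\<in>{1..Suc n}. int (c (int (Suc n) - int i)) * orb q i)"
  proof -
    have "{1..Suc n} = insert 1 {2..Suc n}" by auto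
    then show ?thesis by (simp del: of_nat_Suc)
  qed
  finally show ?case .
qed simp

lemma rdeg_tau_le_pot:
  assumes "pot q \<le> b" "0 \<le> b"
  shows "rdeg q (tau n) \<le> b * int (n ^ 2)"
proof -
  have "rdeg q (tau n) \<le> (\<Sum>i\<in>{1..n}. int (c (int n - int i)) * orb q i)" by (rule rdeg_tau_le)
  also have "\<dots> \<le> (\<Sum>i\<in>{1..n}. int n * b)"
  proof (rule sum_mono)
    fix i assume i: "i \<in> {1..n}"
    have "int (c (int n - int i)) * orb q i \<le> int (c (int n - int i)) * b"
      using orb_le_pot[of q i] assms by (intro mult_left_mono) auto
    also have "int (c (int n - int i)) \<le> int n" using c_upper[of "int n - int i"] i by auto
    then have "int (c (int n - int i)) * b \<le> int n * b" using assms by (intro mult_right_mono) auto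
    finally show "int (c (int n - int i)) * orb q i \<le> int n * b" .
  qed
  also have "\<dots> = b * int (n ^ 2)" by (simp add: power2_eq_square)
  finally show ?thesis .
qed

section \<open>Numerators of the tau functions and the upper bound for the iterates\<close>

definition ind :: "nat \<Rightarrow> nat \<Rightarrow> int" where "ind i = (\<lambda>j. if j = i then 1 else 0)"

lemma vdeg_ind: "vdeg i = wdeg (ind i)"
  by (simp add: vdeg_def ind_def)

text \<open>These weights control, in this order, the total degree, the order of the pole along x i,
  the degree in variables outside 1..k and, for the lower bound, the weight that p and 1 - p add up
  to.\<close>

lemma pot_small:
  "pot (\<lambda>_. 1) \<le> 1" "pot (\<lambda>j. - ind i j) \<le> 1" "j \<notin> {1..k} \<Longrightarrow> pot (ind j) \<le> 0"
  "pot (\<lambda>i. if i \<in> {1..k} then 1 else 0) \<le> 1"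
proof -
  show "pot (\<lambda>_. 1) \<le> 1" using wdeg_ell_le_iff[of "\<lambda>_. 1" 1] by (simp add: pot_def)
  show "pot (\<lambda>i. if i \<in> {1..k} then 1 else 0) \<le> 1"
    using wdeg_ell_le_iff[of "\<lambda>i. if i \<in> {1..k} then 1 else 0" 1] by (simp add: pot_def)
  have "(\<Sum>j\<in>{1..k}. max 0 (- (- ind i j))) = (\<Sum>j\<in>{1..k}. if j = i then 1 else 0)"
    by (intro sum.cong) (auto simp: ind_def)
  then have "(\<Sum>j\<in>{1..k}. max 0 (- (- ind i j))) \<le> 1" by simp
  moreover have "wdeg (\<lambda>j. - ind i j) ell \<le> 0" by (subst wdeg_ell_le_iff) (auto simp: ind_def)
  moreover have "- ind i 1 \<le> 0" by (simp add: ind_def)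
  ultimately show "pot (\<lambda>j. - ind i j) \<le> 1" unfolding pot_def by linarith
  assume j: "j \<notin> {1..k}"
  then have "ind j i = 0" if "i \<in> {1..k}" for i using that by (auto simp: ind_def)
  moreover from this have "(\<Sum>i\<in>{1..k}. max 0 (- ind j i)) = 0" by (intro sum.neutral) simp
  moreover have "wdeg (ind j) ell \<le> 0" by (subst wdeg_ell_le_iff) (use j in \<open>auto simp: ind_def\<close>)
  ultimately show "pot (ind j) \<le> 0" using k3 by (simp add: pot_def)
qed

definition inner :: "mpoly \<Rightarrow> bool" where
  "inner P \<longleftrightarrow> P \<noteq> 0 \<and> (\<forall>j. j \<notin> {1..k} \<longrightarrow> vdeg j P = 0)"

lemma inner_mult: "inner P \<Longrightarrow> inner Q \<Longrightarrow> inner (P * Q)"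
  by (simp add: inner_def vdeg_mult)

lemma inner_1: "inner 1"
  by (simp add: inner_def vdeg_def)

lemma inner_power: "inner P \<Longrightarrow> inner (P ^ n)"
  by (induction n) (auto intro: inner_1 inner_mult)

lemma inner_prod: "(\<And>i. i \<in> S \<Longrightarrow> inner (f i)) \<Longrightarrow> inner (prod f S)"
  by (induction S rule: infinite_finite_induct) (auto intro: inner_1 inner_mult)

lemma inner_mx: "inner mx"
  unfolding mx_def by (rule inner_prod) (auto simp: inner_def vdeg_def)

lemma mx_power_dvd:
  assumes "\<And>m i. m \<in> Poly_Mapping.keys P \<Longrightarrow> i \<in> {1..k} \<Longrightarrow> e \<le> Poly_Mapping.lookup m i"
  shows "mx ^ e dvd P"
proof -
  have "mx ^ e dvd Poly_Mapping.single m (Poly_Mapping.lookup P m)" if m: "m \<in> Poly_Mapping.keys P" for m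
  proof -
    let ?S = "{1..k} \<union> Poly_Mapping.keys m"
    have "mx ^ e = (\<Prod>i\<in>{1..k}. mvar i ^ e)" by (simp add: mx_def prod_power_distrib)
    also have "\<dots> dvd (\<Prod>i\<in>{1..k}. mvar i ^ Poly_Mapping.lookup m i)"
      by (rule prod_dvd_prod) (use assms[OF m] in \<open>auto intro: le_imp_power_dvd\<close>)
    also have "\<dots> dvd (\<Prod>i\<in>?S. mvar i ^ Poly_Mapping.lookup m i)"
      by (rule prod_dvd_prod_subset) auto
    also have "\<dots> = mon mvar m" by (rule mon_superset[symmetric]) auto
    finally show ?thesis by (simp add: single_eq_const_mon)
  qed
  then show ?thesis using mpoly_eq_sum_singles[of P] by (metis (no_types, lifting) dvd_sum)
qed

text \<open>The weight - \<open>ind i\<close> has potential at most 1, so the pole of tau n along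
  each variable has order at most n ^ 2. The degree bound adds n ^ 2 for tau n and k * n ^ 2 for the
  power of mx.\<close>

lemma tau_form:
  obtains P where "tau n * pol mx ^ (n ^ 2) = pol P" "inner P" "tdeg P \<le> int ((k + 1) * n ^ 2)"
proof -
  obtain P r where P: "tau n * pol mx ^ r = pol P" using laurent_tau[of n] unfolding laurent_def by blast
  \<comment> \<open>Multiplying by mx ^ n ^ 2 in advance allows the uncontrolled power mx ^ r to be
    divided out afterwards.\<close>
  then have e: "tau n * pol mx ^ (r + n ^ 2) = pol (P * mx ^ n ^ 2)" by (simp add: power_add mult.assoc)
  let ?Q = "P * mx ^ n ^ 2"
  have Pnz: "P \<noteq> 0" using P by auto
  have wd: "wdeg q ?Q = rdeg q (tau n) + int (r + n ^ 2) * (\<Sum>i\<in>{1..k}. q i)" for q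
  proof -
    have "wdeg q ?Q = rdeg q (tau n * pol mx ^ (r + n ^ 2))" unfolding e using Pnz by (subst rdeg_pol) simp_all
    also have "\<dots> = rdeg q (tau n) + int (r + n ^ 2) * wdeg q mx"
      by (simp add: rdeg_mult rdeg_power rdeg_pol del: of_nat_add)
    finally show ?thesis by (simp add: mx_def wdeg_prod)
  qed
  have "mx ^ r dvd ?Q"
  proof (rule mx_power_dvd)
    fix m i assume m: "m \<in> Poly_Mapping.keys ?Q" and i: "i \<in> {1..k}"
    have "mweight (\<lambda>j. - ind i j) m = - int (Poly_Mapping.lookup m i)"
      using mweight_indicator[of i m] by (simp add: mweight_def ind_def sum_negf)
    then have "- int (Poly_Mapping.lookup m i) \<le> wdeg (\<lambda>j. - ind i j) ?Q"
      using wdeg_ge[OF m, of "\<lambda>j. - ind i j"] by simp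
    also have "(\<Sum>j\<in>{1..k}. - ind i j) = - 1" using i by (simp add: ind_def sum_negf)
    then have "wdeg (\<lambda>j. - ind i j) ?Q = rdeg (\<lambda>j. - ind i j) (tau n) - int (r + n ^ 2)" unfolding wd by simp
    also have "\<dots> \<le> 1 * int (n ^ 2) - int (r + n ^ 2)"
      using rdeg_tau_le_pot[OF pot_small(2)[of i], of n] by simp
    finally show "r \<le> Poly_Mapping.lookup m i" by simp
  qed
  then obtain R where R: "?Q = mx ^ r * R" by (auto simp: dvd_def)
  have Rnz: "R \<noteq> 0" using R Pnz by auto
  have "pol mx ^ r * (tau n * pol mx ^ n ^ 2) = pol mx ^ r * pol R"
    using e R by (simp add: power_add ac_simps)
  then have f: "tau n * pol mx ^ n ^ 2 = pol R" by simp
  have wR: "wdeg q R = rdeg q (tau n) + int (n ^ 2) * (\<Sum>i\<in>{1..k}. q i)" for q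
  proof -
    have "wdeg q R = rdeg q (tau n * pol mx ^ n ^ 2)" unfolding f using Rnz by (simp add: rdeg_pol)
    also have "\<dots> = rdeg q (tau n) + int (n ^ 2) * wdeg q mx" by (simp add: rdeg_mult rdeg_power rdeg_pol)
    finally show ?thesis by (simp add: mx_def wdeg_prod)
  qed
  have "inner R"
    unfolding inner_def
  proof (intro conjI allI impI Rnz)
    fix j assume j: "j \<notin> {1..k}"
    have "(\<Sum>i\<in>{1..k}. ind j i) = 0" using j by (intro sum.neutral) (auto simp: ind_def)
    then have "wdeg (ind j) R = rdeg (ind j) (tau n)" unfolding wR by simp
    also have "\<dots> \<le> 0" using rdeg_tau_le_pot[OF pot_small(3)[OF j], of n] by simp
    finally show "vdeg j R = 0" using vdeg_nonneg[of j R] by (simp add: vdeg_ind)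
  qed
  moreover have "tdeg R \<le> int ((k + 1) * n ^ 2)"
    using wR[of "\<lambda>_. 1"] rdeg_tau_le_pot[OF pot_small(1), of n] by (simp add: algebra_simps)
  ultimately show ?thesis using that f by blast
qed

text \<open>The constant 4 * k + 2 is 2 * (k + 1) for two tau numerators plus 2 * k for the two
  powers of mx that clear the other side.\<close>

lemma X_form:
  assumes "1 \<le> n"
  obtains U V where "X n = pol U / pol V" "inner U" "inner V"
    "tdeg U \<le> int ((4 * k + 2) * n ^ 2)" "tdeg V \<le> int ((4 * k + 2) * n ^ 2)"
proof -
  obtain A where A: "tau n * pol mx ^ (n ^ 2) = pol A" "inner A" "tdeg A \<le> int ((k + 1) * n ^ 2)" by (rule tau_form)
  define n1 n2 n3 where "n1 = n - k" and "n2 = n - k - 1" and "n3 = n - 2 * k - 1"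
  obtain B where B: "tau n1 * pol mx ^ (n1 ^ 2) = pol B" "inner B" "tdeg B \<le> int ((k + 1) * n1 ^ 2)" by (rule tau_form)
  obtain C where C: "tau n2 * pol mx ^ (n2 ^ 2) = pol C" "inner C" "tdeg C \<le> int ((k + 1) * n2 ^ 2)" by (rule tau_form)
  obtain D where D: "tau n3 * pol mx ^ (n3 ^ 2) = pol D" "inner D" "tdeg D \<le> int ((k + 1) * n3 ^ 2)" by (rule tau_form)
  define U V where "U = A * D * mx ^ (n1 ^ 2 + n2 ^ 2)" and "V = B * C * mx ^ (n ^ 2 + n3 ^ 2)"
  have rel: "X n * (tau n1 * tau n2) = tau n * tau n3" using tau_rel[OF assms] by (simp add: n1_def n2_def n3_def)
  have nz: "A \<noteq> 0" "B \<noteq> 0" "C \<noteq> 0" "D \<noteq> 0" using A B C D by (auto simp: inner_def)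
  have "X n * pol V = (X n * (tau n1 * tau n2)) * pol mx ^ (n1 ^ 2 + n2 ^ 2 + n ^ 2 + n3 ^ 2)"
    by (simp add: V_def B(1)[symmetric] C(1)[symmetric] power_add ac_simps)
  also have "\<dots> = pol U"
    unfolding rel by (simp add: U_def A(1)[symmetric] D(1)[symmetric] power_add ac_simps)
  finally have "X n * pol V = pol U" .
  moreover have "V \<noteq> 0" using nz by (simp add: V_def)
  ultimately have XUV: "X n = pol U / pol V" by (simp add: eq_divide_eq)
  have tmx: "tdeg mx = int k" by (simp add: mx_def wdeg_prod)
  have le: "n1 ^ 2 \<le> n ^ 2" "n2 ^ 2 \<le> n ^ 2" "n3 ^ 2 \<le> n ^ 2"
    unfolding n1_def n2_def n3_def by (intro power_mono; simp)+
  have le': "(k + 1) * n1 ^ 2 \<le> (k + 1) * n ^ 2" "(k + 1) * n2 ^ 2 \<le> (k + 1) * n ^ 2" "(k + 1) * n3 ^ 2 \<le> (k + 1) * n ^ 2"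
    "k * (n1 ^ 2 + n2 ^ 2) \<le> k * (n ^ 2 + n ^ 2)" "k * (n ^ 2 + n3 ^ 2) \<le> k * (n ^ 2 + n ^ 2)"
    by (intro mult_le_mono2 add_mono le order_refl)+
  have "tdeg U = tdeg A + tdeg D + int (k * (n1 ^ 2 + n2 ^ 2))"
    unfolding U_def using nz by (simp add: wdeg_mult wdeg_power tmx del: of_nat_add)
  also have "\<dots> \<le> int ((k + 1) * n ^ 2) + int ((k + 1) * n ^ 2) + int (k * (n ^ 2 + n ^ 2))"
    using A(3) D(3) le' by (intro add_mono) (meson order_trans of_nat_mono)+
  also have "\<dots> = int ((4 * k + 2) * n ^ 2)" by (simp add: algebra_simps)
  finally have U: "tdeg U \<le> int ((4 * k + 2) * n ^ 2)" .
  have "tdeg V = tdeg B + tdeg C + int (k * (n ^ 2 + n3 ^ 2))"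
    unfolding V_def using nz by (simp add: wdeg_mult wdeg_power tmx del: of_nat_add)
  also have "\<dots> \<le> int ((k + 1) * n ^ 2) + int ((k + 1) * n ^ 2) + int (k * (n ^ 2 + n ^ 2))"
    using B(3) C(3) le' by (intro add_mono) (meson order_trans of_nat_mono)+
  also have "\<dots> = int ((4 * k + 2) * n ^ 2)" by (simp add: algebra_simps)
  finally have V: "tdeg V \<le> int ((4 * k + 2) * n ^ 2)" .
  have "inner U" "inner V" unfolding U_def V_def using A B C D by (auto intro!: inner_mult inner_power inner_mx)
  then show ?thesis using that XUV U V by blast
qed

abbreviation iter_degree :: "nat \<Rightarrow> nat" where
  "iter_degree n \<equiv> ratmap_degree k (ratmap_iterate n (lyness_map k a))"

text \<open>The product of the k separate denominators serves as a common denominator, at the cost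
  of the factor k.\<close>

theorem iterate_degree_upper:
  shows "iter_degree n \<le> k * ((4 * k + 2) * (n + k) ^ 2)"
    and "\<exists>g. proj_extension k (ratmap_iterate n (lyness_map k a)) (iter_degree n) g"
proof -
  let ?B = "(4 * k + 2) * (n + k) ^ 2"
  have "\<exists>U V. X (n + i) = pol U / pol V \<and> inner U \<and> inner V \<and> tdeg U \<le> int ?B \<and> tdeg V \<le> int ?B"
    if i: "i \<in> {1..k}" for i
  proof -
    obtain U V where UV: "X (n + i) = pol U / pol V" "inner U" "inner V"
      "tdeg U \<le> int ((4 * k + 2) * (n + i) ^ 2)" "tdeg V \<le> int ((4 * k + 2) * (n + i) ^ 2)"
      by (rule X_form[of "n + i"]) (use i in auto)
    have "(4 * k + 2) * (n + i) ^ 2 \<le> ?B" using i by (intro mult_le_mono2 power_mono) auto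
    then have "int ((4 * k + 2) * (n + i) ^ 2) \<le> int ?B" by (rule of_nat_mono)
    then show ?thesis using UV by (meson order_trans)
  qed
  then obtain U V where UV: "\<And>i. i \<in> {1..k} \<Longrightarrow> X (n + i) = pol (U i) / pol (V i)"
    "\<And>i. i \<in> {1..k} \<Longrightarrow> inner (U i)" "\<And>i. i \<in> {1..k} \<Longrightarrow> inner (V i)"
    "\<And>i. i \<in> {1..k} \<Longrightarrow> tdeg (U i) \<le> int ?B" "\<And>i. i \<in> {1..k} \<Longrightarrow> tdeg (V i) \<le> int ?B" by metis
  define W where "W = (\<Prod>i\<in>{1..k}. V i)"
  define T where "T = (\<lambda>i. U i * (\<Prod>j\<in>{1..k} - {i}. V j))"
  have innerW: "inner W" unfolding W_def by (rule inner_prod) (use UV in auto)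
  have innerT: "inner (T i)" if "i \<in> {1..k}" for i
    unfolding T_def using that UV by (intro inner_mult inner_prod) auto
  have XT: "ratmap_iterate n (lyness_map k a) i = pol (T i) / pol W" if i: "i \<in> {1..k}" for i
  proof -
    have W: "W = V i * (\<Prod>j\<in>{1..k} - {i}. V j)" unfolding W_def using i by (simp add: prod.remove)
    have "(\<Prod>j\<in>{1..k} - {i}. V j) \<noteq> 0" using UV(3) by (auto simp: inner_def)
    then show ?thesis using iterate_lyness[of i n] i UV(1)[OF i] by (simp add: T_def W)
  qed
  have dW: "tdeg W \<le> int (k * ?B)"
  proof -
    have "tdeg W = (\<Sum>i\<in>{1..k}. tdeg (V i))" unfolding W_def by (rule wdeg_prod) (use UV in \<open>auto simp: inner_def\<close>)
    also have "\<dots> \<le> (\<Sum>i\<in>{1..k}. int ?B)" by (intro sum_mono UV)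
    finally show ?thesis by simp
  qed
  have dT: "tdeg (T i) \<le> int (k * ?B)" if i: "i \<in> {1..k}" for i
  proof -
    have nz: "V j \<noteq> 0" if "j \<in> {1..k}" for j using UV(3)[OF that] by (simp add: inner_def)
    have "tdeg (\<Prod>j\<in>{1..k} - {i}. V j) = (\<Sum>j\<in>{1..k} - {i}. tdeg (V j))"
      by (rule wdeg_prod) (use nz in auto)
    moreover have "(\<Prod>j\<in>{1..k} - {i}. V j) \<noteq> 0" using nz by simp
    ultimately have "tdeg (T i) = tdeg (U i) + (\<Sum>j\<in>{1..k} - {i}. tdeg (V j))"
      unfolding T_def using UV(2)[OF i] by (simp add: wdeg_mult inner_def)
    also have "\<dots> \<le> int ?B + (\<Sum>j\<in>{1..k} - {i}. int ?B)"
      using UV i by (intro add_mono sum_mono) auto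
    also have "\<dots> = (\<Sum>j\<in>{1..k}. int ?B)" using i by (simp only: sum.remove[of "{1..k}" i] finite_atLeastAtMost)
    finally show ?thesis by simp
  qed
  have below: "P \<in> polys_below (Suc k)" "vdeg 0 P = 0" if "inner P" for P
    using that unfolding inner_def polys_below_def by auto
  have nzW: "W \<noteq> 0" using innerW by (simp add: inner_def)
  show "iter_degree n \<le> k * ?B"
    by (rule ratmap_degree_exists(1)[OF XT nzW below[OF innerW] dW below[OF innerT] dT])
  show "\<exists>g. proj_extension k (ratmap_iterate n (lyness_map k a)) (iter_degree n) g"
    by (rule ratmap_degree_exists(2)[OF XT nzW below[OF innerW] dW below[OF innerT] dT])
qed

end

section \<open>Lower bounds by positive leading coefficients\<close>

lemma tendsto_power_quotient:
  assumes "e < E"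
  shows "((\<lambda>z::real. complex_of_real z ^ e / complex_of_real z ^ E) \<longlongrightarrow> 0) at_top"
proof -
  have "((\<lambda>z::real. inverse (z ^ (E - e))) \<longlongrightarrow> 0) at_top"
    by (intro tendsto_inverse_0_at_top filterlim_pow_at_top filterlim_ident) (use assms in auto)
  then have "((\<lambda>z::real. complex_of_real (inverse (z ^ (E - e)))) \<longlongrightarrow> complex_of_real 0) at_top"
    by (rule tendsto_of_real)
  moreover have "\<forall>\<^sub>F z::real in at_top. complex_of_real (inverse (z ^ (E - e))) = complex_of_real z ^ e / complex_of_real z ^ E"
    using eventually_gt_at_top[of 0]
  proof eventually_elim
    case (elim z)
    have "complex_of_real z ^ E = complex_of_real z ^ e * complex_of_real z ^ (E - e)"
      using assms by (simp flip: power_add)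
    then show ?case using elim by (simp add: field_simps)
  qed
  ultimately show ?thesis by (simp add: tendsto_cong)
qed

text \<open>p solves the tropical recurrence p n + p (n + k) = max (p (n + 1), ..., p (n + k - 1))
  with values 0 and 1; \<open>p_window\<close> says that the maximum is always 1.\<close>

locale lyness_growth = lyness_pattern +
  fixes p :: "nat \<Rightarrow> nat"
  assumes p_le: "j \<ge> 1 \<Longrightarrow> p j \<le> 1" and p_anti: "j \<ge> 1 \<Longrightarrow> p (j + k) = 1 - p j"
    and p_window: "n \<ge> 1 \<Longrightarrow> \<exists>j\<in>{n + 1..<n + k}. p j = 1"
begin

definition wt :: "nat \<Rightarrow> nat" where "wt i = (if i \<in> {1..k} then p i else 0)"

definition curve :: "real \<Rightarrow> nat \<Rightarrow> complex" where "curve z i = complex_of_real z ^ wt i"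

text \<open>Growth like L * z ^ e along the curve x i = z ^ p i. The positivity of L is what
  survives addition and division and rules out cancellation of leading terms.\<close>

definition asymp :: "ratfun \<Rightarrow> nat \<Rightarrow> (real \<Rightarrow> complex) \<Rightarrow> real \<Rightarrow> bool" where
  "asymp f e y L \<longleftrightarrow> L > 0 \<and> ((\<lambda>z. y z / complex_of_real z ^ e) \<longlongrightarrow> complex_of_real L) at_top \<and>
     (\<forall>\<^sub>F z in at_top. has_val (curve z) f (y z))"

text \<open>In the recurrence only the X j with p j = 1 contribute to the leading order, with
  positive coefficients; a and the terms with p j = 0 are of lower order. The new leading
  coefficient is K / L (n - k).\<close>

lemma X_growth:
  assumes "n \<ge> 1"
  shows "\<exists>y L. asymp (X n) (p n) y L"
  using assms
proof (induction n rule: less_induct)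
  case (less n)
  show ?case
  proof (cases "n \<le> k")
    case True
    have "\<forall>\<^sub>F z in at_top. complex_of_real z ^ p n / complex_of_real z ^ p n = complex_of_real 1"
      using eventually_gt_at_top[of 0] by eventually_elim simp
    then have "((\<lambda>z. complex_of_real z ^ p n / complex_of_real z ^ p n) \<longlongrightarrow> complex_of_real 1) at_top"
      by (rule tendsto_eventually)
    moreover have "has_val (curve z) (X n) (complex_of_real z ^ p n)" for z
      using has_val_var[of "curve z" n] True less.prems by (simp add: X_var curve_def wt_def)
    ultimately show ?thesis unfolding asymp_def
      by (intro exI[of _ "\<lambda>z. complex_of_real z ^ p n"] exI[of _ 1]) simp
  next
    case False
    have "\<exists>y L. asymp (X j) (p j) y L" if "j \<in> {n - k..<n}" for j
      by (rule less.IH) (use that False in auto)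
    then obtain y L where "\<And>j. j \<in> {n - k..<n} \<Longrightarrow> asymp (X j) (p j) (y j) (L j)" by metis
    then have yL: "\<And>j. j \<in> {n - k..<n} \<Longrightarrow> L j > 0"
      "\<And>j. j \<in> {n - k..<n} \<Longrightarrow> ((\<lambda>z. y j z / complex_of_real z ^ p j) \<longlongrightarrow> complex_of_real (L j)) at_top"
      "\<And>j. j \<in> {n - k..<n} \<Longrightarrow> \<forall>\<^sub>F z in at_top. has_val (curve z) (X j) (y j z)" by (simp_all add: asymp_def)
    let ?J = "{n - k + 1..<n}"
    have J: "j \<in> {n - k..<n}" "p j \<le> 1" if "j \<in> ?J" for j using that p_le[of j] False by auto
    have nk: "n - k \<in> {n - k..<n}" "n - k \<ge> 1" using False k3 by auto
    define K where "K = (\<Sum>j\<in>?J. if p j = 1 then L j else 0)"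
    define s where "s = (\<lambda>z. a + (\<Sum>j\<in>?J. y j z))"
    have "K > 0"
    proof -
      have n: "n - k + k = n" using False by simp
      obtain j where "j \<in> ?J" "p j = 1" using p_window[of "n - k"] nk unfolding n by blast
      then show ?thesis
        unfolding K_def using yL(1) J by (intro sum_pos2[of _ j]) (auto intro: less_imp_le)
    qed
    have lim_s: "((\<lambda>z. a * (complex_of_real z ^ 0 / complex_of_real z ^ 1) +
        (\<Sum>j\<in>?J. y j z / complex_of_real z ^ p j * (complex_of_real z ^ p j / complex_of_real z ^ 1))) \<longlongrightarrow>
        a * 0 + (\<Sum>j\<in>?J. complex_of_real (L j) * (if p j = 1 then 1 else 0))) at_top"
    proof (intro tendsto_add tendsto_sum tendsto_mult tendsto_const tendsto_power_quotient yL(2) J)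
      fix j assume j: "j \<in> ?J"
      show "((\<lambda>z. complex_of_real z ^ p j / complex_of_real z ^ 1) \<longlongrightarrow> (if p j = 1 then 1 else 0)) at_top"
      proof (cases "p j = 1")
        case True
        have "\<forall>\<^sub>F z in at_top. complex_of_real z ^ 1 / complex_of_real z ^ 1 = 1"
          using eventually_gt_at_top[of 0] by eventually_elim simp
        then show ?thesis unfolding True by (simp add: tendsto_eventually)
      next
        case False
        then have "p j = 0" using J(2)[OF j] by simp
        then show ?thesis using tendsto_power_quotient[of 0 1] False by simp
      qed
    qed simp
    have ev_s: "\<forall>\<^sub>F z in at_top. a * (complex_of_real z ^ 0 / complex_of_real z ^ 1) +
        (\<Sum>j\<in>?J. y j z / complex_of_real z ^ p j * (complex_of_real z ^ p j / complex_of_real z ^ 1)) = s z / complex_of_real z"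
      using eventually_gt_at_top[of 0]
    proof eventually_elim
      case (elim z)
      have "(\<Sum>j\<in>?J. y j z / complex_of_real z ^ p j * (complex_of_real z ^ p j / complex_of_real z ^ 1)) = (\<Sum>j\<in>?J. y j z / complex_of_real z)"
        using elim by (intro sum.cong) auto
      then show ?case by (simp add: s_def add_divide_distrib sum_divide_distrib)
    qed
    have "a * 0 + (\<Sum>j\<in>?J. complex_of_real (L j) * (if p j = 1 then 1 else 0)) = complex_of_real K"
      unfolding K_def of_real_sum by (simp add: if_distrib cong: if_cong)
    then have "((\<lambda>z. s z / complex_of_real z) \<longlongrightarrow> complex_of_real K) at_top"
      using Lim_transform_eventually[OF lim_s ev_s] by simp
    then have "((\<lambda>z. (s z / complex_of_real z) / (y (n - k) z / complex_of_real z ^ p (n - k))) \<longlongrightarrow>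
        complex_of_real K / complex_of_real (L (n - k))) at_top"
      using yL(1,2)[OF nk(1)] by (intro tendsto_divide) auto
    moreover have "\<forall>\<^sub>F z in at_top. (s z / complex_of_real z) / (y (n - k) z / complex_of_real z ^ p (n - k))
        = (s z / y (n - k) z) / complex_of_real z ^ p n"
      using eventually_gt_at_top[of 0]
    proof eventually_elim
      case (elim z)
      have "n - k + k = n" using False by simp
      then have "p n = 1 - p (n - k)" "p (n - k) \<le> 1" using p_anti[OF nk(2)] p_le[OF nk(2)] by auto
      then have "p n + p (n - k) = 1" by simp
      then have "complex_of_real z = complex_of_real z ^ p n * complex_of_real z ^ p (n - k)"
        by (metis power_add power_one_right)
      then have "(s z / complex_of_real z) / (y (n - k) z / complex_of_real z ^ p (n - k)) =
        (s z / (complex_of_real z ^ p n * complex_of_real z ^ p (n - k))) / (y (n - k) z / complex_of_real z ^ p (n - k))" by simp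
      then show ?case using elim by simp
    qed
    ultimately have lim: "((\<lambda>z. (s z / y (n - k) z) / complex_of_real z ^ p n) \<longlongrightarrow> complex_of_real (K / L (n - k))) at_top"
      using Lim_transform_eventually by fastforce
    have "\<forall>\<^sub>F z in at_top. y (n - k) z / complex_of_real z ^ p (n - k) \<noteq> 0"
      using tendsto_imp_eventually_ne[OF yL(2)[OF nk(1)], of 0] yL(1)[OF nk(1)] by simp
    moreover have "\<forall>\<^sub>F z in at_top. \<forall>j\<in>{n - k..<n}. has_val (curve z) (X j) (y j z)"
      by (intro eventually_ball_finite) (use yL(3) in auto)
    ultimately have "\<forall>\<^sub>F z in at_top. has_val (curve z) (X n) (s z / y (n - k) z)"
    proof eventually_elim
      case (elim z)
      then have "has_val (curve z) (rf_const a + (\<Sum>j\<in>?J. X j)) (s z)"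
        unfolding s_def by (intro has_val_add has_val_const has_val_sum) auto
      then have "has_val (curve z) ((rf_const a + (\<Sum>j\<in>?J. X j)) / X (n - k)) (s z / y (n - k) z)"
        using elim nk(1) by (intro has_val_divide) auto
      then show ?case using X_rec[of n] False by simp
    qed
    then show ?thesis unfolding asymp_def using lim \<open>K > 0\<close> yL(1)[OF nk(1)]
      by (intro exI[of _ "\<lambda>z. s z / y (n - k) z"] exI[of _ "K / L (n - k)"]) auto
  qed
qed

lemma tau_growth: "\<exists>y L. asymp (tau n) (\<Sum>i\<in>{1..n}. p i * c (int n - int i)) y L"
proof -
  have "\<exists>y L. asymp (X j) (p j) y L" if "j \<in> {1..n}" for j
    by (rule X_growth) (use that in auto)
  then obtain y L where "\<And>j. j \<in> {1..n} \<Longrightarrow> asymp (X j) (p j) (y j) (L j)" by metis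
  then have yL: "\<And>j. j \<in> {1..n} \<Longrightarrow> L j > 0"
    "\<And>j. j \<in> {1..n} \<Longrightarrow> ((\<lambda>z. y j z / complex_of_real z ^ p j) \<longlongrightarrow> complex_of_real (L j)) at_top"
    "\<And>j. j \<in> {1..n} \<Longrightarrow> \<forall>\<^sub>F z in at_top. has_val (curve z) (X j) (y j z)" by (simp_all add: asymp_def)
  define Y where "Y = (\<lambda>z. \<Prod>i\<in>{1..n}. y i z ^ c (int n - int i))"
  define K where "K = (\<Prod>i\<in>{1..n}. L i ^ c (int n - int i))"
  have "K > 0" unfolding K_def using yL(1) by (intro prod_pos) auto
  have "((\<lambda>z. \<Prod>i\<in>{1..n}. (y i z / complex_of_real z ^ p i) ^ c (int n - int i)) \<longlongrightarrow> (\<Prod>i\<in>{1..n}. complex_of_real (L i) ^ c (int n - int i))) at_top"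
    by (intro tendsto_prod tendsto_power yL)
  moreover have "(\<Prod>i\<in>{1..n}. (y i z / complex_of_real z ^ p i) ^ c (int n - int i)) = Y z / complex_of_real z ^ (\<Sum>i\<in>{1..n}. p i * c (int n - int i))" for z
    by (simp add: Y_def power_divide prod_dividef power_sum power_mult)
  ultimately have "((\<lambda>z. Y z / complex_of_real z ^ (\<Sum>i\<in>{1..n}. p i * c (int n - int i))) \<longlongrightarrow> complex_of_real K) at_top"
    by (simp add: K_def)
  moreover have "\<forall>\<^sub>F z in at_top. \<forall>j\<in>{1..n}. has_val (curve z) (X j) (y j z)"
    by (intro eventually_ball_finite) (use yL(3) in auto)
  then have "\<forall>\<^sub>F z in at_top. has_val (curve z) (tau n) (Y z)"
    by eventually_elim (auto simp: tau_def Y_def intro!: has_val_prod has_val_power)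
  ultimately show ?thesis using \<open>K > 0\<close> unfolding asymp_def by blast
qed

text \<open>A numerator of smaller weight would grow more slowly along the curve than tau n does,
  forcing L = 0.\<close>

lemma rdeg_tau_ge: "int (\<Sum>i\<in>{1..n}. p i * c (int n - int i)) \<le> rdeg (\<lambda>i. int (wt i)) (tau n)"
proof -
  define D where "D = (\<Sum>i\<in>{1..n}. p i * c (int n - int i))"
  define s where "s = (\<Sum>i\<in>{1..k}. wt i)"
  obtain y L where yL: "L > 0" "((\<lambda>z. y z / complex_of_real z ^ D) \<longlongrightarrow> complex_of_real L) at_top"
    "\<forall>\<^sub>F z in at_top. has_val (curve z) (tau n) (y z)"
    using tau_growth[of n] unfolding D_def asymp_def by blast
  obtain P r where P: "tau n * pol mx ^ r = pol P" using laurent_tau unfolding laurent_def by blast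
  have Pnz: "P \<noteq> 0" using P by auto
  let ?E = "D + r * s"
  have mxv: "has_val (curve z) (pol mx) (complex_of_real z ^ s)" for z
  proof -
    have "has_val (curve z) (pol mx) (\<Prod>i\<in>{1..k}. curve z i)"
      unfolding pol_mx by (intro has_val_prod has_val_var)
    then show ?thesis by (simp add: curve_def s_def power_sum)
  qed
  have "\<forall>\<^sub>F z in at_top. y z / complex_of_real z ^ D = peval id (curve z) P / complex_of_real z ^ ?E"
    using yL(3) eventually_gt_at_top[of 0]
  proof eventually_elim
    case (elim z)
    have "has_val (curve z) (pol P) (y z * (complex_of_real z ^ s) ^ r)"
      unfolding P[symmetric] using elim mxv by (intro has_val_mult has_val_power)
    then have "peval id (curve z) P = y z * (complex_of_real z ^ s) ^ r"
      using has_val_unique[OF has_val_pol] by blast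
    then show ?case using elim by (simp add: power_add power_mult[symmetric] mult.commute)
  qed
  then have lim: "((\<lambda>z. peval id (curve z) P / complex_of_real z ^ ?E) \<longlongrightarrow> complex_of_real L) at_top"
    by (rule Lim_transform_eventually[OF yL(2)])
  have "int ?E \<le> wdeg (\<lambda>i. int (wt i)) P"
  proof (rule ccontr)
    assume small: "\<not> ?thesis"
    have mon: "mon (curve z) m = complex_of_real z ^ nat (mweight (\<lambda>i. int (wt i)) m)" for z m
    proof -
      have "mweight (\<lambda>i. int (wt i)) m = int (\<Sum>i\<in>Poly_Mapping.keys m. wt i * Poly_Mapping.lookup m i)"
        by (simp add: mweight_def mult.commute)
      then show ?thesis by (simp only: nat_int) (simp add: mon_def curve_def power_sum power_mult)
    qed
    have "((\<lambda>z. \<Sum>m\<in>Poly_Mapping.keys P. Poly_Mapping.lookup P m * (complex_of_real z ^ nat (mweight (\<lambda>i. int (wt i)) m) / complex_of_real z ^ ?E)) \<longlongrightarrow>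
        (\<Sum>m\<in>Poly_Mapping.keys P. Poly_Mapping.lookup P m * 0)) at_top"
    proof (intro tendsto_sum tendsto_mult tendsto_const tendsto_power_quotient)
      fix m assume "m \<in> Poly_Mapping.keys P"
      then have "mweight (\<lambda>i. int (wt i)) m < int ?E" using wdeg_ge[of m P "\<lambda>i. int (wt i)"] small by linarith
      moreover have "mweight (\<lambda>i. int (wt i)) m \<ge> 0" unfolding mweight_def by (intro sum_nonneg) simp
      ultimately show "nat (mweight (\<lambda>i. int (wt i)) m) < ?E" by linarith
    qed
    then have "((\<lambda>z. peval id (curve z) P / complex_of_real z ^ ?E) \<longlongrightarrow> 0) at_top"
      by (simp add: peval_def mon sum_divide_distrib)
    then have "complex_of_real L = 0" using tendsto_unique[OF _ lim] by simp
    then show False using yL(1) by simp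
  qed
  also have "wdeg (\<lambda>i. int (wt i)) P = rdeg (\<lambda>i. int (wt i)) (tau n * pol mx ^ r)"
    unfolding P using Pnz by (simp add: rdeg_pol)
  also have "\<dots> = rdeg (\<lambda>i. int (wt i)) (tau n) + int r * int s"
    by (simp add: rdeg_mult rdeg_power rdeg_pol mx_def wdeg_prod s_def)
  finally show ?thesis by (simp add: D_def)
qed

end

section \<open>An explicit 0-1 solution and the lower bound for the reduced degree\<close>

context lyness_pattern
begin

text \<open>Blocks of length k alternate between 0, 1, 0, ..., 0 and the complement 1, 0, 1, ..., 1.
  With the lone 1 in second place no run of zeros is longer than k - 2, so each window of k - 1
  entries contains a 1.\<close>

definition pA :: "nat \<Rightarrow> nat" where
  "pA j = (if even ((j - 1) div k) then (if (j - 1) mod k = 1 then 1 else 0) else (if (j - 1) mod k = 1 then 0 else 1))"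

lemma pA_anti: "j \<ge> 1 \<Longrightarrow> pA (j + k) = 1 - pA j"
proof -
  assume "j \<ge> 1"
  then have e0: "j + k - 1 = (j - 1) + k" by simp
  have e: "(j + k - 1) div k = Suc ((j - 1) div k)" "(j + k - 1) mod k = (j - 1) mod k"
    unfolding e0 using k3 div_add_self2[of k "j - 1"] by simp_all
  show ?thesis unfolding pA_def e by simp
qed

lemma pA_window: 
  assumes "n \<ge> 1" shows "\<exists>j\<in>{n + 1..<n + k}. pA j = 1"
proof -
  define b r where "b = n div k" and "r = n mod k"
  have n: "n = k * b + r" and r: "r < k" using k3 by (simp_all add: b_def r_def)
  have val: "(k * b' + t) div k = b'" "(k * b' + t) mod k = t" if "t < k" for b' t
    using that k3 by simp_all
  have A: "pA (k * b' + t + 1) = (if even b' then (if t = 1 then 1 else 0) else (if t = 1 then 0 else 1))" if "t < k" for b' t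
    using val[OF that] by (simp add: pA_def)
  consider "even b" "r \<le> 1" | "even b" "r \<ge> 2" | "odd b" "r \<noteq> 1" "r \<le> k - 2" | "odd b" "r = 1" | "odd b" "r = k - 1"
    using r by linarith
  then show ?thesis
  proof cases
    case 1
    then show ?thesis using A[of 1 b] n k3 by (intro bexI[of _ "k * b + 1 + 1"]) auto
  next
    case 2
    then show ?thesis using A[of 0 "b + 1"] n r k3 by (intro bexI[of _ "k * (b + 1) + 0 + 1"]) (auto simp: algebra_simps)
  next
    case 3
    then show ?thesis using A[of r b] n r k3 by (intro bexI[of _ "k * b + r + 1"]) auto
  next
    case 4
    then show ?thesis using A[of 2 b] n r k3 by (intro bexI[of _ "k * b + 2 + 1"]) auto
  next
    case 5
    then show ?thesis using A[of "k - 1" b] n r k3 by (intro bexI[of _ "k * b + (k - 1) + 1"]) auto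
  qed
qed

lemma pA_le: "pA j \<le> 1"
  by (simp add: pA_def)

lemma growth_A: "lyness_growth k a pA"
  by unfold_locales (use pA_le pA_anti pA_window in auto)

lemma growth_B: "lyness_growth k a (\<lambda>j. pA (j + k))"
proof unfold_locales
  show "\<exists>j\<in>{n + 1..<n + k}. pA (j + k) = 1" if n: "n \<ge> 1" for n
  proof -
    obtain j where "j \<in> {n + k + 1..<n + k + k}" "pA j = 1" using pA_window[of "n + k"] n by auto
    then show ?thesis by (intro bexI[of _ "j - k"]) auto
  qed
qed (use pA_le pA_anti in auto)

lemma split_off_vars:
  assumes "F \<noteq> 0"
  shows "\<exists>\<alpha> P. F = (\<Prod>i\<in>{1..k}. mvar i ^ \<alpha> i) * P \<and> (\<forall>i\<in>{1..k}. \<not> mvar i dvd P)"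
  using assms
proof (induction "nat (tdeg F)" arbitrary: F rule: less_induct)
  case less
  show ?case
  proof (cases "\<exists>i\<in>{1..k}. mvar i dvd F")
    case False
    then show ?thesis by (intro exI[of _ "\<lambda>_. 0"] exI[of _ F]) auto
  next
    case True
    then obtain i G where i: "i \<in> {1..k}" "F = mvar i * G" by (auto simp: dvd_def)
    then have G: "G \<noteq> 0" using less.prems by auto
    have "tdeg F = 1 + tdeg G" using i G by (simp add: wdeg_mult)
    then have "nat (tdeg G) < nat (tdeg F)" using tdeg_nonneg[of G] by simp
    then obtain \<alpha> P where P: "G = (\<Prod>i\<in>{1..k}. mvar i ^ \<alpha> i) * P" "\<forall>i\<in>{1..k}. \<not> mvar i dvd P"
      using less.hyps G by blast
    have "(\<Prod>j\<in>{1..k}. mvar j ^ (\<alpha>(i := \<alpha> i + 1)) j) = (\<Prod>j\<in>{1..k}. mvar j ^ \<alpha> j * (if j = i then mvar i else 1))"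
      by (intro prod.cong) (auto simp: power_add)
    also have "\<dots> = (\<Prod>j\<in>{1..k}. mvar j ^ \<alpha> j) * mvar i"
      using i by (simp add: prod.distrib prod.delta)
    finally have "F = (\<Prod>j\<in>{1..k}. mvar j ^ (\<alpha>(i := \<alpha> i + 1)) j) * P"
      using i P(1) by (simp add: ac_simps)
    then show ?thesis using P(2) by blast
  qed
qed

lemma prime_dvd_mx:
  assumes p: "prime_elem p" "p dvd mx"
  obtains i where "i \<in> {1..k}" "mvar i dvd p"
proof -
  have "\<not> p dvd 1" using p(1) by (simp add: prime_elem_def)
  then have "\<exists>i\<in>S. p dvd mvar i" if "finite S" "p dvd (\<Prod>i\<in>S. mvar i)" for S
    using that(2) by (induction rule: finite_induct[OF that(1)]) (simp_all add: prime_elem_dvd_mult_iff[OF p(1)], blast)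
  then obtain i where i: "i \<in> {1..k}" "p dvd mvar i" using p(2) unfolding mx_def by blast
  then obtain u where u: "mvar i = p * u" by (auto simp: dvd_def)
  have "p * u \<noteq> 0" unfolding u[symmetric] by simp
  then have nz: "p \<noteq> 0" "u \<noteq> 0" by auto
  have "tdeg p + tdeg u = 1" using wdeg_mult[OF nz, of "\<lambda>_. 1"] u[symmetric] by simp
  moreover have "tdeg p > 0" using p(1) nz tdeg_nonneg[of p] mpoly_unit_iff[of p] by (auto simp: prime_elem_def)
  ultimately have "tdeg u = 0" using tdeg_nonneg[of u] by linarith
  then have "u dvd 1" using nz mpoly_unit_iff by blast
  then obtain w where w: "1 = u * w" by (auto simp: dvd_def)
  have "p = p * (u * w)" by (simp flip: w)
  then have "p = mvar i * w" unfolding u by (simp add: mult.assoc)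
  then show ?thesis using that i by simp
qed

text \<open>Instance of \<open>dvd_if_dvd_all_mult\<close> for the family P, Q, which has no common
  factor because it has no common prime.\<close>

lemma dvd_if_coprime:
  fixes P Q G :: mpoly
  assumes "P \<noteq> 0" "P dvd G * Q" "\<And>p. prime_elem p \<Longrightarrow> p dvd P \<Longrightarrow> \<not> p dvd Q"
  shows "P dvd G"
proof (rule dvd_if_dvd_all_mult[of P "{0, 1::nat}" "\<lambda>j. if j = 0 then P else Q"])
  show "P dvd (if j = 0 then P else Q) * G" if "j \<in> {0, 1}" for j
    using assms(2) by (auto simp: mult.commute)
  show "c dvd 1" if "\<forall>j\<in>{0, 1::nat}. c dvd (if j = 0 then P else Q)" for c
  proof (rule ccontr)
    assume nu: "\<not> c dvd 1"
    have c: "c dvd P" "c dvd Q" using that by auto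
    then have "c \<noteq> 0" using assms(1) by auto
    then obtain p where "prime_elem p" "p dvd c" using mpoly_prime_factor nu by blast
    then show False using assms(3) c dvd_trans by blast
  qed
qed (rule assms(1))

text \<open>Considers the first coordinate X (n + 1). Let P be the numerator of tau (n + 1) without
  its variable factors. Being coprime to the denominator tau functions and to mx, it divides the
  numerator of any presentation, so its degree bounds that of the iterate from below. The left side
  depends on P only, and is at most the degree of P because the weight of P for r does not exceed
  the one for q + r.\<close>

lemma iterate_degree_ge_weights:
  fixes q r :: "nat \<Rightarrow> int"
  assumes q: "\<And>i. i \<in> {1..k} \<Longrightarrow> 0 \<le> q i \<and> 0 \<le> r i \<and> q i + r i = 1"
    and q0: "\<And>i. i \<notin> {1..k} \<Longrightarrow> q i = 0" and r0: "\<And>i. i \<notin> {1..k} \<Longrightarrow> r i = 0"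
  shows "rdeg q (tau (n + 1)) + rdeg r (tau (n + 1)) - rdeg (\<lambda>i. if i \<in> {1..k} then 1 else 0) (tau (n + 1)) \<le> int (iter_degree n)"
proof -
  define N where "N = n + 1"
  obtain g where g: "proj_extension k (ratmap_iterate n (lyness_map k a)) (iter_degree n) g"
    using iterate_degree_upper(2) by blast
  obtain G0 G where G: "G0 \<noteq> 0" "\<And>i. i \<in> {1..k} \<Longrightarrow> ratmap_iterate n (lyness_map k a) i = pol (G i) / pol G0"
    "\<And>i. i \<in> {1..k} \<Longrightarrow> tdeg (G i) \<le> int (iter_degree n)"
    by (rule proj_extension_affine[OF g]) blast
  have k1: "1 \<in> {1..k}" using k3 by simp
  have XN: "X N = pol (G 1) / pol G0" using G(2)[OF k1] iterate_lyness[of 1 n] k3 by (simp add: N_def)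
  have G1nz: "G 1 \<noteq> 0" using XN X_neq_0[of N] by auto
  define n1 n2 n3 where "n1 = N - k" and "n2 = N - k - 1" and "n3 = N - 2 * k - 1"
  obtain A where A: "tau N * pol mx ^ (N ^ 2) = pol A" "inner A" by (rule tau_form)
  obtain B where B: "tau n1 * pol mx ^ (n1 ^ 2) = pol B" "inner B" by (rule tau_form)
  obtain C where C: "tau n2 * pol mx ^ (n2 ^ 2) = pol C" "inner C" by (rule tau_form)
  obtain D where D: "tau n3 * pol mx ^ (n3 ^ 2) = pol D" "inner D" by (rule tau_form)
  have Anz: "A \<noteq> 0" using A by (simp add: inner_def)
  obtain \<alpha> P where P: "A = (\<Prod>i\<in>{1..k}. mvar i ^ \<alpha> i) * P" "\<forall>i\<in>{1..k}. \<not> mvar i dvd P"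
    using split_off_vars[OF Anz] by blast
  have Pnz: "P \<noteq> 0" using P Anz by auto
  have pmx: "\<not> p dvd mx" if p: "prime_elem p" "p dvd P" for p
  proof
    assume "p dvd mx"
    then obtain i where "i \<in> {1..k}" "mvar i dvd p" by (rule prime_dvd_mx[OF p(1)])
    then show False using P(2) p(2) dvd_trans by blast
  qed
  have cop: "\<not> p dvd B * C * mx ^ e" if p: "prime_elem p" "p dvd P" for p e
  proof -
    note pm = pmx[OF p]
    have ld: "ldvd p (tau m)" if "tau m * pol mx ^ s = pol F" "p dvd F" for m s F
    proof -
      have "ldvd p (tau m * pol mx ^ s)" unfolding that(1) using that(2) p(1) by (simp only: ldvd_pol_iff)
      moreover have "lunit p (pol mx ^ s)" using pm lunit_power[OF p(1)] lunit_pol_iff[OF p(1)] by blast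
      ultimately show ?thesis by (rule ldvd_mult_lunit[OF p(1)])
    qed
    have "p dvd A" using p P(1) by simp
    then have "ldvd p (tau N)" using ld A(1) by blast
    then have "\<not> ldvd p (tau n1)" "\<not> ldvd p (tau n2)"
      using tau_coprime[of k p N] tau_coprime[of "k + 1" p N] k3 p(1) pm by (auto simp: n1_def n2_def)
    then have "\<not> p dvd B" "\<not> p dvd C" using ld B(1) C(1) by blast+
    then show ?thesis using p(1) pm prime_elem_dvd_power[OF p(1)] by (auto simp: prime_elem_dvd_mult_iff)
  qed
  have rel: "X N * (tau n1 * tau n2) = tau N * tau n3" using tau_rel[of N] by (simp add: n1_def n2_def n3_def N_def)
  have "pol (G 1) * (tau n1 * tau n2) = pol G0 * (tau N * tau n3)"
    using rel G(1) unfolding XN by (simp add: field_simps)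
  then have "pol (G 1) * (tau n1 * tau n2) * pol mx ^ (n1 ^ 2 + n2 ^ 2 + (N ^ 2 + n3 ^ 2)) =
      pol G0 * (tau N * tau n3) * pol mx ^ (n1 ^ 2 + n2 ^ 2 + (N ^ 2 + n3 ^ 2))" by simp
  then have "pol (G 1 * (B * C * mx ^ (N ^ 2 + n3 ^ 2))) = pol (A * (G0 * D * mx ^ (n1 ^ 2 + n2 ^ 2)))"
    by (simp add: A(1)[symmetric] B(1)[symmetric] C(1)[symmetric] D(1)[symmetric] power_add ac_simps)
  then have "A dvd G 1 * (B * C * mx ^ (N ^ 2 + n3 ^ 2))" by (simp only: pol_eq_iff dvd_triv_left)
  moreover have "P dvd A" using P(1) by simp
  ultimately have "P dvd G 1 * (B * C * mx ^ (N ^ 2 + n3 ^ 2))" by (rule dvd_trans[rotated])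
  then have "P dvd G 1" by (rule dvd_if_coprime[OF Pnz]) (rule cop)
  then obtain R where R: "G 1 = P * R" by (auto simp: dvd_def)
  then have "tdeg P \<le> tdeg (G 1)" using G1nz wdeg_mult[of P R "\<lambda>_. 1"] tdeg_nonneg[of R] by auto
  then have low: "tdeg P \<le> int (iter_degree n)" using G(3)[OF k1] by simp
  define o1 :: "nat \<Rightarrow> int" where "o1 = (\<lambda>i. if i \<in> {1..k} then 1 else 0)"
  have deg: "rdeg w (tau N) = wdeg w P + (\<Sum>i\<in>{1..k}. (int (\<alpha> i) - int (N ^ 2)) * w i)" for w
  proof -
    have "rdeg w (tau N) + int (N ^ 2) * (\<Sum>i\<in>{1..k}. w i) = wdeg w A"
      using arg_cong[OF A(1), of "rdeg w"] Anz by (simp add: rdeg_mult rdeg_power rdeg_pol mx_def wdeg_prod)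
    also have "wdeg w A = (\<Sum>i\<in>{1..k}. int (\<alpha> i) * w i) + wdeg w P"
      unfolding P(1) using Pnz by (simp add: wdeg_mult wdeg_prod wdeg_power)
    finally show ?thesis by (simp add: sum_subtractf left_diff_distrib sum_distrib_left)
  qed
  \<comment> \<open>The powers of variables contribute linearly in the weight and q + r = o1, so
    they drop out.\<close>
  have "(\<Sum>i\<in>{1..k}. (int (\<alpha> i) - int (N ^ 2)) * q i) + (\<Sum>i\<in>{1..k}. (int (\<alpha> i) - int (N ^ 2)) * r i)
     = (\<Sum>i\<in>{1..k}. (int (\<alpha> i) - int (N ^ 2)) * o1 i)"
    unfolding sum.distrib[symmetric] distrib_left[symmetric] by (intro sum.cong) (use q in \<open>auto simp: o1_def\<close>)
  then have "rdeg q (tau N) + rdeg r (tau N) - rdeg o1 (tau N) = wdeg q P + wdeg r P - wdeg o1 P"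
    unfolding deg by simp
  moreover have mono: "wdeg v P \<le> wdeg w P" if "\<And>i. v i \<le> w i" for v w
  proof (rule wdeg_leI[OF Pnz])
    fix m assume m: "m \<in> Poly_Mapping.keys P"
    have "mweight v m \<le> mweight w m" unfolding mweight_def using that by (intro sum_mono mult_left_mono) auto
    then show "mweight v m \<le> wdeg w P" using wdeg_ge[OF m, of w] by simp
  qed
  have "wdeg r P \<le> wdeg o1 P" by (rule mono) (use q r0 in \<open>force simp: o1_def\<close>)
  moreover have "q i \<le> 1" for i using q[of i] q0[of i] by (cases "i \<in> {1..k}") auto
  then have "wdeg q P \<le> tdeg P" by (rule mono)
  ultimately have "rdeg q (tau N) + rdeg r (tau N) - rdeg o1 (tau N) \<le> int (iter_degree n)" using low by linarith
  then show ?thesis by (simp add: N_def o1_def)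
qed

text \<open>The two weights are \<open>pA\<close> and its shift by k, which is 1 -
  \<open>pA\<close>. Their lower bounds add up to the sum of the c, from which the tropical upper
  bound for the weight 1 is subtracted.\<close>

lemma iterate_degree_lower_sum:
  defines "o1 \<equiv> \<lambda>i. if i \<in> {1..k} then 1 else (0::int)"
  shows "(\<Sum>i\<in>{1..n + 1}. int (c (int (n + 1) - int i)) * (1 - orb o1 i)) \<le> int (iter_degree n)"
proof -
  interpret A: lyness_growth k a pA by (rule growth_A)
  interpret B: lyness_growth k a "\<lambda>j. pA (j + k)" by (rule growth_B)
  let ?N = "n + 1"
  have "(\<Sum>i\<in>{1..?N}. int (c (int ?N - int i)) * (1 - orb o1 i)) =
     int (\<Sum>i\<in>{1..?N}. pA i * c (int ?N - int i)) + int (\<Sum>i\<in>{1..?N}. pA (i + k) * c (int ?N - int i))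
     - (\<Sum>i\<in>{1..?N}. int (c (int ?N - int i)) * orb o1 i)"
  proof -
    have "int (c (int ?N - int i)) * (1 - orb o1 i) = int (pA i * c (int ?N - int i)) + int (pA (i + k) * c (int ?N - int i)) - int (c (int ?N - int i)) * orb o1 i"
      if "i \<in> {1..?N}" for i
    proof -
      have "pA i + pA (i + k) = 1" using pA_anti[of i] pA_le[of i] that by simp
      then have "int (pA i) + int (pA (i + k)) = 1" by linarith
      then have "int (pA i * c (int ?N - int i)) + int (pA (i + k) * c (int ?N - int i)) = int (c (int ?N - int i))"
        by (metis distrib_right mult_1 of_nat_mult)
      then show ?thesis by (simp only: right_diff_distrib mult_1_right)
    qed
    then show ?thesis by (simp add: sum.distrib sum_subtractf)
  qed
  also have "\<dots> \<le> rdeg (\<lambda>i. int (A.wt i)) (tau ?N) + rdeg (\<lambda>i. int (B.wt i)) (tau ?N) - rdeg o1 (tau ?N)"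
    using A.rdeg_tau_ge[of ?N] B.rdeg_tau_ge[of ?N] rdeg_tau_le[of o1 ?N] by linarith
  also have "\<dots> \<le> int (iter_degree n)"
    unfolding o1_def
  proof (rule iterate_degree_ge_weights)
    fix i assume i: "i \<in> {1..k}"
    then have "pA i + pA (i + k) = 1" using pA_anti[of i] pA_le[of i] by simp
    then show "0 \<le> int (A.wt i) \<and> 0 \<le> int (B.wt i) \<and> int (A.wt i) + int (B.wt i) = 1"
      using i unfolding A.wt_def B.wt_def by simp
  qed (auto simp: A.wt_def B.wt_def)
  finally show ?thesis .
qed

text \<open>Only indices up to n div 2 are kept. There c is at least linear in n, and the deficits 1
  - \<open>orb o1 i\<close> have a sum growing linearly.\<close>

theorem iterate_degree_lower:
  "((n div 2) div (k * (k + 1))) * (k * ((n div 2) div (2 * k))) \<le> iter_degree n"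
proof -
  define o1 :: "nat \<Rightarrow> int" where "o1 = (\<lambda>i. if i \<in> {1..k} then 1 else 0)"
  have pot1: "pot o1 \<le> 1" using pot_small(4) by (simp add: o1_def)
  have orb1: "orb o1 i \<le> 1" for i using orb_le_pot[of o1 i] pot1 by simp
  define c0 where "c0 = (n div 2) div (k * (k + 1))"
  define b where "b = (n div 2) div (2 * k)"
  \<comment> \<open>By \<open>orb_pair_le\<close> the deficits at i and i + k add up to at least 1,
    so a block of 2 * k indices, made of k such pairs, contributes at least k.\<close>
  have blocks: "int (k * b') \<le> (\<Sum>i\<in>{1..2 * k * b'}. 1 - orb o1 i)" for b'
  proof (induction b')
    case (Suc b')
    let ?s = "2 * k * b'"
    have "{1..2 * k * Suc b'} = {1..?s} \<union> ({?s + 1..?s + k} \<union> {?s + k + 1..?s + k + k})" by auto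
    then have "(\<Sum>i\<in>{1..2 * k * Suc b'}. 1 - orb o1 i) = (\<Sum>i\<in>{1..?s}. 1 - orb o1 i) +
        (\<Sum>i\<in>{?s + 1..?s + k} \<union> {?s + k + 1..?s + k + k}. 1 - orb o1 i)"
      by (simp only:) (rule sum.union_disjoint, auto)
    also have "(\<Sum>i\<in>{?s + 1..?s + k} \<union> {?s + k + 1..?s + k + k}. 1 - orb o1 i) =
        (\<Sum>i\<in>{?s + 1..?s + k}. 1 - orb o1 i) + (\<Sum>i\<in>{?s + k + 1..?s + k + k}. 1 - orb o1 i)"
      by (rule sum.union_disjoint) auto
    also have "(\<Sum>i\<in>{?s + k + 1..?s + k + k}. 1 - orb o1 i) = (\<Sum>i\<in>{?s + 1..?s + k}. 1 - orb o1 (i + k))"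
      by (rule sum.reindex_bij_witness[of _ "\<lambda>i. i + k" "\<lambda>i. i - k"]) auto
    also have "(\<Sum>i\<in>{?s + 1..?s + k}. 1 - orb o1 i) + (\<Sum>i\<in>{?s + 1..?s + k}. 1 - orb o1 (i + k))
        = (\<Sum>i\<in>{?s + 1..?s + k}. (1 - orb o1 i) + (1 - orb o1 (i + k)))" by (rule sum.distrib[symmetric])
    finally have e: "(\<Sum>i\<in>{1..2 * k * Suc b'}. 1 - orb o1 i) = (\<Sum>i\<in>{1..?s}. 1 - orb o1 i) +
        (\<Sum>i\<in>{?s + 1..?s + k}. (1 - orb o1 i) + (1 - orb o1 (i + k)))" .
    have "(\<Sum>i\<in>{?s + 1..?s + k}. (1::int)) \<le> (\<Sum>i\<in>{?s + 1..?s + k}. (1 - orb o1 i) + (1 - orb o1 (i + k)))"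
    proof (rule sum_mono)
      fix i assume "i \<in> {?s + 1..?s + k}"
      then have "orb o1 i + orb o1 (i + k) \<le> 1" using orb_pair_le[of i o1] pot1 by simp
      then show "1 \<le> (1 - orb o1 i) + (1 - orb o1 (i + k))" by simp
    qed
    then show ?case unfolding e using Suc by simp
  qed simp
  have bn: "2 * k * b \<le> n div 2" unfolding b_def by (rule times_div_less_eq_dividend)
  have "int c0 * int (k * b) \<le> int c0 * (\<Sum>i\<in>{1..2 * k * b}. 1 - orb o1 i)"
    by (intro mult_left_mono blocks) simp
  also have "\<dots> = (\<Sum>i\<in>{1..2 * k * b}. int c0 * (1 - orb o1 i))" by (rule sum_distrib_left)
  also have "\<dots> \<le> (\<Sum>i\<in>{1..2 * k * b}. int (c (int (n + 1) - int i)) * (1 - orb o1 i))"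
  proof (rule sum_mono)
    fix i assume "i \<in> {1..2 * k * b}"
    then have i: "i \<le> n div 2" using bn by simp
    then have "n div 2 \<le> n + 1 - i" by linarith
    then have "c0 \<le> (n + 1 - i) div (k * (k + 1))" unfolding c0_def by (rule div_le_mono)
    also have "\<dots> \<le> c (int (n + 1 - i))" by (rule c_lower)
    also have "int (n + 1 - i) = int (n + 1) - int i" using i by simp
    finally show "int c0 * (1 - orb o1 i) \<le> int (c (int (n + 1) - int i)) * (1 - orb o1 i)"
      using orb1[of i] by (intro mult_right_mono) auto
  qed
  also have "\<dots> \<le> (\<Sum>i\<in>{1..n + 1}. int (c (int (n + 1) - int i)) * (1 - orb o1 i))"
    by (rule sum_mono2) (use bn orb1 in auto)
  also have "\<dots> \<le> int (iter_degree n)" using iterate_degree_lower_sum[of n] by (simp add: o1_def)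
  finally have "int (c0 * (k * b)) \<le> int (iter_degree n)" by (simp only: of_nat_mult)
  then show ?thesis by (simp only: of_nat_le_iff c0_def b_def)
qed

lemma iterate_degree_quadratic: "grows_quadratically iter_degree"
proof -
  define K where "K = real (k * (k + 1))"
  have K: "K \<ge> 2 * real k" "K > 0"
  proof -
    have "k * (k + 1) \<ge> 2 * k" using k3 by (simp add: mult.commute[of 2])
    then have "real (k * (k + 1)) \<ge> real (2 * k)" by (rule of_nat_mono)
    then show "K \<ge> 2 * real k" by (simp add: K_def)
    then show "K > 0" using k3 by simp
  qed
  define C where "C = real (k * ((4 * k + 2) * 4))"
  define c1 where "c1 = min C (real k / (4 * K) ^ 2)"
  have pos: "0 < c1" "c1 \<le> C" using k3 K by (simp_all add: c1_def C_def)
  have "\<forall>\<^sub>F n in sequentially. c1 * (real n)\<^sup>2 \<le> real (iter_degree n) \<and> real (iter_degree n) \<le> C * (real n)\<^sup>2"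
    \<comment> \<open>n \<ge> k gives (n + k)^2 \<le> 4 * n^2, the factor 4 in C; n \<ge> 4 * K + 2
      gives n div 2 \<ge> n / 4 + K, where K absorbs the rounding of the second division.\<close>
    using eventually_ge_at_top[of "k + nat \<lceil>4 * K + 2\<rceil>"]
  proof eventually_elim
    case (elim n)
    then have n: "n \<ge> k" "real n \<ge> 4 * K + 2" by linarith+
    have "(n + k)\<^sup>2 \<le> (2 * n)\<^sup>2" using n by (intro power_mono) auto
    then have "k * ((4 * k + 2) * (n + k)\<^sup>2) \<le> k * ((4 * k + 2) * (4 * n\<^sup>2))"
      by (intro mult_le_mono2) (simp add: power_mult_distrib)
    then have "iter_degree n \<le> k * ((4 * k + 2) * (4 * n\<^sup>2))" using iterate_degree_upper(1)[of n] by linarith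
    then have "real (iter_degree n) \<le> real (k * ((4 * k + 2) * (4 * n\<^sup>2)))" by (rule of_nat_mono)
    also have "\<dots> = C * (real n)\<^sup>2" by (simp add: C_def algebra_simps)
    finally have up: "real (iter_degree n) \<le> C * (real n)\<^sup>2" .
    have quot: "real n / (4 * K) \<le> real ((n div 2) div d)" if "real d \<le> K" "d > 0" for d
    proof -
      have "real n / 2 - 1 / 2 \<le> real (n div 2)" by linarith
      then have h: "real n / 4 + K \<le> real (n div 2)" using n(2) by linarith
      have dd: "real (n div 2) < real d * (real ((n div 2) div d) + 1)"
      proof -
        have "n div 2 < d * ((n div 2) div d + 1)"
          using that(2) dividend_less_times_div[of d "n div 2"] by (simp add: algebra_simps)
        then have "real (n div 2) < real (d * ((n div 2) div d + 1))" by (rule of_nat_less_iff[THEN iffD2])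
        then show ?thesis by simp
      qed
      also have "\<dots> \<le> K * (real ((n div 2) div d) + 1)" using that by (intro mult_right_mono) auto
      finally have "real n / 4 \<le> K * real ((n div 2) div d)" using h by (simp add: algebra_simps)
      then show ?thesis using K by (simp add: field_simps)
    qed
    have q1: "real n / (4 * K) \<le> real ((n div 2) div (k * (k + 1)))" by (rule quot) (use k3 in \<open>auto simp: K_def\<close>)
    have q2: "real n / (4 * K) \<le> real ((n div 2) div (2 * k))" by (rule quot) (use k3 K in auto)
    have "real k / (4 * K) ^ 2 * (real n)\<^sup>2 = (real n / (4 * K)) * (real k * (real n / (4 * K)))"
      by (simp add: power2_eq_square)
    also have "\<dots> \<le> real ((n div 2) div (k * (k + 1))) * (real k * real ((n div 2) div (2 * k)))"
      using q1 q2 K by (intro mult_mono mult_left_mono) auto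
    also have "\<dots> = real (((n div 2) div (k * (k + 1))) * (k * ((n div 2) div (2 * k))))" by simp
    also have "\<dots> \<le> real (iter_degree n)" using iterate_degree_lower[of n] by (rule of_nat_mono)
    finally have "real k / (4 * K) ^ 2 * (real n)\<^sup>2 \<le> real (iter_degree n)" .
    moreover have "c1 * (real n)\<^sup>2 \<le> real k / (4 * K) ^ 2 * (real n)\<^sup>2"
      by (intro mult_right_mono) (simp_all add: c1_def)
    ultimately show ?case using up by linarith
  qed
  then show ?thesis unfolding grows_quadratically_def using pos by blast
qed

end

theorem theorem0p2:
  fixes k :: nat and a :: complex
  assumes "k \<ge> 3"
    and "k > 3 \<or> a \<noteq> 1"
  shows "grows_quadratically (\<lambda>n. ratmap_degree k (ratmap_iterate n (lyness_map k a)))"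
proof -
  interpret lyness k a by unfold_locales (rule assms(1))
  interpret lyness_pattern k a by (rule lyness_pattern_holds[OF assms(2)])
  show ?thesis by (rule iterate_degree_quadratic)
qed

end
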